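(* Let $j\in\{1,\ldots,d\}$ be fixed and let $\alpha=(\alpha_1,\ldots,\alpha_d)$ satisfy $\alpha_j\ge-3/2$ and $\alpha_i\ge-1/2$ for $i\ne j$. If $\alpha_j\in\{-3/2\}\cup[-1/2,\infty)$ and $\alpha_i\in\{-1/2\}\cup[1/2,\infty)$ for all $i\ne j$, then $\{\widetilde T_t^{\alpha,\varphi,j}\}_{t\ge0}$ is a submarkovian (but not Markovian) symmetric diffusion semigroup on $(\mathbb{R}_+^d,dx)$ satisfying, for $1\le p\le\infty$, $$\|\widetilde T_t^{\alpha,\varphi,j}\|_{p\to p}\le e^{-2t}(\cosh 2t)^{-d/2},\qquad t>0.$$ If either $\alpha_j\notin\{-3/2\}\cup[-1/2,\infty)$ or $\alpha_i\notin\{-1/2\}\cup[1/2,\infty)$ for some $i\ne j$, then $\{\widetilde T_t^{\alpha,\varphi,j}\}_{t\ge0}$ is not an $L^p$-contractive semigroup, but there exists a constant $c=c(\alpha)>1$ such that, for $1\le p\le\infty$, $$\|\widetilde T_t^{\alpha,\varphi,j}\|_{p\to p}\le c\,e^{-2t}(\cosh 2t)^{-d/2},\qquad t>0.$$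
   Context: Notation: $d\ge 1$, $\mathbb{R}_+=(0,\infty)$, $L^p=L^p(\mathbb{R}_+^d,dx)$, $\|\cdot\|_{p\to p}$ is the operator norm on $L^p$, $\|x\|$ is the Euclidean norm, $\mathbf 1$ is the constant function $1$, $e_j$ is the $j$th coordinate vector, and $I_\nu$ is the modified Bessel function of the first kind of order $\nu$. The semigroup. For $\gamma\in(-1,\infty)^d$, $t>0$ and $x,y\in\mathbb{R}_+^d$, the heat kernel associated with Laguerre functions of Hermite type is $$G_t^{\gamma,\varphi}(x,y)=(\sinh 2t)^{-d}\exp\Big(-\tfrac12\coth(2t)\big(\|x\|^2+\|y\|^2\big)\Big)\prod_{i=1}^d\sqrt{x_iy_i}\,I_{\gamma_i}\Big(\frac{x_iy_i}{\sinh 2t}\Big).$$ The modified semigroup is given on all $L^p(\mathbb{R}_+^d,dx)$, $1\le p\le\infty$, by $$\widetilde T_t^{\alpha,\varphi,j}f(x)=e^{-2t}\int_{\mathbb{R}_+^d}G_t^{\alpha+e_j,\varphi}(x,y)f(y)\,dy,\quad x\in\mathbb{R}_+^d,\ t>0,$$ and $\widetilde T_0^{\alpha,\varphi,j}=\mathrm{Id}$. On $L^2$ it is the semigroup generated by a suitable self-adjoint extension of $L_{\alpha+e_j}^\varphi+2$, where $L_\gamma^\varphi=-\Delta+\|x\|^2+\sum_{i=1}^d x_i^{-2}(\gamma_i^2-\frac14)$. Definitions. On a $\sigma$-finite measure space $(X,\mu)$, a symmetric diffusion semigroup is a family of linear operators $\{T_t\}_{t\ge0}$, $T_0=\mathrm{Id}$,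 mapping a linear subspace of the measurable functions that contains all $L^p(X,\mu)$, $1\le p\le\infty$ (e.g. $L^1+L^\infty$) into measurable functions, such that: (i) for each $1\le p\le\infty$ every $T_t$ is a contraction on $L^p$ and $\{T_t\}_{t\ge0}$ is a semigroup there; (ii) each $T_t$ is self-adjoint on $L^2$; (iii) $\lim_{t\to0^+}T_tf=f$ in $L^2$ for each $f\in L^2$. It is Markovian if in addition (iv) $T_tf\ge0$ whenever $f\ge0$, for all $t$, and (v) $T_t\mathbf 1=\mathbf 1$ for all $t$. It is submarkovian if (i)-(iv) hold and (v') $T_t\mathbf 1\le\mathbf 1$ for all $t$. A semigroup $\{T_t\}_{t\ge 0}=\{\exp(-tL)\}_{t\ge0}$ generated by a positive self-adjoint operator $L$ on $L^2(X,\mu)$ is called $L^p$-contractive if $\|T_tf\|_p\le\|f\|_p$ for all $1\le p\le\infty$, all $t\ge0$ and all $f\in L^2\cap L^p(X,\mu)$. *)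

theory Defs
  imports "HOL-Analysis.Analysis" "HOL-Probability.Essential_Supremum"
begin

section \<open>Lebesgue spaces and operator norms\<close>

text \<open>
  Functions are real-valued and exponents \<open>p \<in> [1, \<infinity>]\<close> are of type \<^typ>\<open>ennreal\<close>.  Elements of
  \<open>L\<^sup>p\<close> are functions rather than equivalence classes; equalities of functions are therefore
  stated almost everywhere.
\<close>

definition Lp_norm :: "'a measure \<Rightarrow> ennreal \<Rightarrow> ('a \<Rightarrow> real) \<Rightarrow> ennreal" where
  "Lp_norm M p f =
    (if p = \<infinity> then esssup M (\<lambda>x. ennreal \<bar>f x\<bar>)
     else let I = (\<integral>\<^sup>+ x. ennreal (\<bar>f x\<bar> powr enn2real p) \<partial>M) in
       if I = \<infinity> then \<infinity> else ennreal (enn2real I powr (1 / enn2real p)))"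

definition Lp :: "'a measure \<Rightarrow> ennreal \<Rightarrow> ('a \<Rightarrow> real) set" where
  "Lp M p = {f \<in> borel_measurable M. Lp_norm M p f < \<infinity>}"

text \<open>The value is \<open>\<infinity>\<close> whenever \<open>T\<close> fails to map \<open>L\<^sup>p\<close> into \<open>L\<^sup>p\<close>.\<close>

definition Lp_opnorm :: "'a measure \<Rightarrow> ennreal \<Rightarrow> (('a \<Rightarrow> real) \<Rightarrow> ('a \<Rightarrow> real)) \<Rightarrow> ennreal" where
  "Lp_opnorm M p T =
    Inf {C. \<forall>f\<in>Lp M p. T f \<in> Lp M p \<and> Lp_norm M p (T f) \<le> C * Lp_norm M p f}"

section \<open>Diffusion semigroups\<close>

text \<open>
  \<open>D\<close> is the linear space of measurable functions on which the operators are defined.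
  The requirement that each \<open>T t\<close> respects almost everywhere equality on \<open>D\<close> expresses that it
  acts on equivalence classes.
\<close>

definition symmetric_diffusion_semigroup_on ::
  "'a measure \<Rightarrow> ('a \<Rightarrow> real) set \<Rightarrow> (real \<Rightarrow> ('a \<Rightarrow> real) \<Rightarrow> ('a \<Rightarrow> real)) \<Rightarrow> bool" where
  "symmetric_diffusion_semigroup_on M D T \<longleftrightarrow>
     sigma_finite_measure M \<and>
     D \<subseteq> borel_measurable M \<and>
     (\<forall>f\<in>D. \<forall>g\<in>D. \<forall>a b. (\<lambda>x. a * f x + b * g x) \<in> D) \<and>
     (\<forall>p\<ge>1. Lp M p \<subseteq> D) \<and>
     (\<forall>t\<ge>0. \<forall>f\<in>D. T t f \<in> borel_measurable M) \<and>
     (\<forall>t\<ge>0. \<forall>f\<in>D. \<forall>g\<in>D. (AE x in M. f x = g x) \<longrightarrow> (AE x in M. T t f x = T t g x)) \<and>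
     (\<forall>t\<ge>0. \<forall>f\<in>D. \<forall>g\<in>D. \<forall>a b.
        AE x in M. T t (\<lambda>x. a * f x + b * g x) x = a * T t f x + b * T t g x) \<and>
     (\<forall>f\<in>D. AE x in M. T 0 f x = f x) \<and>
     (\<comment> \<open>(i)\<close>
      \<forall>p\<ge>1. \<forall>f\<in>Lp M p.
        (\<forall>t\<ge>0. T t f \<in> Lp M p \<and> Lp_norm M p (T t f) \<le> Lp_norm M p f) \<and>
        (\<forall>s\<ge>0. \<forall>t\<ge>0. AE x in M. T (s + t) f x = T s (T t f) x)) \<and>
     (\<comment> \<open>(ii)\<close>
      \<forall>t\<ge>0. \<forall>f\<in>Lp M 2. \<forall>g\<in>Lp M 2. (LINT x|M. T t f x * g x) = (LINT x|M. f x * T t g x)) \<and>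
     (\<comment> \<open>(iii)\<close>
      \<forall>f\<in>Lp M 2. ((\<lambda>t. Lp_norm M 2 (\<lambda>x. T t f x - f x)) \<longlongrightarrow> 0) (at_right 0))"

definition positivity_preserving_on ::
  "'a measure \<Rightarrow> ('a \<Rightarrow> real) set \<Rightarrow> (real \<Rightarrow> ('a \<Rightarrow> real) \<Rightarrow> ('a \<Rightarrow> real)) \<Rightarrow> bool" where
  "positivity_preserving_on M D T \<longleftrightarrow>
     (\<forall>t\<ge>0. \<forall>f\<in>D. (AE x in M. 0 \<le> f x) \<longrightarrow> (AE x in M. 0 \<le> T t f x))"

definition markovian_diffusion_semigroup ::
  "'a measure \<Rightarrow> (real \<Rightarrow> ('a \<Rightarrow> real) \<Rightarrow> ('a \<Rightarrow> real)) \<Rightarrow> bool" where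
  "markovian_diffusion_semigroup M T \<longleftrightarrow>
     (\<exists>D. symmetric_diffusion_semigroup_on M D T \<and> positivity_preserving_on M D T \<and>
       (\<forall>t\<ge>0. AE x in M. T t (\<lambda>_. 1) x = 1))"

definition submarkovian_diffusion_semigroup ::
  "'a measure \<Rightarrow> (real \<Rightarrow> ('a \<Rightarrow> real) \<Rightarrow> ('a \<Rightarrow> real)) \<Rightarrow> bool" where
  "submarkovian_diffusion_semigroup M T \<longleftrightarrow>
     (\<exists>D. symmetric_diffusion_semigroup_on M D T \<and> positivity_preserving_on M D T \<and>
       (\<forall>t\<ge>0. AE x in M. T t (\<lambda>_. 1) x \<le> 1))"

text \<open>
  The property defining \<open>L\<^sup>p\<close>-contractivity of a semigroup generated by a positive self-adjoint
  operator on \<open>L\<^sup>2\<close>.  The existence of the generator is not part of the predicate, so that its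
  negation says that one of the inequalities fails.
\<close>

definition Lp_contractive ::
  "'a measure \<Rightarrow> (real \<Rightarrow> ('a \<Rightarrow> real) \<Rightarrow> ('a \<Rightarrow> real)) \<Rightarrow> bool" where
  "Lp_contractive M T \<longleftrightarrow>
     (\<forall>p\<ge>1. \<forall>t\<ge>0. \<forall>f \<in> Lp M 2 \<inter> Lp M p. Lp_norm M p (T t f) \<le> Lp_norm M p f)"

section \<open>The modified Laguerre semigroup\<close>

text \<open>Modified Bessel function of the first kind, for positive argument.  The reciprocal Gamma
  function is entire, so that no order has to be excluded.\<close>

definition bessel_I :: "real \<Rightarrow> real \<Rightarrow> real" where
  "bessel_I \<nu> z = (\<Sum>k. (z / 2) powr (2 * real k + \<nu>) * rGamma (real k + \<nu> + 1) / fact k)"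

definition Rplus :: "(real ^ 'n) measure" where
  "Rplus = restrict_space lborel {x. \<forall>i. 0 < x $ i}"

definition laguerre_kernel :: "real ^ 'n \<Rightarrow> real \<Rightarrow> real ^ 'n \<Rightarrow> real ^ 'n \<Rightarrow> real" where
  "laguerre_kernel \<gamma> t x y =
     (1 / sinh (2 * t)) ^ CARD('n) *
     exp (- (1 / 2) * (cosh (2 * t) / sinh (2 * t)) * ((norm x)\<^sup>2 + (norm y)\<^sup>2)) *
     (\<Prod>i\<in>UNIV. sqrt (x $ i * y $ i) * bessel_I (\<gamma> $ i) (x $ i * y $ i / sinh (2 * t)))"

definition modified_laguerre ::
  "real ^ 'n \<Rightarrow> 'n \<Rightarrow> real \<Rightarrow> (real ^ 'n \<Rightarrow> real) \<Rightarrow> (real ^ 'n \<Rightarrow> real)" where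
  "modified_laguerre \<alpha> j t f =
     (if t = 0 then f
      else (\<lambda>x. exp (- 2 * t) * (LINT y|Rplus. laguerre_kernel (\<alpha> + axis j 1) t x y * f y)))"

end

theory Submission
  imports Defs "HOL-Probability.Distributions"
begin

text \<open>
  With \<open>\<gamma> = \<alpha> + e\<^sub>j\<close>, so that every \<open>\<gamma>\<^sub>i \<ge> -1/2\<close>, the kernel is a product of one-dimensional kernels
  that only involve \<open>\<surd>z I\<^sub>\<nu>(z)\<close> at \<open>z = x y / sinh 2t\<close>.  Poisson's integral writes
  \<open>\<surd>(2\<pi>z) e\<^sup>-\<^sup>z I\<^sub>\<nu>(z)\<close> as the mean of \<open>(1 - u/2z)\<^sup>\<nu>\<^sup>-\<^sup>1\<^sup>/\<^sup>2\<close> over \<open>u < 2z\<close> under a Gamma distribution.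
  For \<open>\<nu> \<ge> 1/2\<close> the mean is at most \<open>1\<close>, hence \<open>\<surd>z I\<^sub>\<nu>(z) \<le> \<surd>(2/\<pi>) cosh z = \<surd>z I\<^bsub>-1/2\<^esub>(z)\<close>, and a Gaussian
  integral bounds the row sums of the kernel by \<open>(cosh 2t)\<^sup>-\<^sup>1\<^sup>/\<^sup>2\<close> in each coordinate; for
  \<open>-1/2 < \<nu> < 1/2\<close> a constant is lost.  Symmetry and Jensen's inequality turn row sums into
  \<open>L\<^sup>p\<close> bounds, and Weber's integral gives the semigroup law.
  For \<open>-1/2 < \<nu> < 1/2\<close> the mean is \<open>1 + \<kappa>/z + O(1/z\<^sup>2)\<close> with \<open>\<kappa> > 0\<close>.  For \<open>x\<close> near \<open>0\<close> and \<open>t\<close> much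
  smaller this is a gain of order \<open>t/x\<^sup>2\<close>, whereas \<open>e\<^sup>-\<^sup>2\<^sup>t\<close> and the remaining coordinates only lose \<open>O(t)\<close>;
  so the row sums exceed \<open>1\<close> on an open set and contractivity fails for \<open>p = \<infinity>\<close>.
\<close>

section \<open>Modified Bessel functions\<close>

text \<open>The dichotomy is the sign of the potential: the constant \<kappa> obtained below is (1/4
  - \<nu>^2)/2, so \<kappa>/z at z = x^2 / sinh 2t is, to first order, -t times the potential
  (\<nu>^2 - 1/4)/x^2. The order -1/2 is the Mehler kernel folded at 0, which integrates explicitly;
  it is therefore the comparison kernel of all upper bounds. The gain is of first order in S = sinh
  2t and only its coefficient grows as x approaches 0. Hence the losses linear in S need constants
  that are fixed before the scale x0 is chosen, and an error whose constant depends on x0 has to be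
  of second order in S. This decides which estimates are made. No generator is constructed.
  Symmetry, positivity and the semigroup law are read off the kernel; continuity in L^2 at t = 0 has
  no formula behind it and comes from concentration of the kernel near the diagonal, which gives
  pointwise convergence only inside open sets. Therefore indicators of open sets come first, and
  outer regularity and density do the rest.\<close>

definition bessel_term :: "real \<Rightarrow> real \<Rightarrow> nat \<Rightarrow> real" where
  "bessel_term \<nu> z k = (z / 2) powr (2 * real k + \<nu>) * rGamma (real k + \<nu> + 1) / fact k"

lemma rGamma_pos_real: "x > 0 \<Longrightarrow> rGamma (x::real) > 0"
  by (simp add: rGamma_inverse_Gamma)

lemma bessel_term_nonneg: "\<nu> > -1 \<Longrightarrow> 0 \<le> bessel_term \<nu> z k"
  unfolding bessel_term_def
  by (intro divide_nonneg_nonneg mult_nonneg_nonneg less_imp_le[OF rGamma_pos_real]) auto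

lemma bessel_term_Suc:
  assumes "\<nu> > -1" "z > 0"
  shows "bessel_term \<nu> z (Suc k) = bessel_term \<nu> z k * ((z/2)\<^sup>2 / ((real k + 1) * (real k + \<nu> + 1)))"
proof -
  have "2 * real (Suc k) + \<nu> = (2 * real k + \<nu>) + 2" by simp
  then have 1: "(z/2) powr (2 * real (Suc k) + \<nu>) = (z/2) powr (2 * real k + \<nu>) * (z/2)\<^sup>2"
    using assms by (simp only: powr_add) simp
  have "(real k + \<nu> + 1) * rGamma ((real k + \<nu> + 1) + 1) = rGamma (real k + \<nu> + 1)"
    by (rule rGamma_plus1)
  moreover have "real k + \<nu> + 1 \<noteq> 0" using assms by linarith
  ultimately have 2: "rGamma (real (Suc k) + \<nu> + 1) = rGamma (real k + \<nu> + 1) / (real k + \<nu> + 1)"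
    by (simp add: field_simps add_ac)
  show ?thesis unfolding bessel_term_def 1 2 by (simp add: field_simps)
qed

lemma summable_bessel_term:
  assumes "\<nu> > -1" "z > 0"
  shows "summable (bessel_term \<nu> z)"
proof (rule summable_ratio_test[of "1/2" "nat \<lceil>max 1 (2 * (z/2)\<^sup>2)\<rceil>"])
  fix k assume "nat \<lceil>max 1 (2 * (z/2)\<^sup>2)\<rceil> \<le> k"
  then have k: "real k \<ge> 1" "real k \<ge> 2 * (z/2)\<^sup>2" by linarith+
  have "real k \<le> 1 * (real k + \<nu> + 1)" using assms by simp
  with k(2) have "2 * (z/2)\<^sup>2 \<le> 1 * (real k + \<nu> + 1)" by (rule order_trans)
  also have "\<dots> \<le> (real k + 1) * (real k + \<nu> + 1)"
    using k assms by (intro mult_right_mono) auto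
  finally have "(z/2)\<^sup>2 / ((real k + 1) * (real k + \<nu> + 1)) \<le> 1/2"
    using k assms by (subst pos_divide_le_eq) auto
  then have "bessel_term \<nu> z k * ((z/2)\<^sup>2 / ((real k + 1) * (real k + \<nu> + 1))) \<le> bessel_term \<nu> z k * (1/2)"
    using assms by (intro mult_left_mono bessel_term_nonneg) auto
  then show "norm (bessel_term \<nu> z (Suc k)) \<le> 1/2 * norm (bessel_term \<nu> z k)"
    unfolding real_norm_def abs_of_nonneg[OF bessel_term_nonneg[OF assms(1)]]
    unfolding bessel_term_Suc[OF assms] by simp
qed simp

lemma bessel_I_eq: "bessel_I \<nu> z = (\<Sum>k. bessel_term \<nu> z k)"
  by (simp add: bessel_I_def bessel_term_def)

lemma bessel_I_nonneg: "\<nu> > -1 \<Longrightarrow> z > 0 \<Longrightarrow> 0 \<le> bessel_I \<nu> z"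
  unfolding bessel_I_eq by (intro suminf_nonneg summable_bessel_term bessel_term_nonneg)

lemma ennreal_bessel_I:
  "\<nu> > -1 \<Longrightarrow> z > 0 \<Longrightarrow> ennreal (bessel_I \<nu> z) = (\<Sum>k. ennreal (bessel_term \<nu> z k))"
  unfolding bessel_I_eq by (rule suminf_ennreal2[symmetric]) (auto intro: bessel_term_nonneg summable_bessel_term)

lemma measurable_bessel_I [measurable]: "bessel_I \<nu> \<in> borel_measurable borel"
  unfolding bessel_I_def[abs_def] by measurable

section \<open>Quadratic substitution and Gaussian moments\<close>

lemma nn_integral_square_substitution:
  fixes f :: "real \<Rightarrow> real"
  assumes [measurable]: "f \<in> borel_measurable borel" and nn: "\<And>x. x > 0 \<Longrightarrow> 0 \<le> f x"
  shows "(\<integral>\<^sup>+x\<in>{0<..}. ennreal (f x) \<partial>lborel) = (\<integral>\<^sup>+s\<in>{0<..}. ennreal (2 * s * f (s\<^sup>2)) \<partial>lborel)"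
proof -
  \<comment> \<open>Substitution is applied on compact intervals; the intervals up to n^2 and up to
    n correspond to each other and exhaust the half-line, so monotone convergence finishes.\<close>
  have fin: "(\<integral>\<^sup>+x. ennreal (f x) * indicator {0<..(real n)\<^sup>2} x \<partial>lborel) =
      (\<integral>\<^sup>+s. ennreal (2 * s * f (s\<^sup>2)) * indicator {0<..real n} s \<partial>lborel)" for n :: nat
  proof -
    have *: "(\<integral>\<^sup>+x. ennreal (f x * indicator {0^2..(real n)^2} x) \<partial>lborel) =
      (\<integral>\<^sup>+s. ennreal (f (s^2) * (2 * s) * indicator {0..real n} s) \<partial>lborel)"
      by (rule nn_integral_substitution[where g = "\<lambda>x. x ^ 2" and g' = "\<lambda>x. 2 * x"])
         (auto intro!: derivative_eq_intros continuous_intros simp: set_borel_measurable_def)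
    have "(\<integral>\<^sup>+x. ennreal (f x) * indicator {0<..(real n)\<^sup>2} x \<partial>lborel) =
       (\<integral>\<^sup>+x. ennreal (f x * indicator {0^2..(real n)^2} x) \<partial>lborel)"
      by (rule nn_integral_cong_AE, rule AE_mp[OF AE_lborel_singleton[of 0]]) (auto simp: indicator_def)
    also have "\<dots> = (\<integral>\<^sup>+s. ennreal (2 * s * f (s\<^sup>2)) * indicator {0<..real n} s \<partial>lborel)"
      unfolding * by (rule nn_integral_cong_AE, rule AE_mp[OF AE_lborel_singleton[of 0]])
        (auto simp: indicator_def mult_ac)
    finally show ?thesis .
  qed
  have mono: "mono (\<lambda>n x. ennreal (h x) * indicator {0<..b n} x)" if "mono b"
    for h :: "real \<Rightarrow> real" and b :: "nat \<Rightarrow> real"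
    using that by (auto simp: mono_def le_fun_def indicator_def intro: order_trans)
  have sup: "(SUP n. ennreal (h x) * indicator {0<..b n} x) = ennreal (h x) * indicator {0<..} x"
    if b: "filterlim b at_top sequentially" for h :: "real \<Rightarrow> real" and b :: "nat \<Rightarrow> real" and x
  proof (rule antisym)
    show "(SUP n. ennreal (h x) * indicator {0<..b n} x) \<le> ennreal (h x) * indicator {0<..} x"
      by (rule SUP_least) (auto simp: indicator_def)
    have "\<forall>\<^sub>F n in sequentially. x \<le> b n" using b by (simp add: filterlim_at_top)
    then obtain n where "x \<le> b n" using eventually_happens'[OF sequentially_bot] by blast
    then show "ennreal (h x) * indicator {0<..} x \<le> (SUP n. ennreal (h x) * indicator {0<..b n} x)"
      by (intro SUP_upper2[of n]) (auto simp: indicator_def)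
  qed
  have lim: "(\<integral>\<^sup>+x. ennreal (h x) * indicator {0<..} x \<partial>lborel) =
      (SUP n. (\<integral>\<^sup>+x. ennreal (h x) * indicator {0<..b n} x \<partial>lborel))"
    if "h \<in> borel_measurable borel" "mono b" "filterlim b at_top sequentially"
    for h :: "real \<Rightarrow> real" and b :: "nat \<Rightarrow> real"
    using that by (subst sup[OF that(3), symmetric], intro nn_integral_monotone_convergence_SUP mono) auto
  have r: "mono real" "filterlim real at_top sequentially" "mono (\<lambda>n. (real n)\<^sup>2)"
    "filterlim (\<lambda>n. (real n)\<^sup>2) at_top sequentially"
       apply (simp add: mono_def)
      apply (rule filterlim_real_sequentially)
     apply (simp add: mono_def power_mono)
    apply (intro filterlim_pow_at_top filterlim_real_sequentially) apply simp
    done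
  show ?thesis
    by (subst lim[OF _ r(3,4)], simp, subst lim[OF _ r(1,2)], measurable) (simp only: fin)
qed

text \<open>Euler's integral for Gamma, rescaled by \<open>p\<close> and then pulled back along t =
  z^2. The exponent has this form because z times two Bessel terms with indices m and n is a
  multiple of z to the power 2 * \<mu> - 1 with \<mu> = m + n + \<nu> + 1.\<close>

lemma nn_integral_gaussian_power:
  assumes "\<mu> > 0" "p > 0"
  shows "(\<integral>\<^sup>+z\<in>{0<..}. ennreal (exp (- p * z\<^sup>2) * z powr (2 * \<mu> - 1)) \<partial>lborel) =
    ennreal (Gamma \<mu> * p powr (- \<mu>) / 2)"
proof -
  have "ennreal (Gamma \<mu>) = (\<integral>\<^sup>+t. ennreal (indicator {0..} t * t powr (\<mu> - 1) / exp t) \<partial>lborel)"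
    by (rule Gamma_conv_nn_integral_real[OF assms(1)])
  also have "\<dots> = ennreal p * (\<integral>\<^sup>+t. ennreal (indicator {0..} (0 + p*t) * (0 + p*t) powr (\<mu> - 1) / exp (0 + p*t)) \<partial>lborel)"
    using assms by (subst nn_integral_real_affine[where c=p and t=0]) auto
  also have "(\<integral>\<^sup>+t. ennreal (indicator {0..} (0 + p*t) * (0 + p*t) powr (\<mu> - 1) / exp (0 + p*t)) \<partial>lborel)
     = (\<integral>\<^sup>+t\<in>{0<..}. ennreal ((p*t) powr (\<mu> - 1) * exp (-p*t)) \<partial>lborel)"
    by (insert assms, rule nn_integral_cong_AE, rule AE_mp[OF AE_lborel_singleton[of 0]])
      (auto simp: indicator_def zero_le_mult_iff exp_minus field_simps)
  also have "\<dots> = (\<integral>\<^sup>+s\<in>{0<..}. ennreal (2 * s * ((p * s\<^sup>2) powr (\<mu> - 1) * exp (-p * s\<^sup>2))) \<partial>lborel)"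
    by (rule nn_integral_square_substitution) auto
  also have "\<dots> = (\<integral>\<^sup>+s. ennreal (2 * p powr (\<mu> - 1)) * (ennreal (exp (- p * s\<^sup>2) * s powr (2 * \<mu> - 1)) * indicator {0<..} s) \<partial>lborel)"
  proof (intro nn_integral_cong)
    fix s :: real
    show "ennreal (2 * s * ((p * s\<^sup>2) powr (\<mu> - 1) * exp (-p * s\<^sup>2))) * indicator {0<..} s =
      ennreal (2 * p powr (\<mu> - 1)) * (ennreal (exp (- p * s\<^sup>2) * s powr (2 * \<mu> - 1)) * indicator {0<..} s)"
    proof (cases "s > 0")
      case True
      have "s powr (2 * \<mu> - 1) = s powr (1 + 2 * (\<mu> - 1))" by (simp add: algebra_simps)
      also have "\<dots> = s powr 1 * (s powr 2) powr (\<mu> - 1)"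
        by (simp only: powr_add powr_powr)
      also have "\<dots> = s * (s\<^sup>2) powr (\<mu> - 1)" using True by simp
      finally have "2 * s * ((p * s\<^sup>2) powr (\<mu> - 1) * exp (-p * s\<^sup>2)) = 2 * p powr (\<mu> - 1) * (exp (- p * s\<^sup>2) * s powr (2 * \<mu> - 1))"
        using assms True by (simp add: powr_mult)
      then show ?thesis using True by (simp add: ennreal_mult[symmetric])
    qed auto
  qed
  also have "\<dots> = ennreal (2 * p powr (\<mu> - 1)) * (\<integral>\<^sup>+s\<in>{0<..}. ennreal (exp (- p * s\<^sup>2) * s powr (2 * \<mu> - 1)) \<partial>lborel)"
    by (subst nn_integral_cmult) auto
  finally have *: "ennreal (Gamma \<mu>) = ennreal (2 * p powr \<mu>) * (\<integral>\<^sup>+s\<in>{0<..}. ennreal (exp (- p * s\<^sup>2) * s powr (2 * \<mu> - 1)) \<partial>lborel)" (is "_ = _ * ?I")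
    using assms by (simp add: mult.assoc[symmetric] ennreal_mult[symmetric] powr_diff)
  have "ennreal (p powr (-\<mu>) / 2) * ennreal (Gamma \<mu>) = ennreal (p powr (-\<mu>) / 2 * (2 * p powr \<mu>)) * ?I"
    unfolding * by (subst ennreal_mult) (auto simp: mult.assoc)
  also have "p powr (-\<mu>) / 2 * (2 * p powr \<mu>) = 1" using assms by (simp add: powr_minus)
  finally show ?thesis using assms by (simp add: ennreal_mult[symmetric] mult_ac)
qed

section \<open>Weber's second exponential integral\<close>

text \<open>Vandermonde's convolution for \<open>(m + (n + \<nu>)) gchoose n\<close>. On the left
  \<open>m\<close> and \<open>n\<close> are coupled by the Gamma factor; on the right each summand
  is a factor in k and m times a factor in k and n. This is what lets the double series in Weber's
  integral be summed one index at a time.\<close>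

lemma bessel_product_coefficient:
  fixes \<nu> :: real
  assumes "\<nu> > -1"
  shows "Gamma (real m + real n + \<nu> + 1) * rGamma (real m + \<nu> + 1) * rGamma (real n + \<nu> + 1) / (fact m * fact n)
    = (\<Sum>k\<le>n. if k \<le> m then rGamma (real k + \<nu> + 1) / (fact k * fact (m - k) * fact (n - k)) else 0)"
proof -
  have pos: "real k + \<nu> + 1 > 0" for k using assms by simp
  have nz: "Gamma (real k + \<nu> + 1) \<noteq> 0" for k using Gamma_real_pos[OF pos[of k]] by simp
  have np: "x > 0 \<Longrightarrow> x \<notin> \<int>\<^sub>\<le>\<^sub>0" for x :: real using nonpos_Ints_nonpos[of x] by auto
  have 1: "(real m + (real n + \<nu>)) gchoose n = Gamma (real m + real n + \<nu> + 1) / (fact n * Gamma (real m + \<nu> + 1))"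
    using assms by (subst gbinomial_Gamma) (auto simp: add_ac intro!: np)
  have 2: "(real n + \<nu>) gchoose (n - k) = Gamma (real n + \<nu> + 1) / (fact (n - k) * Gamma (real k + \<nu> + 1))"
    if "k \<le> n" for k
    using assms that by (subst gbinomial_Gamma) (auto simp: add_ac of_nat_diff intro!: np)
  have 3: "(real m gchoose k) = (if k \<le> m then fact m / (fact k * fact (m - k)) else 0)" for k
    by (auto simp: binomial_gbinomial[symmetric] binomial_fact)
  have "Gamma (real m + real n + \<nu> + 1) * rGamma (real m + \<nu> + 1) * rGamma (real n + \<nu> + 1) / (fact m * fact n)
    = ((real m + (real n + \<nu>)) gchoose n) * (rGamma (real n + \<nu> + 1) / fact m)"
    unfolding 1 using nz by (simp add: rGamma_inverse_Gamma field_simps)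
  also have "\<dots> = (\<Sum>k\<le>n. (real m gchoose k) * ((real n + \<nu>) gchoose (n - k)) * (rGamma (real n + \<nu> + 1) / fact m))"
    by (simp only: gbinomial_Vandermonde[of "real m" "real n + \<nu>" n, symmetric] sum_distrib_right atMost_atLeast0)
  also have "\<dots> = (\<Sum>k\<le>n. if k \<le> m then rGamma (real k + \<nu> + 1) / (fact k * fact (m - k) * fact (n - k)) else 0)"
  proof (intro sum.cong refl)
    fix k assume "k \<in> {..n}"
    then have k: "k \<le> n" by simp
    show "(real m gchoose k) * ((real n + \<nu>) gchoose (n - k)) * (rGamma (real n + \<nu> + 1) / fact m) =
        (if k \<le> m then rGamma (real k + \<nu> + 1) / (fact k * fact (m - k) * fact (n - k)) else 0)"
      unfolding 2[OF k] 3 using nz[of k] nz[of n] by (simp add: rGamma_inverse_Gamma field_simps)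
  qed
  finally show ?thesis .
qed

lemma suminf_ennreal_commute:
  fixes f :: "nat \<Rightarrow> nat \<Rightarrow> ennreal"
  shows "(\<Sum>m. \<Sum>n. f m n) = (\<Sum>n. \<Sum>m. f m n)"
  using nn_integral_suminf[of f "count_space UNIV"]
  by (simp add: nn_integral_count_space_nat)

lemma suminf_ennreal_shifted_exp:
  assumes "u \<ge> 0"
  shows "(\<Sum>m. if k \<le> m then ennreal (u ^ m / fact (m - k)) else 0) = ennreal (u ^ k * exp u)"
proof -
  let ?f = "\<lambda>m. if k \<le> m then u ^ m / fact (m - k) else 0"
  have "(\<lambda>m. u ^ k * (u ^ m /\<^sub>R fact m)) sums (u ^ k * exp u)"
    by (intro sums_mult exp_converges)
  then have "(\<lambda>m. ?f (m + k)) sums (u ^ k * exp u)"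
    by (simp add: power_add field_simps)
  then have "?f sums (u ^ k * exp u)"
    by (subst (asm) sums_iff_shift) simp
  then have "(\<lambda>m. ennreal (?f m)) sums ennreal (u ^ k * exp u)"
    using assms by (subst sums_ennreal) auto
  then show ?thesis
    by (auto simp: sums_iff if_distrib[of ennreal] cong: if_cong)
qed

text \<open>Both Bessel functions are expanded and integrated termwise. After the Vandermonde
  splitting the sums over m and n are exponential series shifted by k, and the remaining sum over k
  is again a Bessel series. All terms are nonnegative extended reals, so every interchange is
  Tonelli's theorem.\<close>

lemma weber_second_exponential_integral:
  fixes \<nu> a b p :: real
  assumes \<nu>: "\<nu> > -1" and a: "a > 0" and b: "b > 0" and p: "p > 0"
  shows "(\<integral>\<^sup>+z\<in>{0<..}. ennreal (exp (- p * z\<^sup>2) * (z * (bessel_I \<nu> (a * z) * bessel_I \<nu> (b * z)))) \<partial>lborel)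
    = ennreal (exp ((a\<^sup>2 + b\<^sup>2) / (4 * p)) / (2 * p) * bessel_I \<nu> (a * b / (2 * p)))"
proof -
  \<comment> \<open>The factor exp (u + v) is the exponential of the result, u * v is the square of
    half the resulting Bessel argument, and \<open>W\<close> collects what is common to all
    terms.\<close>
  define u v W where "u = a\<^sup>2 / (4 * p)" and "v = b\<^sup>2 / (4 * p)" and "W = (a * b / (4 * p)) powr \<nu> / (2 * p)"
  have uv: "u > 0" "v > 0" "W > 0" using a b p by (auto simp: u_def v_def W_def)
  have rG: "rGamma (real k + \<nu> + 1) \<ge> 0" for k using rGamma_pos_real[of "real k + \<nu> + 1"] \<nu> by simp
  define T where "T m n z = exp (- p * z\<^sup>2) * (z * (bessel_term \<nu> (a * z) m * bessel_term \<nu> (b * z) n))" for m n z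
  have Tnn: "T m n z \<ge> 0" if "z > 0" for m n z
    using that \<nu> unfolding T_def by (intro mult_nonneg_nonneg bessel_term_nonneg) auto
  have Tm [measurable]: "T m n \<in> borel_measurable borel" for m n
    unfolding T_def[abs_def] bessel_term_def by measurable
  have int_T: "(\<integral>\<^sup>+z\<in>{0<..}. ennreal (T m n z) \<partial>lborel) =
      ennreal (W * u ^ m * v ^ n * (Gamma (real m + real n + \<nu> + 1) * rGamma (real m + \<nu> + 1) * rGamma (real n + \<nu> + 1) / (fact m * fact n)))"
    for m n
  proof -
    define \<mu> where "\<mu> = real m + real n + \<nu> + 1"
    have \<mu>: "\<mu> > 0" using \<nu> by (simp add: \<mu>_def)
    define A where "A = (a/2) powr (2 * real m + \<nu>) * (b/2) powr (2 * real n + \<nu>) *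
      (rGamma (real m + \<nu> + 1) * rGamma (real n + \<nu> + 1) / (fact m * fact n))"
    have A: "A \<ge> 0" using rG unfolding A_def by (intro mult_nonneg_nonneg divide_nonneg_nonneg) auto
    have "T m n z = A * (exp (- p * z\<^sup>2) * z powr (2 * \<mu> - 1))" if z: "z > 0" for z
    proof -
      have "2 * \<mu> - 1 = 1 + ((2 * real m + \<nu>) + (2 * real n + \<nu>))" by (simp add: \<mu>_def)
      then have "z powr (2 * \<mu> - 1) = z * (z powr (2 * real m + \<nu>) * z powr (2 * real n + \<nu>))"
        using z by (simp only: powr_add powr_one)
      moreover have "(a * z / 2) powr e = (a / 2) powr e * z powr e"
        "(b * z / 2) powr e = (b / 2) powr e * z powr e" for e
        using a b z powr_mult[of "a/2" z e] powr_mult[of "b/2" z e] by (simp_all add: mult_ac)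
      ultimately show ?thesis unfolding T_def bessel_term_def A_def by (simp add: field_simps)
    qed
    then have "(\<integral>\<^sup>+z\<in>{0<..}. ennreal (T m n z) \<partial>lborel) =
      (\<integral>\<^sup>+z. ennreal A * (ennreal (exp (- p * z\<^sup>2) * z powr (2 * \<mu> - 1)) * indicator {0<..} z) \<partial>lborel)"
      using A by (intro nn_integral_cong) (auto simp: indicator_def ennreal_mult[symmetric])
    also have "\<dots> = ennreal A * ennreal (Gamma \<mu> * p powr (- \<mu>) / 2)"
      by (subst nn_integral_cmult, measurable, subst nn_integral_gaussian_power[OF \<mu> p], rule refl)
    also have "\<dots> = ennreal (A * (Gamma \<mu> * p powr (- \<mu>) / 2))"
      using A \<mu> by (intro ennreal_mult[symmetric]) (auto intro!: mult_nonneg_nonneg less_imp_le[OF Gamma_real_pos])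
    also have "A * (Gamma \<mu> * p powr (- \<mu>) / 2) =
      W * u ^ m * v ^ n * (Gamma (real m + real n + \<nu> + 1) * rGamma (real m + \<nu> + 1) * rGamma (real n + \<nu> + 1) / (fact m * fact n))"
    proof -
      have "p powr (-\<mu>) = p powr (- real m) * p powr (- real n) * p powr (-\<nu>) * p powr (-1)"
        unfolding powr_add[symmetric] by (rule arg_cong[where f="\<lambda>x. p powr x"]) (simp add: \<mu>_def)
      also have "\<dots> = 1 / p ^ m * (1 / p ^ n) * (1 / p powr \<nu>) * (1 / p)"
        using p by (simp add: powr_minus powr_realpow field_simps)
      finally have P: "p powr (-\<mu>) = 1 / p ^ m * (1 / p ^ n) * (1 / p powr \<nu>) * (1 / p)" .
      have c: "c powr (2 * real k + \<nu>) = (c\<^sup>2) ^ k * c powr \<nu>" if "c > 0" for c k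
      proof -
        have "c powr (2 * real k) = (c\<^sup>2) ^ k"
          using that by (simp add: powr_powr[symmetric] powr_realpow)
        then show ?thesis by (simp add: powr_add)
      qed
      have W: "W = (a/2) powr \<nu> * (b/2) powr \<nu> / p powr \<nu> / (2 * p)"
        using a b p by (simp add: W_def powr_mult[symmetric] powr_divide[symmetric])
      have u: "u ^ m = ((a/2)\<^sup>2) ^ m / p ^ m" and v: "v ^ n = ((b/2)\<^sup>2) ^ n / p ^ n"
        by (simp_all add: u_def v_def power_divide power_mult_distrib)
      have ca: "(a/2) powr (2 * real m + \<nu>) = ((a/2)\<^sup>2) ^ m * (a/2) powr \<nu>"
        and cb: "(b/2) powr (2 * real n + \<nu>) = ((b/2)\<^sup>2) ^ n * (b/2) powr \<nu>"
        using a b by (simp_all only: c half_gt_zero)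
      show ?thesis
        unfolding A_def P \<mu>_def[symmetric] W u v ca cb using p by (simp add: field_simps)
    qed
    finally show ?thesis .
  qed
  have "(\<integral>\<^sup>+z\<in>{0<..}. ennreal (exp (- p * z\<^sup>2) * (z * (bessel_I \<nu> (a * z) * bessel_I \<nu> (b * z)))) \<partial>lborel)
      = (\<integral>\<^sup>+z. (\<Sum>m. \<Sum>n. ennreal (T m n z) * indicator {0<..} z) \<partial>lborel)"
  proof (intro nn_integral_cong)
    fix z :: real
    show "ennreal (exp (- p * z\<^sup>2) * (z * (bessel_I \<nu> (a * z) * bessel_I \<nu> (b * z)))) * indicator {0<..} z =
      (\<Sum>m. \<Sum>n. ennreal (T m n z) * indicator {0<..} z)"
    proof (cases "z > 0")
      case z: True
      have az: "a * z > 0" "b * z > 0" using z a b by auto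
      have *: "ennreal (T m n z) = ennreal (exp (- p * z\<^sup>2) * z) * ennreal (bessel_term \<nu> (a * z) m) * ennreal (bessel_term \<nu> (b * z) n)" for m n
        using z \<nu> by (simp add: T_def ennreal_mult[symmetric] bessel_term_nonneg mult_ac)
      have "ennreal (exp (- p * z\<^sup>2) * (z * (bessel_I \<nu> (a * z) * bessel_I \<nu> (b * z)))) =
        ennreal (exp (- p * z\<^sup>2) * z) * ennreal (bessel_I \<nu> (a * z)) * ennreal (bessel_I \<nu> (b * z))"
        using z \<nu> az by (simp add: ennreal_mult[symmetric] bessel_I_nonneg mult_ac)
      then show ?thesis using z \<nu> az by (simp add: * ennreal_bessel_I)
    qed auto
  qed
  also have "\<dots> = (\<Sum>m. \<Sum>n. (\<integral>\<^sup>+z\<in>{0<..}. ennreal (T m n z) \<partial>lborel))"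
    by (subst nn_integral_suminf, measurable, subst nn_integral_suminf, measurable)
  \<comment> \<open>The case distinctions make the summands vanish for k above m or n, so the finite
    Vandermonde sum becomes a full series in k and the three sums may be permuted freely.\<close>
  also have "\<dots> = (\<Sum>m. \<Sum>n. \<Sum>k. ennreal (W * (rGamma (real k + \<nu> + 1) / fact k)) *
        (if k \<le> m then ennreal (u ^ m / fact (m - k)) else 0) * (if k \<le> n then ennreal (v ^ n / fact (n - k)) else 0))"
    (is "_ = (\<Sum>m. \<Sum>n. \<Sum>k. ?F k m n)")
  proof -
    have "(\<integral>\<^sup>+z\<in>{0<..}. ennreal (T m n z) \<partial>lborel) = (\<Sum>k. ?F k m n)" for m n
    proof -
      have "(\<Sum>k. ?F k m n) = (\<Sum>k\<le>n. ?F k m n)"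
        by (rule suminf_finite) auto
      also have "\<dots> = (\<Sum>k\<le>n. ennreal (W * u ^ m * v ^ n * (if k \<le> m then rGamma (real k + \<nu> + 1) / (fact k * fact (m - k) * fact (n - k)) else 0)))"
      proof (intro sum.cong refl)
        fix k assume "k \<in> {..n}"
        then show "?F k m n = ennreal (W * u ^ m * v ^ n * (if k \<le> m then rGamma (real k + \<nu> + 1) / (fact k * fact (m - k) * fact (n - k)) else 0))"
          using uv rG[of k] by (auto simp: ennreal_mult[symmetric] field_simps)
      qed
      also have "\<dots> = ennreal (\<Sum>k\<le>n. W * u ^ m * v ^ n * (if k \<le> m then rGamma (real k + \<nu> + 1) / (fact k * fact (m - k) * fact (n - k)) else 0))"
        using uv rG by (intro sum_ennreal) auto
      finally show ?thesis
        unfolding int_T bessel_product_coefficient[OF \<nu>] by (simp only: sum_distrib_left)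
    qed
    then show ?thesis by simp
  qed
  also have "\<dots> = (\<Sum>m. \<Sum>k. \<Sum>n. ?F k m n)"
    by (rule arg_cong[where f=suminf], rule ext, rule suminf_ennreal_commute)
  also have "\<dots> = (\<Sum>k. \<Sum>m. \<Sum>n. ?F k m n)"
    by (rule suminf_ennreal_commute)
  also have "\<dots> = (\<Sum>k. ennreal (W * (rGamma (real k + \<nu> + 1) / fact k)) * ennreal (u ^ k * exp u) * ennreal (v ^ k * exp v))"
    using uv by (simp add: suminf_ennreal_shifted_exp)
  also have "\<dots> = (\<Sum>k. ennreal (exp ((a\<^sup>2 + b\<^sup>2) / (4 * p)) / (2 * p)) * ennreal (bessel_term \<nu> (a * b / (2 * p)) k))"
  proof (intro arg_cong[where f=suminf] ext)
    fix k
    have e: "exp ((a\<^sup>2 + b\<^sup>2) / (4 * p)) = exp u * exp v"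
      by (simp add: u_def v_def exp_add[symmetric] add_divide_distrib)
    define q where "q = a * b / (4 * p)"
    have q: "q > 0" "a * b / (2 * p) / 2 = q" "q\<^sup>2 = u * v"
      using a b p by (auto simp: q_def u_def v_def field_simps power2_eq_square)
    have "q powr (2 * real k + \<nu>) = (q\<^sup>2) ^ k * q powr \<nu>"
      using q(1) by (simp add: powr_add powr_powr[symmetric] powr_realpow)
    then have "bessel_term \<nu> (a * b / (2 * p)) k = (u * v) ^ k * q powr \<nu> * rGamma (real k + \<nu> + 1) / fact k"
      unfolding bessel_term_def q by simp
    then have "W * (rGamma (real k + \<nu> + 1) / fact k) * (u ^ k * exp u) * (v ^ k * exp v) =
      exp ((a\<^sup>2 + b\<^sup>2) / (4 * p)) / (2 * p) * bessel_term \<nu> (a * b / (2 * p)) k"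
      unfolding e W_def q_def[symmetric] by (simp add: power_mult_distrib)
    then show "ennreal (W * (rGamma (real k + \<nu> + 1) / fact k)) * ennreal (u ^ k * exp u) * ennreal (v ^ k * exp v) =
      ennreal (exp ((a\<^sup>2 + b\<^sup>2) / (4 * p)) / (2 * p)) * ennreal (bessel_term \<nu> (a * b / (2 * p)) k)"
      using uv rG[of k] p bessel_term_nonneg[OF \<nu>] by (simp add: ennreal_mult[symmetric])
  qed
  also have "\<dots> = ennreal (exp ((a\<^sup>2 + b\<^sup>2) / (4 * p)) / (2 * p)) * ennreal (bessel_I \<nu> (a * b / (2 * p)))"
    using \<nu> a b p by (simp add: ennreal_bessel_I)
  also have "\<dots> = ennreal (exp ((a\<^sup>2 + b\<^sup>2) / (4 * p)) / (2 * p) * bessel_I \<nu> (a * b / (2 * p)))"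
    using \<nu> a b p by (simp add: ennreal_mult[symmetric] bessel_I_nonneg)
  finally show ?thesis .
qed

section \<open>Poisson's integral\<close>

lemma Gamma_half_plus_nat: "Gamma (real k + 1/2) = fact (2 * k) * sqrt pi / (4 ^ k * fact k)"
proof (induction k)
  case 0
  show ?case by (simp add: Gamma_one_half_real)
next
  case (Suc k)
  have "real k + 1/2 \<notin> \<int>\<^sub>\<le>\<^sub>0" using nonpos_Ints_nonpos[of "real k + 1/2"] by linarith
  then have G: "Gamma ((real k + 1/2) + 1) = (real k + 1/2) * Gamma (real k + 1/2)"
    by (rule Gamma_plus1)
  define x where "x = real k + 1"
  have x: "x > 0" by (simp add: x_def)
  have "real (Suc k) + 1/2 = (real k + 1/2) + 1" by simp
  moreover have "real k + 1/2 = x - 1/2" by (simp add: x_def)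
  moreover have "fact (2 * Suc k) = 2 * x * (2 * x - 1) * (fact (2 * k) :: real)"
    by (simp add: x_def algebra_simps)
  moreover have "fact (Suc k) = x * (fact k :: real)" by (simp add: x_def algebra_simps)
  ultimately show ?case using G Suc.IH x by (simp only: power_Suc) (simp add: field_simps)
qed

lemma ennreal_eq_mult_cancel:
  assumes "ennreal b = ennreal c * I" "0 < c" "0 \<le> b"
  shows "I = ennreal (b / c)"
proof (cases I)
  case (real r)
  with assms have "ennreal b = ennreal (c * r)" by (simp add: ennreal_mult)
  then have "b = c * r" using ennreal_inj[of b "c * r"] real assms(2,3) by simp
  with real assms show ?thesis by simp
next
  case top
  with assms show ?thesis by (simp add: ennreal_mult_top)
qed

lemma cosh_sums: "(\<lambda>k. x ^ (2 * k) / fact (2 * k)) sums cosh (x::real)"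
proof -
  have "(\<lambda>n. \<Sum>i\<in>{n * 2..<n * 2 + 2}. if even i then x ^ i /\<^sub>R fact i else 0) sums cosh x"
    by (rule sums_group[OF cosh_converges]) simp
  moreover have "(\<Sum>i\<in>{n * 2..<n * 2 + 2}. if even i then x ^ i /\<^sub>R fact i else 0) = x ^ (2 * n) / fact (2 * n)" for n
  proof -
    have "{n * 2..<n * 2 + 2} = {2 * n, Suc (2 * n)}" by auto
    then show ?thesis by (simp add: divide_inverse mult.commute)
  qed
  ultimately show ?thesis by simp
qed

lemma nn_integral_even_moment:
  fixes \<nu> :: real
  assumes "\<nu> > -1/2"
  shows "(\<integral>\<^sup>+s\<in>{0<..<1}. ennreal ((1 - s\<^sup>2) powr (\<nu> - 1/2) * s ^ (2 * k)) \<partial>lborel)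
    = ennreal (Beta (real k + 1/2) (\<nu> + 1/2) / 2)"
proof -
  have k: "real k + 1/2 > 0" "\<nu> + 1/2 > 0" using assms by auto
  have B: "Beta (real k + 1/2) (\<nu> + 1/2) \<ge> 0"
    using k by (auto simp: Beta_def intro!: divide_nonneg_nonneg mult_nonneg_nonneg less_imp_le[OF Gamma_real_pos])
  \<comment> \<open>The Beta integrand is continued by 0 beyond 1, so that the quadratic
    substitution on the whole half-line applies.\<close>
  let ?f = "\<lambda>t. (if t < 1 then t powr (real k - 1/2) * (1 - t) powr (\<nu> - 1/2) else 0) :: real"
  have "ennreal (Beta (real k + 1/2) (\<nu> + 1/2)) =
      (\<integral>\<^sup>+t. ennreal (indicator {0..1} t * (t powr (real k - 1/2) * (1 - t) powr (\<nu> - 1/2))) \<partial>lborel)"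
    using nn_integral_has_integral_lebesgue[OF _ has_integral_Beta_real[OF k]] by simp
  also have "\<dots> = (\<integral>\<^sup>+t\<in>{0<..}. ennreal (?f t) \<partial>lborel)"
    by (rule nn_integral_cong_AE, rule AE_mp[OF AE_lborel_singleton[of 0]], rule AE_mp[OF AE_lborel_singleton[of 1]])
       (auto simp: indicator_def)
  also have "\<dots> = (\<integral>\<^sup>+s\<in>{0<..}. ennreal (2 * s * ?f (s\<^sup>2)) \<partial>lborel)"
    by (rule nn_integral_square_substitution) auto
  also have "\<dots> = (\<integral>\<^sup>+s. 2 * (ennreal ((1 - s\<^sup>2) powr (\<nu> - 1/2) * s ^ (2 * k)) * indicator {0<..<1} s) \<partial>lborel)"
  proof (rule nn_integral_cong)
    fix s :: real
    show "ennreal (2 * s * ?f (s\<^sup>2)) * indicator {0<..} s = 2 * (ennreal ((1 - s\<^sup>2) powr (\<nu> - 1/2) * s ^ (2 * k)) * indicator {0<..<1} s)"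
    proof (cases "s > 0")
      case s: True
      have "s * (s\<^sup>2) powr (real k - 1/2) = s powr 1 * (s powr 2) powr (real k - 1/2)" using s by simp
      also have "\<dots> = s powr (2 * real k)" by (simp only: powr_powr powr_add[symmetric]) (simp add: algebra_simps)
      also have "\<dots> = s ^ (2 * k)" using s powr_realpow[of s "2 * k"] by simp
      finally have *: "s * (s\<^sup>2) powr (real k - 1/2) = s ^ (2 * k)" .
      have "2 * s * ((s\<^sup>2) powr (real k - 1/2) * (1 - s\<^sup>2) powr (\<nu> - 1/2)) = 2 * ((1 - s\<^sup>2) powr (\<nu> - 1/2) * s ^ (2 * k))"
        unfolding *[symmetric] by simp
      moreover have "s\<^sup>2 < 1 \<longleftrightarrow> s < 1" using s by (simp add: power_less_one_iff)
      ultimately have "ennreal (2 * s * ?f (s\<^sup>2)) = ennreal (2 * ((1 - s\<^sup>2) powr (\<nu> - 1/2) * s ^ (2 * k)))" if "s < 1"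
        using that by (simp only: if_True)
      then show ?thesis using s \<open>s\<^sup>2 < 1 \<longleftrightarrow> s < 1\<close>
        by (cases "s < 1") (simp_all add: ennreal_mult'[of 2] del: power_mult)
    qed auto
  qed
  also have "\<dots> = 2 * (\<integral>\<^sup>+s\<in>{0<..<1}. ennreal ((1 - s\<^sup>2) powr (\<nu> - 1/2) * s ^ (2 * k)) \<partial>lborel)"
    by (rule nn_integral_cmult) measurable
  finally show ?thesis using B by (intro ennreal_eq_mult_cancel) auto
qed

text \<open>Poisson's integral in its classical form. Each even power in the cosh series gives half
  a Beta value, and Gamma (k + 1/2) / (2k)! equals sqrt pi / (4^k k!), which is the missing part of
  the k-th Bessel coefficient.\<close>

lemma nn_integral_cosh_bessel:
  fixes \<nu> z :: real
  assumes \<nu>: "\<nu> > -1/2" and z: "z > 0"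
  shows "(\<integral>\<^sup>+s\<in>{0<..<1}. ennreal ((1 - s\<^sup>2) powr (\<nu> - 1/2) * (2 * cosh (z * s))) \<partial>lborel)
    = ennreal (sqrt pi * Gamma (\<nu> + 1/2) * (z/2) powr (-\<nu>) * bessel_I \<nu> z)"
proof -
  have G: "Gamma (\<nu> + 1/2) > 0" using \<nu> by (intro Gamma_real_pos) auto
  let ?c = "\<lambda>k. 2 * z ^ (2 * k) / fact (2 * k)"
  have "(\<integral>\<^sup>+s\<in>{0<..<1}. ennreal ((1 - s\<^sup>2) powr (\<nu> - 1/2) * (2 * cosh (z * s))) \<partial>lborel) =
     (\<integral>\<^sup>+s. (\<Sum>k. ennreal (?c k) * (ennreal ((1 - s\<^sup>2) powr (\<nu> - 1/2) * s ^ (2 * k)) * indicator {0<..<1} s)) \<partial>lborel)"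
  proof (rule nn_integral_cong)
    fix s :: real
    have "(\<lambda>k. (1 - s\<^sup>2) powr (\<nu> - 1/2) * (2 * ((z * s) ^ (2 * k) / fact (2 * k)))) sums ((1 - s\<^sup>2) powr (\<nu> - 1/2) * (2 * cosh (z * s)))"
      by (intro sums_mult cosh_sums)
    then have "(\<lambda>k. ennreal ((1 - s\<^sup>2) powr (\<nu> - 1/2) * (2 * ((z * s) ^ (2 * k) / fact (2 * k))))) sums ennreal ((1 - s\<^sup>2) powr (\<nu> - 1/2) * (2 * cosh (z * s)))"
      by (subst sums_ennreal) auto
    then have "ennreal ((1 - s\<^sup>2) powr (\<nu> - 1/2) * (2 * cosh (z * s))) = (\<Sum>k. ennreal ((1 - s\<^sup>2) powr (\<nu> - 1/2) * (2 * ((z * s) ^ (2 * k) / fact (2 * k)))))"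
      by (rule sums_unique)
    moreover have "ennreal ((1 - s\<^sup>2) powr (\<nu> - 1/2) * (2 * ((z * s) ^ (2 * k) / fact (2 * k)))) =
        ennreal (?c k) * ennreal ((1 - s\<^sup>2) powr (\<nu> - 1/2) * s ^ (2 * k))" for k
    proof -
      have "0 \<le> (1 - s\<^sup>2) powr (\<nu> - 1/2) * s ^ (2 * k)" by (intro mult_nonneg_nonneg) auto
      then show ?thesis
        using z by (subst ennreal_mult[symmetric]) (auto simp: power_mult_distrib mult_ac)
    qed
    ultimately have "ennreal ((1 - s\<^sup>2) powr (\<nu> - 1/2) * (2 * cosh (z * s))) = (\<Sum>k. ennreal (?c k) * ennreal ((1 - s\<^sup>2) powr (\<nu> - 1/2) * s ^ (2 * k)))"
      by simp
    then show "ennreal ((1 - s\<^sup>2) powr (\<nu> - 1/2) * (2 * cosh (z * s))) * indicator {0<..<1} s =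
      (\<Sum>k. ennreal (?c k) * (ennreal ((1 - s\<^sup>2) powr (\<nu> - 1/2) * s ^ (2 * k)) * indicator {0<..<1} s))"
      by (simp only: mult.assoc[symmetric] ennreal_suminf_multc)
  qed
  also have "\<dots> = (\<Sum>k. ennreal (?c k) * ennreal (Beta (real k + 1/2) (\<nu> + 1/2) / 2))"
    by (subst nn_integral_suminf, measurable, subst nn_integral_cmult, measurable)
       (simp only: nn_integral_even_moment[OF \<nu>])
  also have "\<dots> = (\<Sum>k. ennreal (sqrt pi * Gamma (\<nu> + 1/2) * (z/2) powr (-\<nu>)) * ennreal (bessel_term \<nu> z k))"
  proof (intro arg_cong[where f=suminf] ext)
    fix k
    have pos: "real k + \<nu> + 1 > 0" using \<nu> by linarith
    have rG: "rGamma (real k + \<nu> + 1) > 0" by (rule rGamma_pos_real[OF pos])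
    have Bk: "Beta (real k + 1/2) (\<nu> + 1/2) = fact (2 * k) * sqrt pi / (4 ^ k * fact k) * Gamma (\<nu> + 1/2) * rGamma (real k + \<nu> + 1)"
    proof -
      have "real k + 1/2 + (\<nu> + 1/2) = real k + \<nu> + 1" by simp
      then show ?thesis unfolding Beta_def Gamma_half_plus_nat rGamma_inverse_Gamma by (simp only: divide_inverse mult_ac)
    qed
    have P: "(z/2) powr (2 * real k + \<nu>) = z ^ (2 * k) / 4 ^ k * (z/2) powr \<nu>"
      using z powr_realpow[of "z/2" "2 * k"] by (simp add: powr_add power_divide power_mult)
    have "sqrt pi * Gamma (\<nu> + 1/2) * (z/2) powr (-\<nu>) * bessel_term \<nu> z k =
        ((z/2) powr (-\<nu>) * (z/2) powr \<nu>) * (sqrt pi * Gamma (\<nu> + 1/2) * (z ^ (2 * k) / 4 ^ k * rGamma (real k + \<nu> + 1) / fact k))"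
      unfolding bessel_term_def P by (simp only: divide_inverse mult_ac)
    moreover have "(z/2) powr (-\<nu>) * (z/2) powr \<nu> = 1" using z by (simp add: powr_add[symmetric])
    moreover have "?c k * (Beta (real k + 1/2) (\<nu> + 1/2) / 2) = sqrt pi * Gamma (\<nu> + 1/2) * (z ^ (2 * k) / 4 ^ k * rGamma (real k + \<nu> + 1) / fact k)"
      unfolding Bk by simp
    ultimately have "?c k * (Beta (real k + 1/2) (\<nu> + 1/2) / 2) = sqrt pi * Gamma (\<nu> + 1/2) * (z/2) powr (-\<nu>) * bessel_term \<nu> z k"
      by (simp only: mult_1_left)
    moreover have "Beta (real k + 1/2) (\<nu> + 1/2) \<ge> 0"
      using \<nu> by (auto simp: Beta_def intro!: divide_nonneg_nonneg mult_nonneg_nonneg less_imp_le[OF Gamma_real_pos])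
    moreover have "bessel_term \<nu> z k \<ge> 0" using \<nu> by (intro bessel_term_nonneg) auto
    ultimately show "ennreal (?c k) * ennreal (Beta (real k + 1/2) (\<nu> + 1/2) / 2) = ennreal (sqrt pi * Gamma (\<nu> + 1/2) * (z/2) powr (-\<nu>)) * ennreal (bessel_term \<nu> z k)"
      using z G by (simp add: ennreal_mult[symmetric])
  qed
  also have "\<dots> = ennreal (sqrt pi * Gamma (\<nu> + 1/2) * (z/2) powr (-\<nu>) * bessel_I \<nu> z)"
    using z \<nu> G by (simp add: ennreal_bessel_I[symmetric] ennreal_mult[symmetric] bessel_I_nonneg)
  finally show ?thesis .
qed

text \<open>The two exponentials in 2 cosh (z s) are moved by u = z (1 - s) and u = z (1 + s) to the
  adjacent intervals below and above z. The second claim holds because the upper half carries exp (-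
  z s) where the lower one carries exp (z s). Division by Gamma (\<nu> + 1/2), the total mass of
  u^(\<nu> - 1/2) exp (-u), turns the integral into a mean.\<close>

lemma poisson_integral:
  fixes \<nu> z :: real
  assumes \<nu>: "\<nu> > -1/2" and z: "z > 0"
  defines "J \<equiv> \<lambda>A. \<integral>\<^sup>+u\<in>A. ennreal (u powr (\<nu> - 1/2) * (1 - u / (2 * z)) powr (\<nu> - 1/2) * exp (- u)) \<partial>lborel"
    and "B \<equiv> Gamma (\<nu> + 1/2) * sqrt (2 * pi) * exp (- z) * (sqrt z * bessel_I \<nu> z)"
  shows "J {0<..<2 * z} = ennreal B" and "ennreal B \<le> 2 * J {0<..<z}"
proof -
  define C where "C = z * (z/2) powr (\<nu> - 1/2) * exp (- z)"
  have C: "C > 0" using z by (simp add: C_def)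
  let ?w = "\<lambda>s. (1 - s\<^sup>2) powr (\<nu> - 1/2)"
  let ?g = "\<lambda>u. u powr (\<nu> - 1/2) * (1 - u / (2 * z)) powr (\<nu> - 1/2) * exp (- u)"
  have B: "B = C * (sqrt pi * Gamma (\<nu> + 1/2) * (z/2) powr (-\<nu>) * bessel_I \<nu> z)"
  proof -
    have "z * (z/2) powr (\<nu> - 1/2) * (z/2) powr (-\<nu>) = z * (z/2) powr (-(1/2))"
      by (simp only: mult.assoc powr_add[symmetric]) simp
    also have "\<dots> = sqrt 2 * sqrt z"
      using z by (simp add: powr_minus powr_half_sqrt real_sqrt_divide field_simps)
    finally have "z * (z/2) powr (\<nu> - 1/2) * (z/2) powr (-\<nu>) = sqrt 2 * sqrt z" .
    moreover have "C * (sqrt pi * Gamma (\<nu> + 1/2) * (z/2) powr (-\<nu>) * bessel_I \<nu> z) =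
        (z * (z/2) powr (\<nu> - 1/2) * (z/2) powr (-\<nu>)) * (exp (-z) * sqrt pi * Gamma (\<nu> + 1/2) * bessel_I \<nu> z)"
      unfolding C_def by (simp only: mult_ac)
    ultimately have "C * (sqrt pi * Gamma (\<nu> + 1/2) * (z/2) powr (-\<nu>) * bessel_I \<nu> z) =
        (sqrt 2 * sqrt z) * (exp (-z) * sqrt pi * Gamma (\<nu> + 1/2) * bessel_I \<nu> z)"
      by (simp only:)
    then show ?thesis unfolding B_def real_sqrt_mult by (simp only: mult_ac)
  qed
  \<comment> \<open>With s = 1 - u/z or s = u/z - 1, the factor 1 - s^2 is (2 - u/z) (u/z), that is
    (2/z) u (1 - u/(2z)); both the Gamma density and the weight come from it.\<close>
  have w: "?g u = (C / z) * (((1 - u / z) + 1) * (u / z)) powr (\<nu> - 1/2) * exp (z - u)" if "0 < u" "u < 2 * z" for u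
  proof -
    have "((1 - u / z) + 1) * (u / z) = (2 / z) * (u * (1 - u / (2 * z)))"
      using z by (simp add: field_simps)
    then have "(((1 - u / z) + 1) * (u / z)) powr (\<nu> - 1/2) = (2 / z) powr (\<nu> - 1/2) * (u powr (\<nu> - 1/2) * (1 - u / (2 * z)) powr (\<nu> - 1/2))"
      by (simp only: powr_mult)
    moreover have "(z/2) powr (\<nu> - 1/2) * (2/z) powr (\<nu> - 1/2) = 1"
      using z by (simp add: powr_mult[symmetric])
    moreover have "exp (-z) * exp (z - u) = exp (-u)" by (simp add: exp_add[symmetric])
    moreover have "(C / z) * ((2/z) powr (\<nu> - 1/2) * (u powr (\<nu> - 1/2) * (1 - u / (2 * z)) powr (\<nu> - 1/2))) * exp (z - u)
      = ((z/2) powr (\<nu> - 1/2) * (2/z) powr (\<nu> - 1/2)) * (u powr (\<nu> - 1/2) * (1 - u / (2 * z)) powr (\<nu> - 1/2)) * (exp (-z) * exp (z - u))"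
      unfolding C_def using z by simp
    ultimately show ?thesis by simp
  qed
  \<comment> \<open>Both halves at once: \<open>\<sigma> = 1\<close> is the part with exp (z s) and
    \<open>\<sigma> = -1\<close> the part with exp (- z s), under the substitution s = \<sigma> (1 -
    u/z).\<close>
  have half: "ennreal C * (\<integral>\<^sup>+s\<in>{0<..<1}. ennreal (?w s * exp (\<sigma> * (z * s))) \<partial>lborel) = J A"
    if \<sigma>: "\<sigma> = 1 \<or> \<sigma> = -1" and A: "\<And>u. u \<in> A \<longleftrightarrow> 0 < \<sigma> * (1 - u / z) \<and> \<sigma> * (1 - u / z) < 1"
      "\<And>u. u \<in> A \<Longrightarrow> 0 < u \<and> u < 2 * z" for \<sigma> A
  proof -
    let ?h = "\<lambda>s. ennreal (?w s * exp (\<sigma> * (z * s))) * indicator {0<..<1} s"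
    have "(\<integral>\<^sup>+s. ?h s \<partial>lborel) = ennreal (1/z) * (\<integral>\<^sup>+u. ?h (\<sigma> + (-\<sigma>/z) * u) \<partial>lborel)"
      using z \<sigma> by (subst nn_integral_real_affine[where c="-\<sigma>/z" and t=\<sigma>]) auto
    then have "ennreal C * (\<integral>\<^sup>+s. ?h s \<partial>lborel) = ennreal (C/z) * (\<integral>\<^sup>+u. ?h (\<sigma> + (-\<sigma>/z) * u) \<partial>lborel)"
      using C z by (simp add: mult.assoc[symmetric] ennreal_mult[symmetric])
    also have "\<dots> = (\<integral>\<^sup>+u. ennreal (C/z) * ?h (\<sigma> + (-\<sigma>/z) * u) \<partial>lborel)"
      by (rule nn_integral_cmult[symmetric]) measurable
    also have "\<dots> = J A" unfolding J_def
    proof (rule nn_integral_cong)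
      fix u
      have su: "\<sigma> + (-\<sigma>/z) * u = \<sigma> * (1 - u / z)" by (simp add: algebra_simps)
      have "1 - (\<sigma> * (1 - u / z))\<^sup>2 = ((1 - u / z) + 1) * (u / z)"
        using \<sigma> by (auto simp: power2_eq_square algebra_simps)
      moreover have "\<sigma> * (z * (\<sigma> * (1 - u / z))) = z - u" using z \<sigma> by (auto simp: algebra_simps)
      ultimately show "ennreal (C/z) * ?h (\<sigma> + (-\<sigma>/z) * u) = ennreal (?g u) * indicator A u"
        unfolding su using A[of u] w[of u] C z by (cases "u \<in> A") (auto simp: ennreal_mult[symmetric] mult.assoc)
    qed
    finally show ?thesis .
  qed
  have right: "ennreal C * (\<integral>\<^sup>+s\<in>{0<..<1}. ennreal (?w s * exp (z * s)) \<partial>lborel) = J {0<..<z}"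
    using half[of 1 "{0<..<z}"] z by (auto simp: field_simps)
  have left: "ennreal C * (\<integral>\<^sup>+s\<in>{0<..<1}. ennreal (?w s * exp (- (z * s))) \<partial>lborel) = J {z<..<2 * z}"
    using half[of "-1" "{z<..<2 * z}"] z by (auto simp: field_simps)
  have "ennreal B = ennreal C * ennreal (sqrt pi * Gamma (\<nu> + 1/2) * (z/2) powr (-\<nu>) * bessel_I \<nu> z)"
    unfolding B using C by (simp add: ennreal_mult')
  also have "\<dots> = ennreal C * (\<integral>\<^sup>+s. ennreal (?w s * exp (z * s)) * indicator {0<..<1} s + ennreal (?w s * exp (- (z * s))) * indicator {0<..<1} s \<partial>lborel)"
    unfolding nn_integral_cosh_bessel[OF \<nu> z, symmetric]
    by (intro arg_cong2[where f="(*)"] refl nn_integral_cong)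
       (auto simp: cosh_def distrib_left ennreal_plus[symmetric] indicator_def simp del: ennreal_plus)
  also have "\<dots> = J {0<..<z} + J {z<..<2*z}"
    unfolding left[symmetric] right[symmetric] by (subst nn_integral_add) (auto simp: distrib_left)
  finally have sum: "ennreal B = J {0<..<z} + J {z<..<2*z}" .
  have "J {0<..<z} + J {z<..<2*z} = (\<integral>\<^sup>+u. ennreal (?g u) * indicator {0<..<z} u + ennreal (?g u) * indicator {z<..<2*z} u \<partial>lborel)"
    unfolding J_def by (subst nn_integral_add) auto
  also have "\<dots> = J {0<..<2*z}" unfolding J_def
    by (insert z, rule nn_integral_cong_AE, rule AE_mp[OF AE_lborel_singleton[of z]]) (auto simp: indicator_def)
  finally show "J {0<..<2 * z} = ennreal B" by (simp add: sum)
  have "J {z<..<2*z} \<le> J {0<..<z}"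
    unfolding left[symmetric] right[symmetric]
  proof (intro mult_left_mono nn_integral_mono)
    fix s
    have "?w s * exp (- (z * s)) \<le> ?w s * exp (z * s)" if "s > 0" using z that by (intro mult_left_mono) auto
    then show "ennreal (?w s * exp (- (z * s))) * indicator {0<..<1} s \<le> ennreal (?w s * exp (z * s)) * indicator {0<..<1} s"
      by (auto simp: indicator_def intro!: ennreal_leI)
  qed simp
  then show "ennreal B \<le> 2 * J {0<..<z}"
    unfolding sum mult_2 by (rule add_left_mono)
qed

section \<open>Moments of the Gamma distribution\<close>

lemma nn_integral_Gamma:
  assumes "b > 0"
  shows "(\<integral>\<^sup>+u\<in>{0<..}. ennreal (u powr (b - 1) * exp (- u)) \<partial>lborel) = ennreal (Gamma b)"
proof -
  have "ennreal (Gamma b) = (\<integral>\<^sup>+t. ennreal (indicator {0..} t * t powr (b - 1) / exp t) \<partial>lborel)"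
    by (rule Gamma_conv_nn_integral_real[OF assms])
  also have "\<dots> = (\<integral>\<^sup>+u\<in>{0<..}. ennreal (u powr (b - 1) * exp (- u)) \<partial>lborel)"
    by (rule nn_integral_cong_AE, rule AE_mp[OF AE_lborel_singleton[of 0]])
       (auto simp: indicator_def exp_minus field_simps)
  finally show ?thesis ..
qed

text \<open>Signed minorants, here polynomials in the Gamma variable and a Gaussian minus a multiple
  of its fourth moment density, are integrated exactly as Bochner integrals; \<open>ennreal\<close>
  cuts a negative result off at 0, where the bound is trivial.\<close>

lemma ennreal_integral_le_nn_integral:
  fixes g h :: "'a \<Rightarrow> real"
  assumes "integrable M g" "\<And>x. x \<in> space M \<Longrightarrow> g x \<le> h x"
  shows "ennreal (\<integral>x. g x \<partial>M) \<le> (\<integral>\<^sup>+x. ennreal (h x) \<partial>M)"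
proof -
  have i: "integrable M (\<lambda>x. max 0 (g x))" using assms(1) by simp
  have "ennreal (\<integral>x. g x \<partial>M) \<le> ennreal (\<integral>x. max 0 (g x) \<partial>M)"
    by (intro ennreal_leI integral_mono i assms(1)) auto
  also have "\<dots> = (\<integral>\<^sup>+x. ennreal (max 0 (g x)) \<partial>M)"
    by (rule nn_integral_eq_integral[symmetric, OF i]) auto
  also have "\<dots> \<le> (\<integral>\<^sup>+x. ennreal (h x) \<partial>M)"
    by (intro nn_integral_mono) (simp add: max_def assms(2) ennreal_leI)
  finally show ?thesis .
qed

lemma has_bochner_integral_Gamma:
  fixes b :: real
  assumes "b > 0"
  shows "has_bochner_integral lborel (\<lambda>u. indicator {0<..} u * (u powr (b - 1) * exp (- u))) (Gamma b)"
proof (rule has_bochner_integral_nn_integral)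
  show "0 \<le> Gamma b" using Gamma_real_pos[OF assms] by simp
  show "(\<integral>\<^sup>+u. ennreal (indicator {0<..} u * (u powr (b - 1) * exp (- u))) \<partial>lborel) = ennreal (Gamma b)"
    unfolding nn_integral_Gamma[OF assms, symmetric]
    by (intro nn_integral_cong) (auto simp: indicator_def)
qed auto

text \<open>The Gamma distribution with parameter b has moments b and b (b + 1). The minorant may
  take negative values, which is why it goes through a Bochner integral.\<close>

lemma nn_integral_Gamma_quadratic_lower:
  fixes \<phi> :: "real \<Rightarrow> real"
  assumes b: "b > 0" and nn: "\<And>u. 0 \<le> \<phi> u" and le: "\<And>u. u > 0 \<Longrightarrow> c0 + c1 * u + c2 * u\<^sup>2 \<le> \<phi> u"
  shows "ennreal (Gamma b * (c0 + c1 * b + c2 * (b * (b + 1)))) \<le>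
    (\<integral>\<^sup>+u\<in>{0<..}. ennreal (u powr (b - 1) * exp (- u) * \<phi> u) \<partial>lborel)"
proof -
  have np: "x > 0 \<Longrightarrow> x \<notin> \<int>\<^sub>\<le>\<^sub>0" for x :: real using nonpos_Ints_nonpos[of x] by auto
  have G1: "Gamma (b + 1) = b * Gamma b" using b by (intro Gamma_plus1 np)
  have G2: "Gamma (b + 2) = (b + 1) * (b * Gamma b)"
    using b Gamma_plus1[of "b + 1"] np[of "b + 1"] G1 by (simp add: add.assoc)
  have "has_bochner_integral lborel (\<lambda>u. c0 * (indicator {0<..} u * (u powr (b - 1) * exp (- u)))
      + c1 * (indicator {0<..} u * (u powr (b + 1 - 1) * exp (- u)))
      + c2 * (indicator {0<..} u * (u powr (b + 2 - 1) * exp (- u)))) (c0 * Gamma b + c1 * Gamma (b + 1) + c2 * Gamma (b + 2))"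
    using b by (intro has_bochner_integral_add has_bochner_integral_mult_right has_bochner_integral_Gamma) auto
  then have I: "has_bochner_integral lborel (\<lambda>u. indicator {0<..} u * (u powr (b - 1) * exp (- u) * (c0 + c1 * u + c2 * u\<^sup>2)))
     (Gamma b * (c0 + c1 * b + c2 * (b * (b + 1))))" (is "has_bochner_integral _ ?g _")
  proof (rule has_bochner_integral_cong[THEN iffD1, rotated -1])
    fix u :: real
    have "u powr (b + 1 - 1) = u powr (b - 1) * u" "u powr (b + 2 - 1) = u powr (b - 1) * u\<^sup>2" if "u > 0"
    proof -
      have e: "b + 1 - 1 = (b - 1) + 1" "b + 2 - 1 = (b - 1) + 2" by simp_all
      show "u powr (b + 1 - 1) = u powr (b - 1) * u" "u powr (b + 2 - 1) = u powr (b - 1) * u\<^sup>2"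
        unfolding e using that by (simp_all only: powr_add) simp_all
    qed
    then show "c0 * (indicator {0<..} u * (u powr (b - 1) * exp (- u)))
      + c1 * (indicator {0<..} u * (u powr (b + 1 - 1) * exp (- u)))
      + c2 * (indicator {0<..} u * (u powr (b + 2 - 1) * exp (- u))) = ?g u"
      by (cases "u > 0") (simp_all add: algebra_simps)
  next
    show "c0 * Gamma b + c1 * Gamma (b + 1) + c2 * Gamma (b + 2) = Gamma b * (c0 + c1 * b + c2 * (b * (b + 1)))"
      unfolding G1 G2 by (simp add: algebra_simps)
  qed simp
  have "ennreal (\<integral>u. ?g u \<partial>lborel) \<le> (\<integral>\<^sup>+u. ennreal (indicator {0<..} u * (u powr (b - 1) * exp (- u) * \<phi> u)) \<partial>lborel)"
    by (rule ennreal_integral_le_nn_integral[OF integrable.intros[OF I]])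
       (auto simp: indicator_def intro!: mult_left_mono le)
  also have "\<dots> = (\<integral>\<^sup>+u\<in>{0<..}. ennreal (u powr (b - 1) * exp (- u) * \<phi> u) \<partial>lborel)"
    by (intro nn_integral_cong) (auto simp: indicator_def)
  finally show ?thesis unfolding has_bochner_integral_integral_eq[OF I] .
qed

text \<open>The minorant is integrated over the whole half-line, where the moments are explicit. The
  weight is therefore continued by 0 beyond \<open>2 * z\<close>, and the minorant has to be
  nonpositive there.\<close>

lemma bessel_I_ge_of_weight_ge:
  fixes \<nu> z :: real
  assumes \<nu>: "\<nu> > -1/2" and z: "z > 0"
    and le: "\<And>u. u > 0 \<Longrightarrow> c0 + c1 * u + c2 * u\<^sup>2 \<le> (if u < 2 * z then (1 - u / (2 * z)) powr (\<nu> - 1/2) else 0)"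
  shows "exp z / sqrt (2 * pi) * (c0 + c1 * (\<nu> + 1/2) + c2 * ((\<nu> + 1/2) * (\<nu> + 3/2))) \<le> sqrt z * bessel_I \<nu> z"
proof -
  let ?b = "\<nu> + 1/2" and ?c = "c0 + c1 * (\<nu> + 1/2) + c2 * ((\<nu> + 1/2) * (\<nu> + 3/2))"
  let ?B = "Gamma (\<nu> + 1/2) * sqrt (2 * pi) * exp (- z) * (sqrt z * bessel_I \<nu> z)"
  have b: "?b > 0" using \<nu> by simp
  have G: "Gamma ?b > 0" using b by (rule Gamma_real_pos)
  have "ennreal (Gamma ?b * (c0 + c1 * ?b + c2 * (?b * (?b + 1)))) \<le>
     (\<integral>\<^sup>+u\<in>{0<..}. ennreal (u powr (?b - 1) * exp (- u) * (if u < 2 * z then (1 - u / (2 * z)) powr (\<nu> - 1/2) else 0)) \<partial>lborel)"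
    by (rule nn_integral_Gamma_quadratic_lower[OF b _ le]) auto
  also have "\<dots> = (\<integral>\<^sup>+u\<in>{0<..<2*z}. ennreal (u powr (\<nu> - 1/2) * (1 - u / (2 * z)) powr (\<nu> - 1/2) * exp (- u)) \<partial>lborel)"
    by (intro nn_integral_cong) (auto simp: indicator_def mult_ac)
  also have "\<dots> = ennreal ?B" by (rule poisson_integral[OF \<nu> z])
  finally have "Gamma ?b * ?c \<le> ?B"
    using G z bessel_I_nonneg[of \<nu> z] \<nu> by (subst (asm) ennreal_le_iff) (auto simp: add_ac)
  then have "Gamma ?b * ?c \<le> Gamma ?b * (sqrt (2 * pi) * exp (- z) * (sqrt z * bessel_I \<nu> z))"
    by (simp only: mult.assoc)
  then have "?c \<le> sqrt (2 * pi) * exp (- z) * (sqrt z * bessel_I \<nu> z)"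
    using G by (simp only: mult_le_cancel_left_pos)
  then have "exp z / sqrt (2 * pi) * ?c \<le> exp z / sqrt (2 * pi) * (sqrt (2 * pi) * exp (- z) * (sqrt z * bessel_I \<nu> z))"
    by (intro mult_left_mono) auto
  also have "\<dots> = sqrt z * bessel_I \<nu> z" by (simp add: exp_minus)
  finally show ?thesis .
qed

section \<open>Upper and lower bounds for Bessel functions\<close>

lemma bessel_I_le_of_poisson_le:
  fixes \<nu> z :: real
  assumes \<nu>: "\<nu> > -1/2" and z: "z > 0" and c: "c \<ge> 0"
    and le: "ennreal (Gamma (\<nu> + 1/2) * sqrt (2 * pi) * exp (- z) * (sqrt z * bessel_I \<nu> z)) \<le> ennreal (c * Gamma (\<nu> + 1/2))"
  shows "sqrt z * bessel_I \<nu> z \<le> c * (exp z / sqrt (2 * pi))"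
proof -
  have G: "Gamma (\<nu> + 1/2) > 0" using \<nu> by (intro Gamma_real_pos) simp
  have "Gamma (\<nu> + 1/2) * sqrt (2 * pi) * exp (- z) * (sqrt z * bessel_I \<nu> z) \<le> c * Gamma (\<nu> + 1/2)"
    using G c le by (subst (asm) ennreal_le_iff) auto
  then have "Gamma (\<nu> + 1/2) * (sqrt (2 * pi) * exp (- z) * (sqrt z * bessel_I \<nu> z)) \<le> Gamma (\<nu> + 1/2) * c"
    by (simp only: mult_ac)
  then have "sqrt (2 * pi) * exp (- z) * (sqrt z * bessel_I \<nu> z) \<le> c"
    using G by (simp only: mult_le_cancel_left_pos)
  then have "exp z / sqrt (2 * pi) * (sqrt (2 * pi) * exp (- z) * (sqrt z * bessel_I \<nu> z)) \<le> exp z / sqrt (2 * pi) * c"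
    by (intro mult_left_mono) auto
  then show ?thesis by (simp add: exp_minus mult_ac)
qed

text \<open>The duplication value of Gamma (k + 1/2) turns the Bessel series into the series of
  cosh. This is the comparison function: its kernel is a sum of two reflected Gaussians.\<close>

lemma bessel_I_minus_half:
  assumes "z > 0"
  shows "sqrt z * bessel_I (-1/2) z = sqrt (2 / pi) * cosh z"
proof -
  have "sqrt z * bessel_term (-1/2) z k = sqrt (2 / pi) * (z ^ (2 * k) / fact (2 * k))" for k
  proof -
    have "(z/2) powr (2 * real k + -1/2) = (z/2) powr (2 * real k) * (z/2) powr (-1/2)"
      by (simp only: powr_add)
    also have "(z/2) powr (2 * real k) = z ^ (2 * k) / 4 ^ k"
      using assms powr_realpow[of "z/2" "2 * k"] by (simp add: power_divide power_mult)
    also have "(z/2) powr (-1/2) = sqrt 2 / sqrt z"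
      using assms powr_minus[of "z/2" "1/2"] by (simp add: powr_half_sqrt real_sqrt_divide)
    finally have P: "(z/2) powr (2 * real k + -1/2) = z ^ (2 * k) / 4 ^ k * (sqrt 2 / sqrt z)" .
    have "real k + -1/2 + 1 = real k + 1/2" by simp
    then have "rGamma (real k + -1/2 + 1) = 4 ^ k * fact k / (fact (2 * k) * sqrt pi)"
      by (simp only: rGamma_inverse_Gamma Gamma_half_plus_nat) simp
    then show ?thesis unfolding bessel_term_def P using assms by (simp add: real_sqrt_divide field_simps)
  qed
  moreover have "(\<lambda>k. sqrt z * bessel_term (-1/2) z k) sums (sqrt z * bessel_I (-1/2) z)"
    unfolding bessel_I_eq using assms by (intro sums_mult summable_sums summable_bessel_term) auto
  moreover have "(\<lambda>k. sqrt (2 / pi) * (z ^ (2 * k) / fact (2 * k))) sums (sqrt (2 / pi) * cosh z)"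
    by (intro sums_mult cosh_sums)
  ultimately show ?thesis by (simp add: sums_unique2)
qed

lemma exp_le_cosh_scaled: "exp z / sqrt (2 * pi) \<le> sqrt (2 / pi) * cosh (z::real)"
proof -
  have "sqrt (2 / pi) * (exp z / 2) = exp z / sqrt (2 * pi)"
    by (simp add: real_sqrt_divide real_sqrt_mult field_simps)
  moreover have "exp z / 2 \<le> cosh z" by (simp add: cosh_def)
  ultimately show ?thesis by (metis mult_left_mono real_sqrt_ge_zero divide_nonneg_nonneg pi_ge_zero zero_le_numeral)
qed

lemma bessel_I_le_cosh:
  fixes \<nu> z :: real
  assumes "\<nu> = -1/2 \<or> \<nu> \<ge> 1/2" "z > 0"
  shows "sqrt z * bessel_I \<nu> z \<le> sqrt (2 / pi) * cosh z"
proof (cases "\<nu> = -1/2")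
  case False
  with assms have \<nu>: "\<nu> \<ge> 1/2" by simp
  have "(\<integral>\<^sup>+u\<in>{0<..<2*z}. ennreal (u powr (\<nu> - 1/2) * (1 - u / (2 * z)) powr (\<nu> - 1/2) * exp (- u)) \<partial>lborel)
      \<le> (\<integral>\<^sup>+u\<in>{0<..}. ennreal (u powr (\<nu> + 1/2 - 1) * exp (- u)) \<partial>lborel)"
  proof (intro nn_integral_mono)
    fix u :: real
    have "(1 - u / (2 * z)) powr (\<nu> - 1/2) \<le> 1" if "0 < u" "u < 2 * z"
      using that \<nu> assms(2) by (intro powr_le1) auto
    then have "u powr (\<nu> - 1/2) * ((1 - u / (2 * z)) powr (\<nu> - 1/2)) * exp (- u) \<le> u powr (\<nu> - 1/2) * 1 * exp (- u)"
      if "0 < u" "u < 2 * z" using that by (intro mult_right_mono mult_left_mono) auto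
    then show "ennreal (u powr (\<nu> - 1/2) * (1 - u / (2 * z)) powr (\<nu> - 1/2) * exp (- u)) * indicator {0<..<2*z} u \<le>
      ennreal (u powr (\<nu> + 1/2 - 1) * exp (- u)) * indicator {0<..} u"
      by (auto simp: indicator_def intro!: ennreal_leI)
  qed
  also have "\<dots> = ennreal (1 * Gamma (\<nu> + 1/2))" using \<nu> by (subst nn_integral_Gamma) auto
  finally have "sqrt z * bessel_I \<nu> z \<le> 1 * (exp z / sqrt (2 * pi))"
    using \<nu> assms(2) by (intro bessel_I_le_of_poisson_le) (auto simp: poisson_integral(1))
  then show ?thesis using exp_le_cosh_scaled[of z] by simp
qed (use assms bessel_I_minus_half in simp)

text \<open>In Poisson's integral the part \<open>u > z\<close> is at most the part \<open>u < z\<close>, where the weight is at most \<open>2\<close>.\<close>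

lemma bessel_I_le_cosh_uniform:
  fixes \<nu> z :: real
  assumes \<nu>: "\<nu> \<ge> -1/2" and z: "z > 0"
  shows "sqrt z * bessel_I \<nu> z \<le> 4 * (sqrt (2 / pi) * cosh z)"
proof (cases "\<nu> = -1/2 \<or> \<nu> \<ge> 1/2")
  case True
  have "0 \<le> sqrt (2 / pi) * cosh z" by simp
  with bessel_I_le_cosh[OF True z] show ?thesis by linarith
next
  case False
  with \<nu> have \<nu>: "-1/2 < \<nu>" "\<nu> < 1/2" by auto
  have "ennreal (Gamma (\<nu> + 1/2) * sqrt (2 * pi) * exp (- z) * (sqrt z * bessel_I \<nu> z)) \<le>
    2 * (\<integral>\<^sup>+u\<in>{0<..<z}. ennreal (u powr (\<nu> - 1/2) * (1 - u / (2 * z)) powr (\<nu> - 1/2) * exp (- u)) \<partial>lborel)"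
    by (rule poisson_integral[OF \<nu>(1) z])
  also have "(\<integral>\<^sup>+u\<in>{0<..<z}. ennreal (u powr (\<nu> - 1/2) * (1 - u / (2 * z)) powr (\<nu> - 1/2) * exp (- u)) \<partial>lborel)
     \<le> (\<integral>\<^sup>+u. 2 * (ennreal (u powr (\<nu> + 1/2 - 1) * exp (- u)) * indicator {0<..} u) \<partial>lborel)"
  proof (intro nn_integral_mono)
    fix u :: real
    have "(1 - u / (2 * z)) powr (\<nu> - 1/2) \<le> 2" if "0 < u" "u < z"
    proof -
      have h: "1/2 \<le> 1 - u / (2 * z)" using that z by (simp add: field_simps)
      have "(1 - u / (2 * z)) powr (\<nu> - 1/2) \<le> (1/2) powr (\<nu> - 1/2)"
        using h \<nu> by (intro powr_mono2') auto
      also have "\<dots> = 2 powr (1/2 - \<nu>)" by (simp add: powr_divide powr_minus_divide[symmetric])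
      also have "\<dots> \<le> 2 powr 1" using \<nu> by (intro powr_mono) auto
      finally show ?thesis by simp
    qed
    then have "u powr (\<nu> - 1/2) * ((1 - u / (2 * z)) powr (\<nu> - 1/2)) * exp (- u) \<le> u powr (\<nu> - 1/2) * 2 * exp (- u)"
      if "0 < u" "u < z" using that by (intro mult_right_mono mult_left_mono) auto
    then have "ennreal (u powr (\<nu> - 1/2) * (1 - u / (2 * z)) powr (\<nu> - 1/2) * exp (- u)) \<le> ennreal (2 * (u powr (\<nu> + 1/2 - 1) * exp (- u)))"
      if "0 < u" "u < z" using that by (intro ennreal_leI) (simp add: mult_ac)
    then show "ennreal (u powr (\<nu> - 1/2) * (1 - u / (2 * z)) powr (\<nu> - 1/2) * exp (- u)) * indicator {0<..<z} u \<le>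
      2 * (ennreal (u powr (\<nu> + 1/2 - 1) * exp (- u)) * indicator {0<..} u)"
      by (auto simp: indicator_def ennreal_mult')
  qed
  also have "\<dots> = 2 * ennreal (Gamma (\<nu> + 1/2))"
    using \<nu> nn_integral_Gamma[of "\<nu> + 1/2"] by (subst nn_integral_cmult) auto
  also have "2 * (2 * ennreal (Gamma (\<nu> + 1/2))) = ennreal (4 * Gamma (\<nu> + 1/2))"
    using \<nu> by (simp add: mult.assoc[symmetric] ennreal_mult')
  finally have "sqrt z * bessel_I \<nu> z \<le> 4 * (exp z / sqrt (2 * pi))"
    using \<nu> z by (intro bessel_I_le_of_poisson_le) (auto simp: mult_left_mono)
  then show ?thesis using exp_le_cosh_scaled[of z] by simp
qed

lemma bessel_I_asymptotic_lower:
  fixes \<nu> :: real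
  assumes \<nu>: "\<nu> \<ge> -1/2"
  obtains K where "K \<ge> 0" "\<And>z. z > 0 \<Longrightarrow> exp z / sqrt (2 * pi) * (1 - K / z) \<le> sqrt z * bessel_I \<nu> z"
proof (cases "\<nu> = -1/2")
  case True
  have "exp z / sqrt (2 * pi) * (1 - 0 / z) \<le> sqrt z * bessel_I \<nu> z" if "z > 0" for z
    using exp_le_cosh_scaled[of z] bessel_I_minus_half[OF that] True by simp
  then show ?thesis using that[of 0] by auto
next
  case False
  with \<nu> have \<nu>: "\<nu> > -1/2" by simp
  define n where "n = max 1 (nat \<lceil>\<nu> - 1/2\<rceil>)"
  have n: "n \<ge> 1" "\<nu> - 1/2 \<le> real n" unfolding n_def by linarith+
  show ?thesis
  proof (rule that[of "real n * (\<nu> + 1/2) / 2"])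
    show "0 \<le> real n * (\<nu> + 1/2) / 2" using \<nu> by simp
    fix z :: real assume z: "z > 0"
    have "1 + (- (real n / (2 * z))) * u + 0 * u\<^sup>2 \<le> (if u < 2 * z then (1 - u / (2 * z)) powr (\<nu> - 1/2) else 0)" if u: "u > 0" for u
    proof (cases "u < 2 * z")
      case True
      define v where "v = u / (2 * z)"
      have v: "0 < v" "v < 1" using True u z by (auto simp: v_def)
      have "1 + real n * (- v) \<le> (1 + (- v)) ^ n" by (rule Bernoulli_inequality) (use v in auto)
      also have "\<dots> = (1 - v) powr (real n)" using v by (simp add: powr_realpow)
      also have "\<dots> \<le> (1 - v) powr (\<nu> - 1/2)" using v n by (intro powr_mono') auto
      finally show ?thesis using True by (simp add: v_def)
    next
      case False
      then have "1 * 1 \<le> real n * (u / (2 * z))" using n z by (intro mult_mono) auto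
      then show ?thesis using False by simp
    qed
    from bessel_I_ge_of_weight_ge[OF \<nu> z this]
    show "exp z / sqrt (2 * pi) * (1 - real n * (\<nu> + 1/2) / 2 / z) \<le> sqrt z * bessel_I \<nu> z"
      by (simp add: field_simps)
  qed
qed

text \<open>The quadratic term absorbs the missing tail \<open>u \<ge> 2 * z\<close> of the Gamma distribution.\<close>

lemma bessel_I_asymptotic_lower_small_order:
  fixes \<nu> :: real
  assumes \<nu>: "-1/2 < \<nu>" "\<nu> < 1/2"
  obtains \<kappa> K where "\<kappa> > 0" "K \<ge> 0"
    "\<And>z. z > 0 \<Longrightarrow> exp z / sqrt (2 * pi) * (1 + \<kappa> / z - K / z\<^sup>2) \<le> sqrt z * bessel_I \<nu> z"
proof -
  define a where "a = 1/2 - \<nu>"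
  have a: "0 < a" "a < 1" using \<nu> by (auto simp: a_def)
  show ?thesis
  \<comment> \<open>The minorant is 1 + a v - (1 + a) v^2 with v = u/(2z): a is the slope of (1 - v)
    powr (-a) at 0, and 1 + a makes the quadratic vanish at v = 1 and stay nonpositive beyond. The
    first constant equals (1/4 - \<nu>^2)/2, the first correction in the classical expansion of the
    Bessel function.\<close>
  proof (rule that[of "a * (\<nu> + 1/2) / 2" "(1 + a) * ((\<nu> + 1/2) * (\<nu> + 3/2)) / 4"])
    show "0 < a * (\<nu> + 1/2) / 2" "0 \<le> (1 + a) * ((\<nu> + 1/2) * (\<nu> + 3/2)) / 4" using \<nu> a by auto
    fix z :: real assume z: "z > 0"
    have "1 + a / (2 * z) * u + (- ((1 + a) / (4 * z\<^sup>2))) * u\<^sup>2 \<le> (if u < 2 * z then (1 - u / (2 * z)) powr (\<nu> - 1/2) else 0)" if u: "u > 0" for u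
    proof -
      define v where "v = u / (2 * z)"
      have v: "0 < v" using u z by (auto simp: v_def)
      have eq: "1 + a / (2 * z) * u + (- ((1 + a) / (4 * z\<^sup>2))) * u\<^sup>2 = 1 + a * v - (1 + a) * v\<^sup>2"
        by (simp add: v_def power_divide power_mult_distrib)
      show ?thesis
      proof (cases "u < 2 * z")
        case True
        have v1: "v < 1" using True z by (simp add: v_def)
        have "a * v \<le> (- a) * ln (1 - v)" using ln_le_minus_one[of "1 - v"] v v1 a
          by (metis mult_le_cancel_left_pos mult_minus_left mult_minus_right diff_gt_0_iff_gt le_minus_iff add_diff_cancel_left' diff_diff_eq2 minus_diff_eq)
        also have "1 + (- a) * ln (1 - v) \<le> exp ((- a) * ln (1 - v))" by (rule exp_ge_add_one_self)
        also have "\<dots> = (1 - v) powr (\<nu> - 1/2)" using v1 by (simp add: powr_def a_def)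
        finally have "1 + a * v \<le> (1 - v) powr (\<nu> - 1/2)" by simp
        moreover have "0 \<le> (1 + a) * v\<^sup>2" using a by simp
        ultimately show ?thesis unfolding eq using True unfolding v_def by simp
      next
        case False
        then have v1: "1 \<le> v" using z by (simp add: v_def)
        then have "1 \<le> v\<^sup>2" "v \<le> v\<^sup>2" by (auto simp: power2_eq_square mult_le_cancel_left1 intro: mult_mono[of 1 v 1 v, simplified])
        then have "1 + a * v \<le> v\<^sup>2 + a * v\<^sup>2" using a by (intro add_mono mult_left_mono) auto
        then show ?thesis unfolding eq using False by (simp add: algebra_simps)
      qed
    qed
    from bessel_I_ge_of_weight_ge[OF \<nu>(1) z this]
    show "exp z / sqrt (2 * pi) * (1 + a * (\<nu> + 1/2) / 2 / z - (1 + a) * ((\<nu> + 1/2) * (\<nu> + 3/2)) / 4 / z\<^sup>2) \<le> sqrt z * bessel_I \<nu> z"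
      by simp
  qed
qed

section \<open>The one-dimensional Laguerre kernel\<close>

definition laguerre_kernel1 :: "real \<Rightarrow> real \<Rightarrow> real \<Rightarrow> real \<Rightarrow> real" where
  "laguerre_kernel1 \<nu> t x y =
    1 / sinh (2 * t) * exp (- (1 / 2) * (cosh (2 * t) / sinh (2 * t)) * (x\<^sup>2 + y\<^sup>2)) *
    (sqrt (x * y) * bessel_I \<nu> (x * y / sinh (2 * t)))"

lemma laguerre_kernel1_commute: "laguerre_kernel1 \<nu> t x y = laguerre_kernel1 \<nu> t y x"
  by (simp add: laguerre_kernel1_def mult.commute add.commute)

lemma laguerre_kernel1_nonneg:
  "\<lbrakk>\<nu> \<ge> -1/2; t > 0; x > 0; y > 0\<rbrakk> \<Longrightarrow> 0 \<le> laguerre_kernel1 \<nu> t x y"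
  unfolding laguerre_kernel1_def
  by (intro mult_nonneg_nonneg divide_nonneg_nonneg bessel_I_nonneg) auto

lemma measurable_laguerre_kernel1 [measurable]:
  assumes [measurable]: "f \<in> borel_measurable M" "g \<in> borel_measurable M"
  shows "(\<lambda>x. laguerre_kernel1 \<nu> t (f x) (g x)) \<in> borel_measurable M"
  unfolding laguerre_kernel1_def by measurable

text \<open>The Bessel estimates concern \<open>sqrt z * bessel_I \<nu> z\<close>. This form
  isolates that function at z = x y / sinh 2t by taking one factor sqrt (sinh 2t) out of the
  prefactor.\<close>

lemma laguerre_kernel1_eq:
  assumes "t > 0" "x > 0" "y > 0"
  shows "laguerre_kernel1 \<nu> t x y = exp (- (1 / 2) * (cosh (2 * t) / sinh (2 * t)) * (x\<^sup>2 + y\<^sup>2)) / sqrt (sinh (2 * t)) *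
     (sqrt (x * y / sinh (2 * t)) * bessel_I \<nu> (x * y / sinh (2 * t)))"
proof -
  have S: "sinh (2 * t) > 0" using assms by simp
  then have "1 / sinh (2 * t) * sqrt (x * y) = 1 / sqrt (sinh (2 * t)) * sqrt (x * y / sinh (2 * t))"
    using real_sqrt_mult_self[of "sinh (2 * t)"] by (simp add: real_sqrt_divide field_simps)
  moreover have "laguerre_kernel1 \<nu> t x y = (1 / sinh (2 * t) * sqrt (x * y)) *
      (exp (- (1 / 2) * (cosh (2 * t) / sinh (2 * t)) * (x\<^sup>2 + y\<^sup>2)) * bessel_I \<nu> (x * y / sinh (2 * t)))"
    unfolding laguerre_kernel1_def by (simp only: mult_ac)
  ultimately show ?thesis by simp
qed

text \<open>As a function of the middle variable the product is a Gaussian times z and two Bessel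
  functions, which is Weber's integrand. The addition formulas for sinh and cosh identify the
  outcome with the kernel at time s + t.\<close>

lemma laguerre_kernel1_chapman_kolmogorov:
  assumes \<nu>: "\<nu> \<ge> -1/2" and s: "s > 0" and t: "t > 0" and x: "x > 0" and y: "y > 0"
  shows "(\<integral>\<^sup>+z\<in>{0<..}. ennreal (laguerre_kernel1 \<nu> s x z * laguerre_kernel1 \<nu> t z y) \<partial>lborel)
    = ennreal (laguerre_kernel1 \<nu> (s + t) x y)"
proof -
  define A B C D where "A = sinh (2 * s)" and "B = cosh (2 * s)" and "C = sinh (2 * t)" and "D = cosh (2 * t)"
  have pos: "A > 0" "B > 0" "C > 0" "D > 0" using s t by (auto simp: A_def B_def C_def D_def cosh_real_pos)
  have BA: "B\<^sup>2 = A\<^sup>2 + 1" and DC: "D\<^sup>2 = C\<^sup>2 + 1"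
    by (simp_all add: A_def B_def C_def D_def cosh_square_eq)
  have sum: "sinh (2 * (s + t)) = A * D + B * C" "cosh (2 * (s + t)) = B * D + A * C"
    unfolding A_def B_def C_def D_def distrib_left sinh_add cosh_add by simp_all
  have P: "A * D + B * C > 0" using pos by (intro add_pos_pos mult_pos_pos)
  \<comment> \<open>The Gaussian rate in the middle variable: half of coth 2s + coth 2t, which is
    sinh (2 (s + t)) / (2 sinh 2s sinh 2t).\<close>
  define p where "p = (B / A + D / C) / 2"
  have p: "p = (A * D + B * C) / (2 * A * C)" using pos by (simp add: p_def field_simps)
  have p0: "p > 0" unfolding p using P pos by simp
  define W where "W = exp (- (1/2) * (B / A) * x\<^sup>2 - (1/2) * (D / C) * y\<^sup>2) * sqrt (x * y) / (A * C)"
  have W: "W \<ge> 0" using pos x y by (simp add: W_def)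
  have "laguerre_kernel1 \<nu> s x z * laguerre_kernel1 \<nu> t z y =
      W * (exp (- p * z\<^sup>2) * (z * (bessel_I \<nu> (x / A * z) * bessel_I \<nu> (y / C * z))))" if z: "z > 0" for z
  proof -
    have "sqrt (x * z) * sqrt (z * y) = sqrt (x * y) * z"
      using x y z by (simp add: real_sqrt_mult mult_ac)
    moreover have "exp (- (1/2) * (B / A) * (x\<^sup>2 + z\<^sup>2)) * exp (- (1/2) * (D / C) * (z\<^sup>2 + y\<^sup>2)) =
      exp (- (1/2) * (B / A) * x\<^sup>2 - (1/2) * (D / C) * y\<^sup>2) * exp (- p * z\<^sup>2)"
      unfolding exp_add[symmetric] p_def by (simp add: algebra_simps add_divide_distrib)
    moreover have "laguerre_kernel1 \<nu> s x z * laguerre_kernel1 \<nu> t z y =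
       (exp (- (1/2) * (B / A) * (x\<^sup>2 + z\<^sup>2)) * exp (- (1/2) * (D / C) * (z\<^sup>2 + y\<^sup>2))) * (sqrt (x * z) * sqrt (z * y)) / (A * C) *
       (bessel_I \<nu> (x / A * z) * bessel_I \<nu> (y / C * z))"
      unfolding laguerre_kernel1_def A_def B_def C_def D_def by (simp add: mult_ac)
    ultimately show ?thesis unfolding W_def by (simp add: mult_ac)
  qed
  then have "(\<integral>\<^sup>+z\<in>{0<..}. ennreal (laguerre_kernel1 \<nu> s x z * laguerre_kernel1 \<nu> t z y) \<partial>lborel) =
     (\<integral>\<^sup>+z. ennreal W * (ennreal (exp (- p * z\<^sup>2) * (z * (bessel_I \<nu> (x / A * z) * bessel_I \<nu> (y / C * z)))) * indicator {0<..} z) \<partial>lborel)"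
    using W by (intro nn_integral_cong) (auto simp: indicator_def ennreal_mult')
  also have "\<dots> = ennreal W * (\<integral>\<^sup>+z\<in>{0<..}. ennreal (exp (- p * z\<^sup>2) * (z * (bessel_I \<nu> (x / A * z) * bessel_I \<nu> (y / C * z)))) \<partial>lborel)"
    by (rule nn_integral_cmult) measurable
  also have "\<dots> = ennreal W * ennreal (exp (((x / A)\<^sup>2 + (y / C)\<^sup>2) / (4 * p)) / (2 * p) * bessel_I \<nu> (x / A * (y / C) / (2 * p)))"
    using \<nu> x y pos p0 by (subst weber_second_exponential_integral) auto
  also have "\<dots> = ennreal (W * (exp (((x / A)\<^sup>2 + (y / C)\<^sup>2) / (4 * p)) / (2 * p) * bessel_I \<nu> (x / A * (y / C) / (2 * p))))"
    using W by (rule ennreal_mult'[symmetric])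
  also have "W * (exp (((x / A)\<^sup>2 + (y / C)\<^sup>2) / (4 * p)) / (2 * p) * bessel_I \<nu> (x / A * (y / C) / (2 * p))) = laguerre_kernel1 \<nu> (s + t) x y"
  proof -
    have arg: "x / A * (y / C) / (2 * p) = x * y / (A * D + B * C)"
      using pos P unfolding p by (simp add: field_simps)
    have pre: "1 / (A * C) / (2 * p) = 1 / (A * D + B * C)"
      using pos P unfolding p by (simp add: field_simps)
    \<comment> \<open>The coefficient of x^2 after Weber's integral. It is stated for arbitrary a,
      b, c, d so that the coefficient of y^2 follows by exchanging the two times; the essential
      identity is cosh^2 = sinh^2 + 1.\<close>
    have e: "- (1/2) * (b / a) + 1 / (a\<^sup>2 * (4 * p)) = - (1/2) * ((B * D + A * C) / (A * D + B * C))"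
      if "a * d + b * c = A * D + B * C" "b * d + a * c = B * D + A * C" "a * c = A * C" "b\<^sup>2 = a\<^sup>2 + 1" "a > 0" "c > 0" for a b c d
    proof -
      define Q where "Q = a * d + b * c"
      have Q: "Q > 0" using P that by (simp add: Q_def)
      have pQ: "p = Q / (2 * a * c)" unfolding p Q_def using that by (simp add: mult.assoc)
      have "b * Q - c = a * (b * d) + (b\<^sup>2 - 1) * c" by (simp add: Q_def algebra_simps power2_eq_square)
      also have "\<dots> = a * (b * d + a * c)" using that by (simp add: algebra_simps power2_eq_square)
      finally have "b / a - c / (a * Q) = (b * d + a * c) / Q"
        using that(5) Q by (simp add: divide_simps)
      moreover have "1 / (a\<^sup>2 * (4 * p)) = (1/2) * (c / (a * Q))"
        using that(5,6) Q unfolding pQ by (simp add: divide_simps power2_eq_square)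
      ultimately show ?thesis using that(1,2) by (simp add: Q_def algebra_simps)
    qed
    note ex = e[of A D B C, OF refl refl refl BA pos(1,3)]
    have ey: "- (1/2) * (D / C) + 1 / (C\<^sup>2 * (4 * p)) = - (1/2) * ((B * D + A * C) / (A * D + B * C))"
      by (rule e[of C B D A]) (use pos DC in \<open>simp_all add: mult.commute add.commute\<close>)
    have "exp (- (1/2) * (B / A) * x\<^sup>2 - (1/2) * (D / C) * y\<^sup>2) * exp (((x / A)\<^sup>2 + (y / C)\<^sup>2) / (4 * p)) =
      exp ((- (1/2) * (B / A) + 1 / (A\<^sup>2 * (4 * p))) * x\<^sup>2 + (- (1/2) * (D / C) + 1 / (C\<^sup>2 * (4 * p))) * y\<^sup>2)"
      unfolding exp_add[symmetric] by (simp add: power_divide algebra_simps add_divide_distrib)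
    also have "\<dots> = exp (- (1/2) * ((B * D + A * C) / (A * D + B * C)) * (x\<^sup>2 + y\<^sup>2))"
      unfolding ex ey by (simp only: distrib_left)
    finally have E: "exp (- (1/2) * (B / A) * x\<^sup>2 - (1/2) * (D / C) * y\<^sup>2) * exp (((x / A)\<^sup>2 + (y / C)\<^sup>2) / (4 * p)) =
      exp (- (1/2) * ((B * D + A * C) / (A * D + B * C)) * (x\<^sup>2 + y\<^sup>2))" .
    have "W * (exp (((x / A)\<^sup>2 + (y / C)\<^sup>2) / (4 * p)) / (2 * p) * bessel_I \<nu> (x / A * (y / C) / (2 * p))) =
      (exp (- (1/2) * (B / A) * x\<^sup>2 - (1/2) * (D / C) * y\<^sup>2) * exp (((x / A)\<^sup>2 + (y / C)\<^sup>2) / (4 * p))) *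
      (1 / (A * C) / (2 * p)) * (sqrt (x * y) * bessel_I \<nu> (x / A * (y / C) / (2 * p)))"
      by (simp add: W_def)
    then show ?thesis unfolding E pre arg laguerre_kernel1_def sum by simp
  qed
  finally show ?thesis .
qed

text \<open>The right-hand side is \<open>C\<close> times the kernel of order -1/2, the folded
  Mehler kernel.\<close>

lemma laguerre_kernel1_le:
  assumes C: "C \<ge> 0" "\<And>z. z > 0 \<Longrightarrow> sqrt z * bessel_I \<nu> z \<le> C * (sqrt (2 / pi) * cosh z)"
    and t: "t > 0" and x: "x > 0" and y: "y > 0"
  shows "laguerre_kernel1 \<nu> t x y \<le> C * sqrt (2 / pi) / sqrt (sinh (2 * t)) *
    (exp (- (1 / 2) * (cosh (2 * t) / sinh (2 * t)) * (x\<^sup>2 + y\<^sup>2)) * cosh (x * y / sinh (2 * t)))"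
proof -
  have S: "sinh (2 * t) > 0" using t by simp
  have "sqrt (x * y / sinh (2 * t)) * bessel_I \<nu> (x * y / sinh (2 * t)) \<le> C * (sqrt (2 / pi) * cosh (x * y / sinh (2 * t)))"
    using S x y by (intro C) auto
  then have "laguerre_kernel1 \<nu> t x y \<le> exp (- (1 / 2) * (cosh (2 * t) / sinh (2 * t)) * (x\<^sup>2 + y\<^sup>2)) / sqrt (sinh (2 * t)) *
    (C * (sqrt (2 / pi) * cosh (x * y / sinh (2 * t))))"
    unfolding laguerre_kernel1_eq[OF t x y] using S by (intro mult_left_mono) auto
  then show ?thesis by (simp only: divide_inverse mult_ac)
qed

text \<open>Since coth 2t \<ge> 1 / sinh 2t and x^2 + y^2 \<ge> 2 x y, the Gaussian factor outweighs
  cosh \<le> exp. The bound serves to make the kernel integrals of functions in L^p with finite p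
  converge.\<close>

lemma laguerre_kernel1_bounded:
  assumes \<nu>: "\<nu> \<ge> -1/2" and t: "t > 0" and x: "x > 0" and y: "y > 0"
  shows "laguerre_kernel1 \<nu> t x y \<le> 4 * sqrt (2 / pi) / sqrt (sinh (2 * t))"
proof -
  define S where "S = sinh (2 * t)"
  have S: "S > 0" using t by (simp add: S_def)
  have "1 \<le> cosh (2 * t)" by (rule cosh_real_ge_1)
  then have "(1/2) * (cosh (2 * t) / S) * (x\<^sup>2 + y\<^sup>2) \<ge> (1/2) * (1 / S) * (x\<^sup>2 + y\<^sup>2)"
    using S by (intro mult_right_mono mult_left_mono divide_right_mono) auto
  moreover have "(1/2) * (1 / S) * (x\<^sup>2 + y\<^sup>2) \<ge> x * y / S"
    using S sum_squares_bound[of x y] by (simp add: divide_simps)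
  moreover have "cosh (x * y / S) \<le> exp (x * y / S)"
    using S x y by (simp add: cosh_def field_simps)
  ultimately have "exp (- (1 / 2) * (cosh (2 * t) / S) * (x\<^sup>2 + y\<^sup>2)) * cosh (x * y / S) \<le> exp (- (x * y / S)) * exp (x * y / S)"
    by (intro mult_mono) auto
  also have "\<dots> = 1" by (simp add: exp_add[symmetric])
  finally have "4 * sqrt (2 / pi) / sqrt S * (exp (- (1 / 2) * (cosh (2 * t) / S) * (x\<^sup>2 + y\<^sup>2)) * cosh (x * y / S))
     \<le> 4 * sqrt (2 / pi) / sqrt S * 1" using S by (intro mult_left_mono) auto
  moreover have "laguerre_kernel1 \<nu> t x y \<le> 4 * sqrt (2 / pi) / sqrt (sinh (2 * t)) *
    (exp (- (1 / 2) * (cosh (2 * t) / sinh (2 * t)) * (x\<^sup>2 + y\<^sup>2)) * cosh (x * y / sinh (2 * t)))"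
    using bessel_I_le_cosh_uniform[OF \<nu>] by (intro laguerre_kernel1_le t x y) auto
  ultimately show ?thesis by (simp add: S_def)
qed

text \<open>After completing the square the comparison kernel is a multiple of h(y) + h(-y) for a
  normal density h. Reflection moves the second term to the negative half-line, so the two together
  integrate to exactly 1 and no error function appears.\<close>

lemma laguerre_kernel1_row_mass:
  assumes C: "C \<ge> 0" "\<And>z. z > 0 \<Longrightarrow> sqrt z * bessel_I \<nu> z \<le> C * (sqrt (2 / pi) * cosh z)"
    and t: "t > 0" and x: "x > 0"
  shows "(\<integral>\<^sup>+y\<in>{0<..}. ennreal (laguerre_kernel1 \<nu> t x y) \<partial>lborel) \<le> ennreal (C * cosh (2 * t) powr (-1/2))"
proof -
  define S c where "S = sinh (2 * t)" and "c = cosh (2 * t) / S"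
  have Ch: "cosh (2 * t) \<ge> 1" by (rule cosh_real_ge_1)
  have S: "S > 0" using t by (simp add: S_def)
  have c: "c > 0" using S Ch by (simp add: c_def)
  \<comment> \<open>Completing the square in \<open>y\<close> gives mean x / cosh 2t, variance tanh
    2t and the leftover factor exp (- tanh (2t) x^2 / 2), which is finally estimated by 1.\<close>
  define m \<sigma> E where "m = x / (S * c)" and "\<sigma> = 1 / sqrt c" and "E = exp (- (1/2) * (S / cosh (2 * t)) * x\<^sup>2)"
  have \<sigma>: "\<sigma> > 0" "\<sigma>\<^sup>2 = 1 / c" using c by (auto simp: \<sigma>_def power_divide)
  have E: "0 \<le> E" "E \<le> 1" using S Ch by (auto simp: E_def)
  define h where "h = normal_density m \<sigma>"
  define A where "A = C * sqrt (2 / pi) / sqrt S * (E * sqrt (2 * pi / c) / 2)"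
  have A: "A \<ge> 0" using C S c E by (simp add: A_def)
  have h: "exp (- (1/2) * c * (x\<^sup>2 + y\<^sup>2) + x * y / S) = E * sqrt (2 * pi / c) * h y" for y
  proof -
    have Sc: "S * c = cosh (2 * t)" using S by (simp add: c_def)
    have ch2: "(cosh (2 * t))\<^sup>2 = S\<^sup>2 + 1" by (simp add: S_def cosh_square_eq)
    have 1: "c * m = x / S" using c by (simp add: m_def)
    have "c * m\<^sup>2 = x\<^sup>2 / (S * cosh (2 * t))"
      using S Ch unfolding m_def Sc by (simp add: c_def power2_eq_square)
    moreover have "c * x\<^sup>2 - x\<^sup>2 / (S * cosh (2 * t)) = S / cosh (2 * t) * x\<^sup>2"
    proof -
      have "c - 1 / (S * cosh (2 * t)) = ((cosh (2 * t))\<^sup>2 - 1) / (S * cosh (2 * t))"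
        using S Ch by (simp add: c_def field_simps power2_eq_square)
      also have "\<dots> = S / cosh (2 * t)" unfolding ch2 using S by (simp add: power2_eq_square)
      finally have "S / cosh (2 * t) * x\<^sup>2 = (c - 1 / (S * cosh (2 * t))) * x\<^sup>2" by simp
      then show ?thesis by (simp add: algebra_simps)
    qed
    ultimately have 2: "c * m\<^sup>2 = c * x\<^sup>2 - S / cosh (2 * t) * x\<^sup>2" by simp
    have "- (1/2) * c * (x\<^sup>2 + y\<^sup>2) + x * y / S = - (1/2) * (c * x\<^sup>2) - (1/2) * (c * y\<^sup>2) + (c * m) * y"
      unfolding 1 by (simp add: algebra_simps)
    also have "\<dots> = - (1/2) * (S / cosh (2 * t)) * x\<^sup>2 + (- (1/2) * (c * (y - m)\<^sup>2))"
      using 2 by (simp add: algebra_simps power2_diff)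
    finally have "exp (- (1/2) * c * (x\<^sup>2 + y\<^sup>2) + x * y / S) = E * exp (- (1/2) * (c * (y - m)\<^sup>2))"
      by (simp only: E_def exp_add)
    also have "exp (- (1/2) * (c * (y - m)\<^sup>2)) = sqrt (2 * pi / c) * h y"
      using c by (simp add: h_def normal_density_def \<sigma> mult_ac)
    finally show ?thesis by simp
  qed
  have le: "laguerre_kernel1 \<nu> t x y \<le> A * (h y + h (- y))" if y: "y > 0" for y
  proof -
    have "exp (- (1/2) * c * (x\<^sup>2 + y\<^sup>2)) * cosh (x * y / S) =
      (exp (- (1/2) * c * (x\<^sup>2 + y\<^sup>2) + x * y / S) + exp (- (1/2) * c * (x\<^sup>2 + (-y)\<^sup>2) + x * (-y) / S)) / 2"
    proof -
      have "exp a * cosh b = (exp (a + b) + exp (a + (- b))) / 2" for a b :: real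
        by (simp only: exp_add cosh_def) (simp add: algebra_simps)
      from this[of "- (1/2) * c * (x\<^sup>2 + y\<^sup>2)" "x * y / S"] show ?thesis by simp
    qed
    also have "\<dots> = E * sqrt (2 * pi / c) / 2 * (h y + h (- y))"
      unfolding h by (simp add: algebra_simps)
    finally have e: "exp (- (1/2) * c * (x\<^sup>2 + y\<^sup>2)) * cosh (x * y / S) = E * sqrt (2 * pi / c) / 2 * (h y + h (- y))" .
    show ?thesis
      using laguerre_kernel1_le[OF C t x y] unfolding S_def[symmetric] c_def[symmetric] A_def e by (simp only: mult.assoc)
  qed
  have hm [measurable]: "h \<in> borel_measurable borel" by (simp add: h_def)
  have hn: "h y \<ge> 0" for y by (simp add: h_def)
  have "(\<integral>\<^sup>+y\<in>{0<..}. ennreal (laguerre_kernel1 \<nu> t x y) \<partial>lborel) \<le>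
    (\<integral>\<^sup>+y. ennreal A * (ennreal (h y) * indicator {0<..} y + ennreal (h (- y)) * indicator {0<..} y) \<partial>lborel)"
  proof (intro nn_integral_mono)
    fix y :: real
    show "ennreal (laguerre_kernel1 \<nu> t x y) * indicator {0<..} y \<le> ennreal A * (ennreal (h y) * indicator {0<..} y + ennreal (h (- y)) * indicator {0<..} y)"
      using le[of y] hn A by (cases "y > 0") (auto simp: ennreal_mult[symmetric] ennreal_plus[symmetric] intro!: ennreal_leI simp del: ennreal_plus)
  qed
  also have "\<dots> = ennreal A * ((\<integral>\<^sup>+y\<in>{0<..}. ennreal (h y) \<partial>lborel) + (\<integral>\<^sup>+y\<in>{0<..}. ennreal (h (- y)) \<partial>lborel))"
    by (subst nn_integral_cmult, measurable, subst nn_integral_add) auto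
  also have "(\<integral>\<^sup>+y\<in>{0<..}. ennreal (h (- y)) \<partial>lborel) = (\<integral>\<^sup>+y\<in>{..<0}. ennreal (h y) \<partial>lborel)"
    by (subst (2) nn_integral_real_affine[where c="-1" and t=0]) (auto simp: indicator_def intro!: nn_integral_cong)
  also have "(\<integral>\<^sup>+y\<in>{0<..}. ennreal (h y) \<partial>lborel) + (\<integral>\<^sup>+y\<in>{..<0}. ennreal (h y) \<partial>lborel) = (\<integral>\<^sup>+y. ennreal (h y) \<partial>lborel)"
    by (subst nn_integral_add[symmetric], measurable, rule nn_integral_cong_AE, rule AE_mp[OF AE_lborel_singleton[of 0]])
       (auto simp: indicator_def)
  also have "(\<integral>\<^sup>+y. ennreal (h y) \<partial>lborel) = 1"
    using nn_integral_eq_integral[of lborel h] \<sigma> hn by (simp add: h_def integrable_normal_density integral_normal_density)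
  also have "ennreal A * 1 \<le> ennreal (C * cosh (2 * t) powr (-1/2))"
  proof -
    have "sqrt (2 / pi) / sqrt S * (sqrt (2 * pi / c) / 2) = 1 / sqrt (S * c)"
      using S c by (simp add: real_sqrt_divide real_sqrt_mult field_simps)
    also have "S * c = cosh (2 * t)" using S by (simp add: c_def)
    also have "1 / sqrt (cosh (2 * t)) = cosh (2 * t) powr (-1/2)"
      using Ch powr_minus[of "cosh (2 * t)" "1/2"] by (simp add: powr_half_sqrt inverse_eq_divide)
    finally have e: "sqrt (2 / pi) / sqrt S * (sqrt (2 * pi / c) / 2) = cosh (2 * t) powr (-1/2)" .
    have "A = C * (sqrt (2 / pi) / sqrt S * (sqrt (2 * pi / c) / 2)) * E"
      unfolding A_def by (simp only: divide_inverse mult_ac)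
    then have "A = C * cosh (2 * t) powr (-1/2) * E" unfolding e .
    also have "\<dots> \<le> C * cosh (2 * t) powr (-1/2) * 1" using C E by (intro mult_left_mono) auto
    finally show ?thesis by (simp add: ennreal_leI)
  qed
  finally show ?thesis by simp
qed

text \<open>Chebyshev's inequality with the fourth moment keeps the Gaussian tail at second order in \<open>sinh (2 * t)\<close>;
  with the second moment it would compete with the first-order gain in \<open>laguerre_kernel1_mass_gain\<close>.\<close>

lemma laguerre_kernel1_local_mass:
  assumes t: "t > 0" and \<delta>: "0 < \<delta>" "\<delta> < x" and Q: "Q \<ge> 0"
    and le: "\<And>y. \<bar>y - x\<bar> < \<delta> \<Longrightarrow>
      exp (x * y / sinh (2 * t)) / sqrt (2 * pi) * Q \<le> sqrt (x * y / sinh (2 * t)) * bessel_I \<nu> (x * y / sinh (2 * t))"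
  shows "ennreal (cosh (2 * t) powr (-1/2) * exp (- 2 * x\<^sup>2 * sinh (2 * t)) * Q * (1 - 3 * (sinh (2 * t))\<^sup>2 / \<delta> ^ 4))
    \<le> (\<integral>\<^sup>+y\<in>{x - \<delta><..<x + \<delta>}. ennreal (laguerre_kernel1 \<nu> t x y) \<partial>lborel)"
proof -
  define S c where "S = sinh (2 * t)" and "c = cosh (2 * t) / S"
  have Ch: "cosh (2 * t) \<ge> 1" by (rule cosh_real_ge_1)
  have S: "S > 0" using t by (simp add: S_def)
  have c: "c > 0" using S Ch by (simp add: c_def)
  have Sc: "S * c = cosh (2 * t)" using S by (simp add: c_def)
  have x: "x > 0" using \<delta> by simp
  define \<sigma> h where "\<sigma> = 1 / sqrt c" and "h = normal_density x \<sigma>"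
  have \<sigma>: "\<sigma> > 0" "\<sigma>\<^sup>2 = 1 / c" using c by (auto simp: \<sigma>_def power_divide)
  have hn: "h y \<ge> 0" for y by (simp add: h_def)
  define E where "E = cosh (2 * t) powr (-1/2) * exp (- 2 * x\<^sup>2 * S) * Q"
  have E: "E \<ge> 0" using Q by (simp add: E_def)
  \<comment> \<open>The Gaussian is centred at \<open>x\<close> and not at its true mean x / cosh
    2t. The price is exp (- x y (c - 1/S)); since c - 1/S \<le> S and y < 2 x on the window, this is
    at least exp (- 2 x^2 S).\<close>
  have lower: "E * h y \<le> laguerre_kernel1 \<nu> t x y" if y: "\<bar>y - x\<bar> < \<delta>" for y
  proof -
    have y0: "0 < y" "y < 2 * x" using y \<delta> by linarith+
    have "(cosh (2 * t) - 1) * 1 \<le> (cosh (2 * t) - 1) * (cosh (2 * t) + 1)"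
      using Ch by (intro mult_left_mono) auto
    also have "\<dots> = S * S" using cosh_square_eq[of "2 * t"] by (simp add: S_def algebra_simps power2_eq_square)
    finally have "c - 1 / S \<le> S" using S by (simp add: c_def field_simps)
    then have "x * y * (c - 1 / S) \<le> x * y * S" using x y0 by (intro mult_left_mono) auto
    also have "\<dots> \<le> x * (2 * x) * S" using x y0 S by (intro mult_right_mono mult_left_mono) auto
    finally have 1: "x * y * (c - 1 / S) \<le> 2 * x\<^sup>2 * S" by (simp add: power2_eq_square)
    have "- (1/2) * c * (x\<^sup>2 + y\<^sup>2) = - (1/2) * (c * (y - x)\<^sup>2) - x * y * (c - 1 / S) - x * y / S"
      by (simp add: power2_eq_square algebra_simps)
    with 1 have "- (1/2) * (c * (y - x)\<^sup>2) + (- 2 * x\<^sup>2 * S) + (- (x * y / S)) \<le> - (1/2) * c * (x\<^sup>2 + y\<^sup>2)"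
      by simp
    then have e1: "exp (- (1/2) * (c * (y - x)\<^sup>2)) * exp (- 2 * x\<^sup>2 * S) * exp (- (x * y / S)) \<le> exp (- (1/2) * c * (x\<^sup>2 + y\<^sup>2))"
      unfolding exp_add[symmetric] exp_le_cancel_iff .
    have "exp (- (1/2) * (c * (y - x)\<^sup>2)) * exp (- 2 * x\<^sup>2 * S) * exp (- (x * y / S)) / sqrt S * (exp (x * y / S) / sqrt (2 * pi) * Q)
       \<le> exp (- (1/2) * c * (x\<^sup>2 + y\<^sup>2)) / sqrt S * (sqrt (x * y / S) * bessel_I \<nu> (x * y / S))"
      by (rule mult_mono[OF divide_right_mono[OF e1] le[OF y, folded S_def]]) (use S Q in auto)
    also have "\<dots> = laguerre_kernel1 \<nu> t x y"
      unfolding laguerre_kernel1_eq[OF t x y0(1)] S_def[symmetric] c_def[symmetric] ..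
    also have "exp (- (1/2) * (c * (y - x)\<^sup>2)) * exp (- 2 * x\<^sup>2 * S) * exp (- (x * y / S)) / sqrt S * (exp (x * y / S) / sqrt (2 * pi) * Q)
      = (exp (- (x * y / S)) * exp (x * y / S)) * (exp (- 2 * x\<^sup>2 * S) * Q * (exp (- (1/2) * (c * (y - x)\<^sup>2)) / (sqrt S * sqrt (2 * pi))))"
      by simp
    also have "\<dots> = exp (- 2 * x\<^sup>2 * S) * Q * (exp (- (1/2) * (c * (y - x)\<^sup>2)) / (sqrt S * sqrt (2 * pi)))"
      by (simp add: exp_add[symmetric])
    also have "exp (- (1/2) * (c * (y - x)\<^sup>2)) / (sqrt S * sqrt (2 * pi)) = cosh (2 * t) powr (-1/2) * h y"
    proof -
      have p: "cosh (2 * t) powr (-1/2) = 1 / sqrt (S * c)"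
        using Ch powr_minus[of "cosh (2 * t)" "1/2"] by (simp add: powr_half_sqrt inverse_eq_divide Sc)
      have h: "h y = sqrt c / sqrt (2 * pi) * exp (- (1/2) * (c * (y - x)\<^sup>2))"
        using c by (simp add: h_def normal_density_def \<sigma> real_sqrt_divide mult_ac)
      show ?thesis unfolding p h using S c by (simp add: real_sqrt_mult)
    qed
    finally show ?thesis by (simp add: E_def mult_ac)
  qed
  have i0: "has_bochner_integral lborel h 1"
    using \<sigma> by (simp add: has_bochner_integral_iff h_def integrable_normal_density integral_normal_density)
  have i4: "has_bochner_integral lborel (\<lambda>y. h y * (y - x) ^ 4) (3 / c\<^sup>2)"
  proof -
    have "fact (2 * 2) / ((2 / \<sigma>\<^sup>2) ^ 2 * fact 2) = 3 / c\<^sup>2"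
      unfolding \<sigma>(2) using c by (simp add: fact_numeral field_simps power2_eq_square)
    then show ?thesis using normal_moment_even[OF \<sigma>(1), of x 2] unfolding h_def by simp
  qed
  \<comment> \<open>Chebyshev as a pointwise minorant: h (1 - ((y - x)/\<delta>)^4) is at most h on
    the window and nonpositive off it. The fourth moment is 3/c^2, and 1/c \<le> S because S c =
    cosh 2t \<ge> 1.\<close>
  have i: "has_bochner_integral lborel (\<lambda>y. E * (h y - 1 / \<delta> ^ 4 * (h y * (y - x) ^ 4))) (E * (1 - 1 / \<delta> ^ 4 * (3 / c\<^sup>2)))"
    by (intro has_bochner_integral_mult_right has_bochner_integral_diff i0 i4)
  have "3 * S\<^sup>2 / \<delta> ^ 4 \<ge> 1 / \<delta> ^ 4 * (3 / c\<^sup>2)"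
  proof -
    have "1 \<le> (S * c)\<^sup>2" unfolding Sc using Ch by (simp add: power2_eq_square mult_ge1_I)
    then have "1 / c\<^sup>2 \<le> S\<^sup>2" using c by (simp add: power_mult_distrib divide_le_eq)
    then show ?thesis using \<delta> by (simp add: field_simps)
  qed
  then have "E * (1 - 3 * S\<^sup>2 / \<delta> ^ 4) \<le> E * (1 - 1 / \<delta> ^ 4 * (3 / c\<^sup>2))"
    using E by (intro mult_left_mono) auto
  then have "ennreal (E * (1 - 3 * S\<^sup>2 / \<delta> ^ 4)) \<le> ennreal (\<integral>y. E * (h y - 1 / \<delta> ^ 4 * (h y * (y - x) ^ 4)) \<partial>lborel)"
    unfolding has_bochner_integral_integral_eq[OF i] by (rule ennreal_leI)
  also have "\<dots> \<le> (\<integral>\<^sup>+y. ennreal (indicator {x - \<delta><..<x + \<delta>} y * laguerre_kernel1 \<nu> t x y) \<partial>lborel)"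
  proof (rule ennreal_integral_le_nn_integral[OF integrable.intros[OF i]])
    fix y
    show "E * (h y - 1 / \<delta> ^ 4 * (h y * (y - x) ^ 4)) \<le> indicator {x - \<delta><..<x + \<delta>} y * laguerre_kernel1 \<nu> t x y"
    proof (cases "\<bar>y - x\<bar> < \<delta>")
      case True
      have "0 \<le> 1 / \<delta> ^ 4 * (h y * (y - x) ^ 4)"
        using hn[of y] \<delta> by (intro mult_nonneg_nonneg) auto
      then have "E * (h y - 1 / \<delta> ^ 4 * (h y * (y - x) ^ 4)) \<le> E * h y"
        using E by (intro mult_left_mono) auto
      with lower[OF True] True show ?thesis by (auto simp: indicator_def abs_less_iff)
    next
      case False
      then have "\<delta> ^ 4 \<le> \<bar>y - x\<bar> ^ 4" using \<delta> by (intro power_mono) auto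
      then have "1 \<le> 1 / \<delta> ^ 4 * (y - x) ^ 4" using \<delta> by (simp add: field_simps power_even_abs)
      then have "h y * 1 \<le> h y * (1 / \<delta> ^ 4 * (y - x) ^ 4)" by (intro mult_left_mono hn)
      then have "E * (h y - 1 / \<delta> ^ 4 * (h y * (y - x) ^ 4)) \<le> 0"
        using E by (intro mult_nonneg_nonpos) (auto simp: mult_ac)
      moreover have "y \<notin> {x - \<delta><..<x + \<delta>}" using False by auto
      ultimately show ?thesis by simp
    qed
  qed
  also have "\<dots> = (\<integral>\<^sup>+y\<in>{x - \<delta><..<x + \<delta>}. ennreal (laguerre_kernel1 \<nu> t x y) \<partial>lborel)"
    by (intro nn_integral_cong) (auto simp: indicator_def)
  finally show ?thesis unfolding E_def S_def by simp
qed

text \<open>On the window x y stays above x (x - \<delta>) > 0, so the Bessel argument tends to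
  infinity uniformly as t tends to 0 and the correction K/z disappears. All remaining factors of the
  local bound tend to 1 as well. This is the source of strong continuity.\<close>

lemma laguerre_kernel1_local_mass_tendsto:
  assumes \<nu>: "\<nu> \<ge> -1/2" and \<delta>: "0 < \<delta>" "\<delta> < x"
  obtains L where "(L \<longlongrightarrow> 1) (at_right 0)"
    "\<forall>\<^sub>F t in at_right 0. 0 \<le> L t \<and>
      ennreal (L t) \<le> (\<integral>\<^sup>+y\<in>{x - \<delta><..<x + \<delta>}. ennreal (laguerre_kernel1 \<nu> t x y) \<partial>lborel)"
proof -
  obtain K where K: "K \<ge> 0" "\<And>z. z > 0 \<Longrightarrow> exp z / sqrt (2 * pi) * (1 - K / z) \<le> sqrt z * bessel_I \<nu> z"
    using bessel_I_asymptotic_lower[OF \<nu>] by blast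
  define m where "m = x * (x - \<delta>)"
  have m: "m > 0" using \<delta> by (simp add: m_def)
  define Q where "Q t = 1 - K * sinh (2 * t) / m" for t :: real
  define L where "L t = cosh (2 * t) powr (-1/2) * exp (- 2 * x\<^sup>2 * sinh (2 * t)) * Q t * (1 - 3 * (sinh (2 * t))\<^sup>2 / \<delta> ^ 4)" for t
  have s0: "((\<lambda>t. sinh (2 * t)) \<longlongrightarrow> 0) (at_right (0::real))"
    by (rule tendsto_eq_rhs, (rule tendsto_intros)+) auto
  have Q0: "(Q \<longlongrightarrow> 1) (at_right 0)"
  proof -
    have "(Q \<longlongrightarrow> 1 - K * 0 / m) (at_right 0)"
      unfolding Q_def by (intro tendsto_intros s0) (use m in auto)
    then show ?thesis by simp
  qed
  have L0: "(L \<longlongrightarrow> 1) (at_right 0)"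
  proof -
    have "((\<lambda>t. cosh (2 * t) powr (-1/2)) \<longlongrightarrow> cosh (2 * 0) powr (-1/2)) (at_right (0::real))"
      by (intro tendsto_intros) (auto simp: cosh_real_pos)
    moreover have "((\<lambda>t. exp (- 2 * x\<^sup>2 * sinh (2 * t))) \<longlongrightarrow> exp (- 2 * x\<^sup>2 * 0)) (at_right 0)"
      by (intro tendsto_intros s0)
    moreover have "((\<lambda>t. 1 - 3 * (sinh (2 * t))\<^sup>2 / \<delta> ^ 4) \<longlongrightarrow> 1 - 3 * 0\<^sup>2 / \<delta> ^ 4) (at_right 0)"
      by (intro tendsto_intros s0) (use \<delta> in auto)
    ultimately have "(L \<longlongrightarrow> cosh (2 * 0) powr (-1/2) * exp (- 2 * x\<^sup>2 * 0) * 1 * (1 - 3 * 0\<^sup>2 / \<delta> ^ 4)) (at_right 0)"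
      unfolding L_def by (intro tendsto_mult Q0)
    then show ?thesis by simp
  qed
  have "\<forall>\<^sub>F t in at_right 0. Q t > 0" "\<forall>\<^sub>F t in at_right 0. L t > 0"
    using order_tendstoD(1)[OF Q0, of 0] order_tendstoD(1)[OF L0, of 0] by auto
  moreover have "\<forall>\<^sub>F t in at_right (0::real). t > 0" by (simp add: eventually_at_filter)
  ultimately have "\<forall>\<^sub>F t in at_right 0. 0 \<le> L t \<and>
      ennreal (L t) \<le> (\<integral>\<^sup>+y\<in>{x - \<delta><..<x + \<delta>}. ennreal (laguerre_kernel1 \<nu> t x y) \<partial>lborel)"
  proof eventually_elim
    case (elim t)
    have S: "sinh (2 * t) > 0" using elim by simp
    show ?case unfolding L_def
    proof (intro conjI laguerre_kernel1_local_mass \<delta> \<open>t > 0\<close>)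
      show "0 \<le> Q t" using elim by simp
      fix y assume y: "\<bar>y - x\<bar> < \<delta>"
      have xy: "m \<le> x * y" using y \<delta> by (auto simp: m_def intro!: mult_left_mono)
      then have z: "x * y / sinh (2 * t) > 0" using S m by simp
      have "K * sinh (2 * t) / (x * y) \<le> K * sinh (2 * t) / m"
        using xy m K S by (intro divide_left_mono) auto
      then have "Q t \<le> 1 - K / (x * y / sinh (2 * t))" by (simp add: Q_def)
      then have "exp (x * y / sinh (2 * t)) / sqrt (2 * pi) * Q t \<le> exp (x * y / sinh (2 * t)) / sqrt (2 * pi) * (1 - K / (x * y / sinh (2 * t)))"
        by (intro mult_left_mono) auto
      also note K(2)[OF z]
      finally show "exp (x * y / sinh (2 * t)) / sqrt (2 * pi) * Q t \<le> sqrt (x * y / sinh (2 * t)) * bessel_I \<nu> (x * y / sinh (2 * t))" .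
    qed (use elim in \<open>simp add: L_def\<close>)
  qed
  with L0 show ?thesis by (rule that)
qed

section \<open>First-order loss and gain of row mass\<close>

lemma sinh_le_one_bounds:
  fixes t :: real
  assumes "t > 0" "sinh (2 * t) \<le> 1"
  shows "1 - sinh (2 * t) \<le> cosh (2 * t) powr (-1/2)"
proof -
  define S where "S = sinh (2 * t)"
  have S: "0 < S" "S \<le> 1" using assms by (auto simp: S_def)
  have Ch: "cosh (2 * t) \<ge> 1" by (rule cosh_real_ge_1)
  have "(1 - S) * (1 - S) * (cosh (2 * t)) \<le> 1"
  proof -
    have "(cosh (2 * t))\<^sup>2 = 1 + S\<^sup>2" by (simp add: S_def cosh_square_eq)
    also have "\<dots> \<le> (1 + S)\<^sup>2" using S by (simp add: power2_eq_square algebra_simps)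
    finally have "cosh (2 * t) \<le> 1 + S" using S by (simp add: power2_le_iff_abs_le abs_le_iff)
    then have "(1 - S) * ((1 - S) * (cosh (2 * t))) \<le> 1 * ((1 - S) * (1 + S))"
      using S Ch by (intro mult_mono) auto
    also have "\<dots> \<le> 1" by (simp add: algebra_simps)
    finally show ?thesis by (simp add: mult.assoc)
  qed
  then have "(1 - S)\<^sup>2 \<le> 1 / cosh (2 * t)" using Ch by (simp add: field_simps power2_eq_square)
  then have "1 - S \<le> sqrt (1 / cosh (2 * t))" by (rule real_le_rsqrt)
  also have "\<dots> = cosh (2 * t) powr (-1/2)"
    using Ch powr_minus[of "cosh (2 * t)" "1/2"] by (simp add: powr_half_sqrt real_sqrt_divide inverse_eq_divide)
  finally show ?thesis by (simp add: S_def)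
qed

lemma mult_one_minus_ge: "0 \<le> a \<Longrightarrow> 0 \<le> b \<Longrightarrow> 1 - (a + b) \<le> (1 - a) * (1 - (b::real))"
  by (simp add: algebra_simps)

text \<open>For the coordinates away from the exceptional one. Keeping x in [1, 2] makes the loss
  linear in sinh 2t with one constant for all such x, fixed independently of the small scale used in
  the exceptional coordinate.\<close>

lemma laguerre_kernel1_mass_loss:
  assumes \<nu>: "\<nu> \<ge> -1/2"
  obtains A where "A \<ge> 0"
    "\<And>t x. \<lbrakk>t > 0; A * sinh (2 * t) \<le> 1; 1 \<le> x; x \<le> 2\<rbrakk> \<Longrightarrow>
      ennreal (1 - A * sinh (2 * t)) \<le> (\<integral>\<^sup>+y\<in>{1/2<..<5/2}. ennreal (laguerre_kernel1 \<nu> t x y) \<partial>lborel)"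
proof -
  obtain K where K: "K \<ge> 0" "\<And>z. z > 0 \<Longrightarrow> exp z / sqrt (2 * pi) * (1 - K / z) \<le> sqrt z * bessel_I \<nu> z"
    using bessel_I_asymptotic_lower[OF \<nu>] by blast
  show ?thesis
  \<comment> \<open>57 = 1 + 8 + 48: the cosh factor, the exponential with x \<le> 2, and the
    fourth-moment term 3 S^2 / (1/2)^4. The part 2 K comes from K/z with x y \<ge> 1/2.\<close>
  proof (rule that[of "57 + 2 * K"])
    show "0 \<le> 57 + 2 * K" using K by simp
    fix t x :: real assume t: "t > 0" and A: "(57 + 2 * K) * sinh (2 * t) \<le> 1" and x: "1 \<le> x" "x \<le> 2"
    define S where "S = sinh (2 * t)"
    have S: "S > 0" using t by (simp add: S_def)
    have KS: "K * S \<ge> 0" using K S by simp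
    have A': "57 * S + 2 * (K * S) \<le> 1" using A by (simp add: S_def algebra_simps)
    have S1: "S \<le> 1" "8 * S \<le> 1" "48 * S \<le> 1" "2 * (K * S) \<le> 1" using A' S KS by linarith+
    have "ennreal (cosh (2 * t) powr (-1/2) * exp (- 2 * x\<^sup>2 * sinh (2 * t)) * (1 - 2 * K * S) * (1 - 3 * (sinh (2 * t))\<^sup>2 / (1/2) ^ 4))
      \<le> (\<integral>\<^sup>+y\<in>{x - 1/2<..<x + 1/2}. ennreal (laguerre_kernel1 \<nu> t x y) \<partial>lborel)"
    proof (rule laguerre_kernel1_local_mass[OF t])
      show "0 \<le> 1 - 2 * K * S" using S1 by simp
      fix y assume y: "\<bar>y - x\<bar> < 1/2"
      have "1/2 \<le> y" using y x by linarith
      then have "1 * (1/2) \<le> x * y" using x by (intro mult_mono) auto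
      then have xy: "1/2 \<le> x * y" by simp
      then have z: "x * y / S > 0" using S by simp
      have "K * S / (x * y) \<le> K * S / (1/2)" using xy KS by (intro divide_left_mono) auto
      then have "1 - 2 * K * S \<le> 1 - K / (x * y / S)" by simp
      then have "exp (x * y / S) / sqrt (2 * pi) * (1 - 2 * K * S) \<le> exp (x * y / S) / sqrt (2 * pi) * (1 - K / (x * y / S))"
        by (intro mult_left_mono) auto
      also note K(2)[OF z]
      finally show "exp (x * y / sinh (2 * t)) / sqrt (2 * pi) * (1 - 2 * K * S) \<le> sqrt (x * y / sinh (2 * t)) * bessel_I \<nu> (x * y / sinh (2 * t))"
        unfolding S_def .
    qed (use x in auto)
    also have "\<dots> \<le> (\<integral>\<^sup>+y\<in>{1/2<..<5/2}. ennreal (laguerre_kernel1 \<nu> t x y) \<partial>lborel)"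
      using x by (intro nn_integral_mono) (auto simp: indicator_def)
    finally have main: "ennreal (cosh (2 * t) powr (-1/2) * exp (- 2 * x\<^sup>2 * S) * (1 - 2 * K * S) * (1 - 3 * S\<^sup>2 / (1/2) ^ 4))
      \<le> (\<integral>\<^sup>+y\<in>{1/2<..<5/2}. ennreal (laguerre_kernel1 \<nu> t x y) \<partial>lborel)" unfolding S_def .
    have "x\<^sup>2 \<le> 2\<^sup>2" using x by (intro power_mono) auto
    then have "2 * x\<^sup>2 * S \<le> 8 * S" using S by (intro mult_right_mono) auto
    then have "1 - 8 * S \<le> 1 + (- 2 * x\<^sup>2 * S)" by simp
    also have "\<dots> \<le> exp (- 2 * x\<^sup>2 * S)" by (rule exp_ge_add_one_self)
    finally have e: "1 - 8 * S \<le> exp (- 2 * x\<^sup>2 * S)" .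
    have "S\<^sup>2 \<le> S" using S S1 by (simp add: power2_eq_square mult_left_le)
    then have q: "1 - 48 * S \<le> 1 - 3 * S\<^sup>2 / (1/2) ^ 4" by (simp add: power_divide)
    have "1 - (57 + 2 * K) * S \<le> 1 - (S + (8 * S + (2 * K * S + 48 * S)))"
      using S by (simp add: algebra_simps)
    also have "\<dots> \<le> (1 - S) * (1 - (8 * S + (2 * K * S + 48 * S)))"
      using S KS by (intro mult_one_minus_ge) auto
    also have "\<dots> \<le> (1 - S) * ((1 - 8 * S) * ((1 - 2 * K * S) * (1 - 48 * S)))"
      using S S1 KS by (intro mult_left_mono order_trans[OF mult_one_minus_ge] mult_one_minus_ge) auto
    also have "\<dots> \<le> cosh (2 * t) powr (-1/2) * (exp (- 2 * x\<^sup>2 * S) * ((1 - 2 * K * S) * (1 - 3 * S\<^sup>2 / (1/2) ^ 4)))"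
      using S S1 KS e q sinh_le_one_bounds[OF t] unfolding S_def[symmetric] by (intro mult_mono mult_nonneg_nonneg) auto
    finally show "ennreal (1 - (57 + 2 * K) * sinh (2 * t)) \<le> (\<integral>\<^sup>+y\<in>{1/2<..<5/2}. ennreal (laguerre_kernel1 \<nu> t x y) \<partial>lborel)"
      using main by (intro order_trans[OF ennreal_leI main]) (simp add: S_def mult_ac)
  qed
qed

text \<open>For orders in the open interval from \<open>-1/2\<close> to \<open>1/2\<close> the correction \<open>\<kappa> / z\<close> with
  \<open>z = x * y / sinh (2 * t)\<close> beats every linear loss in \<open>sinh (2 * t)\<close> once \<open>x\<close> is small.\<close>

lemma laguerre_kernel1_mass_gain:
  assumes \<nu>: "-1/2 < \<nu>" "\<nu> < 1/2"
  obtains x0 where "x0 > 0"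
    "\<forall>\<^sub>F S in at_right 0. \<forall>t>0. sinh (2 * t) = S \<longrightarrow> (\<forall>x. x0 \<le> x \<longrightarrow> x \<le> 2 * x0 \<longrightarrow>
      ennreal (1 + M * S) \<le> (\<integral>\<^sup>+y\<in>{x0 / 2<..<3 * x0}. ennreal (laguerre_kernel1 \<nu> t x y) \<partial>lborel))"
proof -
  obtain \<kappa> K where K: "\<kappa> > 0" "K \<ge> 0" "\<And>z. z > 0 \<Longrightarrow> exp z / sqrt (2 * pi) * (1 + \<kappa> / z - K / z\<^sup>2) \<le> sqrt z * bessel_I \<nu> z"
    using bessel_I_asymptotic_lower_small_order[OF \<nu>] by blast
  \<comment> \<open>Chosen so that \<kappa> / (5 x0^2) \<ge> \<bar>M\<bar> + 10. Since x0 \<le> 1,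
    this exceeds the first-order losses 8 x0^2 and 1 together with the demanded rate
    \<open>M\<close>.\<close>
  define x0 where "x0 = min 1 (sqrt (\<kappa> / (5 * (\<bar>M\<bar> + 10))))"
  have x0: "0 < x0" "x0 \<le> 1" using K by (auto simp: x0_def)
  have "x0\<^sup>2 \<le> (sqrt (\<kappa> / (5 * (\<bar>M\<bar> + 10))))\<^sup>2" using x0 by (intro power_mono) (auto simp: x0_def)
  also have "\<dots> = \<kappa> / (5 * (\<bar>M\<bar> + 10))" using K by simp
  finally have "\<bar>M\<bar> + 10 \<le> \<kappa> / (5 * x0\<^sup>2)" using x0 K by (simp add: field_simps)
  moreover have "8 * x0\<^sup>2 \<le> 8" using x0 by (simp add: power_le_one)
  ultimately have gain: "\<kappa> / (5 * x0\<^sup>2) - 8 * x0\<^sup>2 - 1 - M > 0" by linarith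
  \<comment> \<open>On the window x y lies between x0^2/2 and 5 x0^2. The upper end gives
    \<open>a1\<close>, the lower end \<open>a2\<close>, and \<open>a3\<close> is the fourth-moment
    constant for half-width x0/2.\<close>
  define a1 a2 a3 where "a1 = \<kappa> / (5 * x0\<^sup>2)" and "a2 = 4 * K / x0 ^ 4" and "a3 = 48 / x0 ^ 4"
  define Q where "Q S = 1 + a1 * S - a2 * S\<^sup>2" for S :: real
  \<comment> \<open>\<open>F\<close> is a lower bound for the surplus over 1 + M S. It vanishes at 0
    with positive derivative, so it is positive for small S > 0; \<open>a2\<close> and
    \<open>a3\<close> multiply S^2 and do not enter the derivative, however large they are.\<close>
  define F where "F S = (1 - S) * exp (- 8 * x0\<^sup>2 * S) * Q S * (1 - a3 * S\<^sup>2) - (1 + M * S)" for S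
  have "(F has_real_derivative (\<kappa> / (5 * x0\<^sup>2) - 8 * x0\<^sup>2 - 1 - M)) (at 0)"
    unfolding F_def Q_def a1_def[symmetric] by (auto intro!: derivative_eq_intros)
  from DERIV_pos_inc_right[OF this gain] obtain d where d: "d > 0" "\<And>h. h > 0 \<Longrightarrow> h < d \<Longrightarrow> F h > 0"
    by (auto simp: F_def Q_def)
  have Q0: "(Q \<longlongrightarrow> 1) (at_right 0)"
    unfolding Q_def by (rule tendsto_eq_rhs, (rule tendsto_intros)+) auto
  have ev: "\<forall>\<^sub>F S in at_right 0. F S > 0" using d by (auto simp: eventually_at_right_field)
  have "\<forall>\<^sub>F S in at_right 0. Q S > 0" using order_tendstoD(1)[OF Q0, of 0] by simp
  moreover have "\<forall>\<^sub>F S in at_right 0. 1 - a3 * S\<^sup>2 > 0"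
  proof -
    have "((\<lambda>S. 1 - a3 * S\<^sup>2) \<longlongrightarrow> 1) (at_right 0)"
      by (rule tendsto_eq_rhs, (rule tendsto_intros)+) auto
    from order_tendstoD(1)[OF this, of 0] show ?thesis by simp
  qed
  moreover have "\<forall>\<^sub>F S in at_right (0::real). S > 0 \<and> S \<le> 1"
    by (auto simp: eventually_at_right_field intro: exI[of _ 1])
  moreover note ev
  ultimately have "\<forall>\<^sub>F S in at_right 0. \<forall>t>0. sinh (2 * t) = S \<longrightarrow> (\<forall>x. x0 \<le> x \<longrightarrow> x \<le> 2 * x0 \<longrightarrow>
      ennreal (1 + M * S) \<le> (\<integral>\<^sup>+y\<in>{x0 / 2<..<3 * x0}. ennreal (laguerre_kernel1 \<nu> t x y) \<partial>lborel))"
  proof eventually_elim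
    case (elim S)
    show ?case
    proof (intro allI impI)
      fix t x assume t: "t > 0" and S_def: "sinh (2 * t) = S" and x: "x0 \<le> x" "x \<le> 2 * x0"
      have S: "S > 0" "S \<le> 1" using elim by auto
      have "ennreal (cosh (2 * t) powr (-1/2) * exp (- 2 * x\<^sup>2 * sinh (2 * t)) * Q S * (1 - 3 * (sinh (2 * t))\<^sup>2 / (x0/2) ^ 4))
        \<le> (\<integral>\<^sup>+y\<in>{x - x0/2<..<x + x0/2}. ennreal (laguerre_kernel1 \<nu> t x y) \<partial>lborel)"
      proof (rule laguerre_kernel1_local_mass[OF t])
        show "0 \<le> Q S" using elim by simp
        fix y assume y: "\<bar>y - x\<bar> < x0/2"
        have yb: "x0/2 \<le> y" "y \<le> 5 * x0/2" using y x by linarith+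
        then have "x0 * (x0/2) \<le> x * y" using x x0 by (intro mult_mono) auto
        then have xy: "x0\<^sup>2/2 \<le> x * y" by (simp add: power2_eq_square)
        have "x * y \<le> (2 * x0) * (5 * x0/2)" using yb x x0 by (intro mult_mono) auto
        then have xy': "x * y \<le> 5 * x0\<^sup>2" by (simp add: power2_eq_square)
        have xy0: "x * y > 0" using xy x0 by (smt (verit) half_gt_zero zero_less_power)
        then have z: "x * y / S > 0" using S by simp
        have "\<kappa> * S / (5 * x0\<^sup>2) \<le> \<kappa> * S / (x * y)" using xy' xy0 K S x0 by (intro divide_left_mono) auto
        moreover have "K * S\<^sup>2 / (x * y)\<^sup>2 \<le> K * S\<^sup>2 / (x0\<^sup>2/2)\<^sup>2"
          using xy xy0 K S x0 by (intro divide_left_mono power_mono mult_pos_pos) auto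
        ultimately have "Q S \<le> 1 + \<kappa> / (x * y / S) - K / (x * y / S)\<^sup>2"
          using x0 by (simp add: Q_def a1_def a2_def power_divide power_mult[symmetric])
        then have "exp (x * y / S) / sqrt (2 * pi) * Q S \<le> exp (x * y / S) / sqrt (2 * pi) * (1 + \<kappa> / (x * y / S) - K / (x * y / S)\<^sup>2)"
          by (intro mult_left_mono) auto
        also note K(3)[OF z]
        finally show "exp (x * y / sinh (2 * t)) / sqrt (2 * pi) * Q S \<le> sqrt (x * y / sinh (2 * t)) * bessel_I \<nu> (x * y / sinh (2 * t))"
          unfolding S_def .
      qed (use x x0 in auto)
      also have "\<dots> \<le> (\<integral>\<^sup>+y\<in>{x0/2<..<3 * x0}. ennreal (laguerre_kernel1 \<nu> t x y) \<partial>lborel)"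
        using x x0 by (intro nn_integral_mono) (auto simp: indicator_def)
      finally have main: "ennreal (cosh (2 * t) powr (-1/2) * exp (- 2 * x\<^sup>2 * S) * Q S * (1 - 3 * S\<^sup>2 / (x0/2) ^ 4))
        \<le> (\<integral>\<^sup>+y\<in>{x0/2<..<3 * x0}. ennreal (laguerre_kernel1 \<nu> t x y) \<partial>lborel)" unfolding S_def .
      have "x\<^sup>2 \<le> (2 * x0)\<^sup>2" using x x0 by (intro power_mono) auto
      then have "2 * x\<^sup>2 * S \<le> 8 * x0\<^sup>2 * S" using S by (intro mult_right_mono) (auto simp: power_mult_distrib)
      then have e: "exp (- 8 * x0\<^sup>2 * S) \<le> exp (- 2 * x\<^sup>2 * S)" by simp
      have "1 + M * S \<le> (1 - S) * exp (- 8 * x0\<^sup>2 * S) * Q S * (1 - a3 * S\<^sup>2)"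
        using elim by (simp add: F_def)
      also have "\<dots> \<le> cosh (2 * t) powr (-1/2) * exp (- 2 * x\<^sup>2 * S) * Q S * (1 - a3 * S\<^sup>2)"
        using elim S e sinh_le_one_bounds[OF t] unfolding S_def by (intro mult_mono mult_nonneg_nonneg) auto
      also have "1 - a3 * S\<^sup>2 = 1 - 3 * S\<^sup>2 / (x0/2) ^ 4" by (simp add: a3_def power_divide)
      finally show "ennreal (1 + M * S) \<le> (\<integral>\<^sup>+y\<in>{x0/2<..<3 * x0}. ennreal (laguerre_kernel1 \<nu> t x y) \<partial>lborel)"
        by (intro order_trans[OF ennreal_leI main])
    qed
  qed
  with x0(1) show ?thesis by (rule that)
qed

section \<open>Symmetric kernels on Lebesgue spaces\<close>

text \<open>Convexity of the power in the form needed for Jensen: Young's inequality with weights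
  1/r and 1 - 1/r bounds u m^(r-1), and rearranging gives the tangent at m.\<close>

lemma powr_tangent_le:
  fixes u m r :: real
  assumes "r \<ge> 1" "u \<ge> 0" "m > 0"
  shows "m powr r + r * m powr (r - 1) * (u - m) \<le> u powr r"
proof -
  have mm: "m powr (r - 1) * m = m powr r"
    using assms powr_add[of m "r - 1" 1] by simp
  show ?thesis
  proof (cases "u = 0")
    case True
    have "m powr r \<le> r * m powr r" using assms by (simp add: mult_le_cancel_right1)
    then show ?thesis using True mm by (simp add: mult.assoc)
  next
    case False
    with assms have u: "u > 0" by simp
    have r: "(1 - 1/r) * r = r - 1" using assms by (simp add: field_simps)
    have "(u powr r) powr (1/r) * (m powr r) powr (1 - 1/r) \<le> 1/r * (u powr r) + (1 - 1/r) * (m powr r)"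
      using assms u by (intro Youngs_inequality_0) auto
    moreover have "(u powr r) powr (1/r) = u" using assms u by (simp add: powr_powr)
    moreover have "(m powr r) powr (1 - 1/r) = m powr (r - 1)" using r by (simp add: powr_powr mult.commute)
    ultimately have "r * (u * m powr (r - 1)) \<le> r * (1/r * (u powr r) + (1 - 1/r) * (m powr r))"
      using assms by (intro mult_left_mono) auto
    also have "\<dots> = u powr r + (r - 1) * m powr r" using assms by (simp add: algebra_simps)
    finally have "r * (u * m powr (r - 1)) - r * (m powr (r - 1) * m) + m powr r \<le> u powr r"
      unfolding mm by (simp add: algebra_simps)
    then show ?thesis by (simp add: algebra_simps)
  qed
qed

lemma Lp_measurable: "f \<in> Lp M p \<Longrightarrow> f \<in> borel_measurable M"
  by (simp add: Lp_def)

lemma Lp_norm_finite_exponent: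
  assumes "1 \<le> p" "p \<noteq> \<infinity>"
  obtains r where "r = enn2real p" "r \<ge> 1" "p = ennreal r"
proof (cases p)
  case (real r)
  with assms show ?thesis using that[of r] by (simp add: ennreal_le_iff flip: ennreal_1)
qed (use assms in auto)

lemma Lp_norm_two: "Lp_norm M 2 f =
  (let I = (\<integral>\<^sup>+x. ennreal ((f x)\<^sup>2) \<partial>M) in if I = \<infinity> then \<infinity> else ennreal (sqrt (enn2real I)))"
  by (auto simp: Lp_norm_def Let_def powr_half_sqrt)

lemma Lp_two_iff: "f \<in> Lp M 2 \<longleftrightarrow> f \<in> borel_measurable M \<and> (\<integral>\<^sup>+x. ennreal ((f x)\<^sup>2) \<partial>M) < \<infinity>"
  by (auto simp: Lp_def Lp_norm_two Let_def top.not_eq_extremum)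

text \<open>The setting of Schur's test: by symmetry the row bound \<open>C\<close> also bounds the
  columns, hence the norm on every L^p. The pointwise bound \<open>B\<close> secures convergence of
  the integrals and does not enter the norm.\<close>

locale symmetric_kernel = sigma_finite_measure M for M :: "'a measure" +
  fixes K :: "'a \<Rightarrow> 'a \<Rightarrow> real" and C B :: real
  assumes kernel_measurable: "case_prod K \<in> borel_measurable (M \<Otimes>\<^sub>M M)"
    and kernel_nonneg: "\<And>x y. x \<in> space M \<Longrightarrow> y \<in> space M \<Longrightarrow> 0 \<le> K x y"
    and kernel_symmetric: "\<And>x y. x \<in> space M \<Longrightarrow> y \<in> space M \<Longrightarrow> K x y = K y x"
    and kernel_mass: "\<And>x. x \<in> space M \<Longrightarrow> (\<integral>\<^sup>+y. ennreal (K x y) \<partial>M) \<le> ennreal C"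
    and kernel_bounded: "\<And>x y. x \<in> space M \<Longrightarrow> y \<in> space M \<Longrightarrow> K x y \<le> B"
    and mass_pos: "0 < C"
begin

definition operator :: "('a \<Rightarrow> real) \<Rightarrow> 'a \<Rightarrow> real" where
  "operator f x = (LINT y|M. K x y * f y)"

text \<open>A Bochner integral is 0 by default for a nonintegrable integrand, so linearity may fail
  for arbitrary measurable functions. Integrability at every point, not just almost everywhere,
  gives pointwise identities; the resulting set is linear and contains every L^p.\<close>

definition operator_domain :: "('a \<Rightarrow> real) set" where
  "operator_domain = {f \<in> borel_measurable M. \<forall>x\<in>space M. integrable M (\<lambda>y. K x y * f y)}"

lemma measurable_kernel_fst: "x \<in> space M \<Longrightarrow> K x \<in> borel_measurable M"
  using measurable_compose_Pair1[OF _ kernel_measurable] by auto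

lemma measurable_kernel_apply [measurable (raw)]:
  assumes "f \<in> N \<rightarrow>\<^sub>M M" "g \<in> N \<rightarrow>\<^sub>M M"
  shows "(\<lambda>x. K (f x) (g x)) \<in> borel_measurable N"
  using measurable_compose[OF measurable_Pair[OF assms] kernel_measurable] by simp

lemma integrable_kernel: "x \<in> space M \<Longrightarrow> integrable M (K x)"
proof (rule integrableI_nonneg)
  assume x: "x \<in> space M"
  show "K x \<in> borel_measurable M" by (rule measurable_kernel_fst[OF x])
  show "AE y in M. 0 \<le> K x y" using kernel_nonneg[OF x] by auto
  show "(\<integral>\<^sup>+y. ennreal (K x y) \<partial>M) < \<infinity>" using kernel_mass[OF x] by (simp add: le_less_trans)
qed

lemma integral_kernel_le: "x \<in> space M \<Longrightarrow> (LINT y|M. K x y) \<le> C"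
proof -
  assume x: "x \<in> space M"
  have "ennreal (LINT y|M. K x y) = (\<integral>\<^sup>+y. ennreal (K x y) \<partial>M)"
    using kernel_nonneg[OF x] by (intro nn_integral_eq_integral[symmetric] integrable_kernel x) auto
  also have "\<dots> \<le> ennreal C" by (rule kernel_mass[OF x])
  finally show ?thesis using mass_pos by (subst (asm) ennreal_le_iff) auto
qed

lemma measurable_operator:
  assumes [measurable]: "f \<in> borel_measurable M"
  shows "operator f \<in> borel_measurable M"
  unfolding operator_def[abs_def] by measurable

lemma operator_linear:
  assumes "f \<in> operator_domain" "g \<in> operator_domain" "x \<in> space M"
  shows "operator (\<lambda>y. a * f y + b * g y) x = a * operator f x + b * operator g x"
proof -
  have i: "integrable M (\<lambda>y. K x y * f y)" "integrable M (\<lambda>y. K x y * g y)"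
    using assms by (auto simp: operator_domain_def)
  have "operator (\<lambda>y. a * f y + b * g y) x = (LINT y|M. a * (K x y * f y) + b * (K x y * g y))"
    unfolding operator_def by (simp add: algebra_simps)
  then show ?thesis unfolding operator_def using i by simp
qed

lemma operator_domain_linear:
  assumes "f \<in> operator_domain" "g \<in> operator_domain"
  shows "(\<lambda>y. a * f y + b * g y) \<in> operator_domain"
proof -
  have "integrable M (\<lambda>y. K x y * (a * f y + b * g y))" if "x \<in> space M" for x
  proof -
    have "integrable M (\<lambda>y. a * (K x y * f y) + b * (K x y * g y))"
      using assms that by (auto simp: operator_domain_def)
    then show ?thesis by (simp add: algebra_simps)
  qed
  then show ?thesis using assms by (auto simp: operator_domain_def)
qed

lemma operator_AE_cong:
  assumes "f \<in> borel_measurable M" "g \<in> borel_measurable M" "AE y in M. f y = g y" "x \<in> space M"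
  shows "operator f x = operator g x"
  unfolding operator_def
  by (rule integral_cong_AE) (use assms measurable_kernel_fst in auto)

lemma operator_nonneg:
  assumes "AE y in M. 0 \<le> f y" "x \<in> space M"
  shows "0 \<le> operator f x"
  unfolding operator_def
proof (rule integral_nonneg_AE)
  show "AE y in M. 0 \<le> K x y * f y"
    using assms(1) AE_space by eventually_elim (simp add: kernel_nonneg[OF assms(2)])
qed

text \<open>From \<bar>f\<bar> \<le> 1 + \<bar>f\<bar>^r, the integrand is dominated by K x +
  \<bar>B\<bar> \<bar>f\<bar>^r: the first summand has finite row mass and the second is integrable
  by assumption.\<close>

lemma in_operator_domain:
  assumes f: "f \<in> borel_measurable M" and r: "r \<ge> 1" and I: "(\<integral>\<^sup>+y. ennreal (\<bar>f y\<bar> powr r) \<partial>M) < \<infinity>"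
  shows "f \<in> operator_domain"
proof -
  note [measurable] = f
  have "integrable M (\<lambda>y. K x y * f y)" if x: "x \<in> space M" for x
  proof (rule Bochner_Integration.integrable_bound)
    have "integrable M (\<lambda>y. \<bar>f y\<bar> powr r)" using I by (intro integrableI_nonneg) auto
    then show "integrable M (\<lambda>y. K x y + \<bar>B\<bar> * \<bar>f y\<bar> powr r)"
      by (intro Bochner_Integration.integrable_add integrable_kernel x integrable_mult_right)
    show "(\<lambda>y. K x y * f y) \<in> borel_measurable M" using measurable_kernel_fst[OF x] by measurable
    show "AE y in M. norm (K x y * f y) \<le> norm (K x y + \<bar>B\<bar> * \<bar>f y\<bar> powr r)"
    proof (rule AE_I2)
      fix y assume y: "y \<in> space M"
      have K: "0 \<le> K x y" "K x y \<le> \<bar>B\<bar>" using kernel_nonneg[OF x y] kernel_bounded[OF x y] by auto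
      have "\<bar>f y\<bar> \<le> 1 + \<bar>f y\<bar> powr r"
      proof (cases "\<bar>f y\<bar> \<le> 1")
        case False
        then have "\<bar>f y\<bar> powr 1 \<le> \<bar>f y\<bar> powr r" using r by (intro powr_mono) auto
        then show ?thesis using False by simp
      qed (simp add: add_increasing2)
      then have "K x y * \<bar>f y\<bar> \<le> K x y * (1 + \<bar>f y\<bar> powr r)" using K by (intro mult_left_mono)
      also have "\<dots> \<le> K x y + \<bar>B\<bar> * \<bar>f y\<bar> powr r" using K by (simp add: distrib_left mult_right_mono)
      finally show "norm (K x y * f y) \<le> norm (K x y + \<bar>B\<bar> * \<bar>f y\<bar> powr r)"
        using K by (simp add: abs_mult)
    qed
  qed
  then show ?thesis using f by (auto simp: operator_domain_def)
qed

lemma bounded_in_operator_domain: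
  assumes f: "f \<in> borel_measurable M" and s: "AE y in M. \<bar>f y\<bar> \<le> s"
  shows "f \<in> operator_domain" and "\<And>x. x \<in> space M \<Longrightarrow> \<bar>operator f x\<bar> \<le> C * \<bar>s\<bar>"
proof -
  note [measurable] = f
  have le: "AE y in M. norm (K x y * f y) \<le> \<bar>s\<bar> * K x y" if x: "x \<in> space M" for x
    using s AE_space
  proof eventually_elim
    case (elim y)
    then show ?case using kernel_nonneg[OF x, of y]
      by (simp add: abs_mult) (subst mult.commute, intro mult_right_mono, auto)
  qed
  have i: "integrable M (\<lambda>y. K x y * f y)" if x: "x \<in> space M" for x
    using le[OF x] measurable_kernel_fst[OF x] kernel_nonneg[OF x]
    by (intro Bochner_Integration.integrable_bound[OF integrable_mult_right[OF integrable_kernel[OF x], of "\<bar>s\<bar>"]])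
       (auto elim!: AE_mp intro!: AE_I2)
  then show "f \<in> operator_domain" using f by (auto simp: operator_domain_def)
  fix x assume x: "x \<in> space M"
  have "\<bar>operator f x\<bar> \<le> (LINT y|M. norm (K x y * f y))"
    unfolding operator_def real_norm_def[symmetric] by (rule integral_norm_bound)
  also have "\<dots> \<le> (LINT y|M. \<bar>s\<bar> * K x y)"
    by (intro integral_mono_AE integrable_norm i integrable_mult_right integrable_kernel x le)
  also have "\<dots> \<le> \<bar>s\<bar> * C" using integral_kernel_le[OF x] by (simp add: mult_left_mono)
  finally show "\<bar>operator f x\<bar> \<le> C * \<bar>s\<bar>" by (simp add: mult.commute)
qed

text \<open>Tonelli exchanges the integrals, and symmetry lets the row bound act on the column that
  is now integrated first.\<close>

lemma nn_integral_kernel_transpose_le: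
  assumes [measurable]: "F \<in> borel_measurable M"
  shows "(\<integral>\<^sup>+x. (\<integral>\<^sup>+y. ennreal (K x y) * F y \<partial>M) \<partial>M) \<le> ennreal C * (\<integral>\<^sup>+y. F y \<partial>M)"
proof -
  interpret P: pair_sigma_finite M M ..
  have "(\<integral>\<^sup>+x. (\<integral>\<^sup>+y. ennreal (K x y) * F y \<partial>M) \<partial>M) = (\<integral>\<^sup>+y. (\<integral>\<^sup>+x. ennreal (K x y) * F y \<partial>M) \<partial>M)"
    by (rule P.Fubini'[symmetric]) measurable
  also have "\<dots> \<le> (\<integral>\<^sup>+y. ennreal C * F y \<partial>M)"
  proof (rule nn_integral_mono)
    fix y assume y: "y \<in> space M"
    have "(\<integral>\<^sup>+x. ennreal (K x y) * F y \<partial>M) = (\<integral>\<^sup>+x. ennreal (K y x) \<partial>M) * F y"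
      using y measurable_kernel_fst[OF y]
      by (subst nn_integral_multc[symmetric]) (auto intro!: nn_integral_cong simp: kernel_symmetric)
    also have "\<dots> \<le> ennreal C * F y" using kernel_mass[OF y] by (rule mult_right_mono) simp
    finally show "(\<integral>\<^sup>+x. ennreal (K x y) * F y \<partial>M) \<le> ennreal C * F y" .
  qed
  also have "\<dots> = ennreal C * (\<integral>\<^sup>+y. F y \<partial>M)" by (rule nn_integral_cmult) measurable
  finally show ?thesis .
qed

text \<open>Jensen's inequality for the sub-probability measures \<open>K x y / C\<close>, read off from the tangent
  of \<open>u powr r\<close> at the \<open>K x\<close>-mean of \<open>\<bar>f\<bar>\<close>.\<close>

lemma operator_powr_le:
  assumes f: "f \<in> operator_domain" and r: "r \<ge> 1" and x: "x \<in> space M"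
  shows "ennreal (\<bar>operator f x\<bar> powr r) \<le> ennreal (C powr (r - 1)) * (\<integral>\<^sup>+y. ennreal (K x y) * ennreal (\<bar>f y\<bar> powr r) \<partial>M)"
proof -
  have fm [measurable]: "f \<in> borel_measurable M" using f by (simp add: operator_domain_def)
  note Kx [measurable] = measurable_kernel_fst[OF x]
  have i: "integrable M (\<lambda>y. K x y * f y)" using f x by (simp add: operator_domain_def)
  then have i': "integrable M (\<lambda>y. K x y * \<bar>f y\<bar>)"
    by (rule Bochner_Integration.integrable_bound) (auto simp: abs_mult)
  define A where "A = (LINT y|M. K x y * \<bar>f y\<bar>)"
  define m where "m = (LINT y|M. K x y)"
  have "\<bar>operator f x\<bar> \<le> (LINT y|M. norm (K x y * f y))"
    unfolding operator_def real_norm_def[symmetric] by (rule integral_norm_bound)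
  also have "\<dots> = A" unfolding A_def
    by (intro Bochner_Integration.integral_cong refl) (simp add: abs_mult kernel_nonneg[OF x])
  finally have op: "\<bar>operator f x\<bar> \<le> A" .
  show ?thesis
  proof (cases "A = 0")
    case True
    then show ?thesis using op by simp
  next
    case False
    with op have A: "A > 0" by (smt (verit))
    have m: "m > 0"
    proof (rule ccontr)
      assume "\<not> m > 0"
      moreover have "m \<ge> 0" unfolding m_def using kernel_nonneg[OF x] by (intro integral_nonneg_AE) auto
      ultimately have "m = 0" by simp
      then have "AE y in M. K x y = 0"
        unfolding m_def using kernel_nonneg[OF x] by (subst (asm) integral_nonneg_eq_0_iff_AE[OF integrable_kernel[OF x]]) auto
      then have "A = (LINT y|M. 0)" unfolding A_def by (intro integral_cong_AE) auto
      with False show False by simp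
    qed
    define u where "u = A / m"
    have u: "u > 0" using A m by (simp add: u_def)
    \<comment> \<open>The tangent at the mean u, integrated against \<open>K x\<close>. The slope
      term cancels because A = m u, so only m u^r is left.\<close>
    let ?g = "\<lambda>y. K x y * (u powr r - r * u powr (r - 1) * u) + r * u powr (r - 1) * (K x y * \<bar>f y\<bar>)"
    have ig: "integrable M ?g" using i' integrable_kernel[OF x] by auto
    have "(LINT y|M. ?g y) = m * (u powr r - r * u powr (r - 1) * u) + r * u powr (r - 1) * A"
      using i' integrable_kernel[OF x] by (simp add: m_def A_def)
    also have "\<dots> = m * u powr r" using m by (simp add: u_def algebra_simps)
    finally have "ennreal (m * u powr r) = ennreal (LINT y|M. ?g y)" by simp
    also have "\<dots> \<le> (\<integral>\<^sup>+y. ennreal (K x y * \<bar>f y\<bar> powr r) \<partial>M)"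
    proof (rule ennreal_integral_le_nn_integral[OF ig])
      fix y assume y: "y \<in> space M"
      have "K x y * (u powr r + r * u powr (r - 1) * (\<bar>f y\<bar> - u)) \<le> K x y * \<bar>f y\<bar> powr r"
        using kernel_nonneg[OF x y] r u by (intro mult_left_mono powr_tangent_le) auto
      then show "?g y \<le> K x y * \<bar>f y\<bar> powr r" by (simp add: algebra_simps)
    qed
    also have "\<dots> = (\<integral>\<^sup>+y. ennreal (K x y) * ennreal (\<bar>f y\<bar> powr r) \<partial>M)"
      by (intro nn_integral_cong) (simp add: ennreal_mult kernel_nonneg[OF x])
    finally have main: "ennreal (m * u powr r) \<le> (\<integral>\<^sup>+y. ennreal (K x y) * ennreal (\<bar>f y\<bar> powr r) \<partial>M)" .
    have "\<bar>operator f x\<bar> powr r \<le> A powr r" using op r by (intro powr_mono2) auto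
    also have "A powr r = (m * u) powr r" using m by (simp add: u_def)
    also have "\<dots> = m powr (r - 1) * (m * u powr r)"
      using m u powr_add[of m "r - 1" 1] by (simp add: powr_mult)
    also have "\<dots> \<le> C powr (r - 1) * (m * u powr r)"
      using m r integral_kernel_le[OF x] unfolding m_def[symmetric]
      by (intro mult_right_mono powr_mono2) auto
    finally have "ennreal (\<bar>operator f x\<bar> powr r) \<le> ennreal (C powr (r - 1)) * ennreal (m * u powr r)"
      using m by (simp add: ennreal_mult[symmetric] ennreal_leI)
    also have "\<dots> \<le> ennreal (C powr (r - 1)) * (\<integral>\<^sup>+y. ennreal (K x y) * ennreal (\<bar>f y\<bar> powr r) \<partial>M)"
      by (intro mult_left_mono main) simp
    finally show ?thesis .
  qed
qed

text \<open>For finite exponent r, Jensen contributes C^(r-1) and the column bound one more factor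
  C; the r-th root then gives exactly C. No interpolation between the endpoint exponents is
  involved.\<close>

lemma operator_Lp:
  assumes p: "1 \<le> p" and f: "f \<in> Lp M p"
  shows "f \<in> operator_domain" "operator f \<in> Lp M p" "Lp_norm M p (operator f) \<le> ennreal C * Lp_norm M p f"
proof -
  have fm [measurable]: "f \<in> borel_measurable M" using f by (rule Lp_measurable)
  note Tm [measurable] = measurable_operator[OF fm]
  have fin: "Lp_norm M p f < \<infinity>" using f by (simp add: Lp_def)
  have "f \<in> operator_domain \<and> Lp_norm M p (operator f) \<le> ennreal C * Lp_norm M p f"
  proof (cases "p = \<infinity>")
    case True
    define s where "s = enn2real (Lp_norm M p f)"
    have s: "Lp_norm M p f = ennreal s" "s \<ge> 0" using fin by (auto simp: s_def)
    have "AE y in M. ennreal \<bar>f y\<bar> \<le> ennreal s"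
      using esssup_AE[of "\<lambda>y. ennreal \<bar>f y\<bar>" M] s(1) True by (simp add: Lp_norm_def)
    then have "AE y in M. \<bar>f y\<bar> \<le> s" using s by (auto simp: ennreal_le_iff)
    note b = bounded_in_operator_domain[OF fm this]
    have "esssup M (\<lambda>x. ennreal \<bar>operator f x\<bar>) \<le> ennreal (C * s)"
      using b(2) s by (intro esssup_I AE_I2 ennreal_leI) auto
    then show ?thesis using b(1) True s mass_pos by (simp add: Lp_norm_def ennreal_mult)
  next
    case False
    obtain r where r: "r = enn2real p" "r \<ge> 1" using Lp_norm_finite_exponent[OF p False] by metis
    define I where "I = (\<integral>\<^sup>+y. ennreal (\<bar>f y\<bar> powr r) \<partial>M)"
    have I: "I \<noteq> \<infinity>" and nf: "Lp_norm M p f = ennreal (enn2real I powr (1/r))"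
      using fin False by (auto simp: Lp_norm_def Let_def r(1)[symmetric] I_def[symmetric] split: if_splits)
    have dom: "f \<in> operator_domain"
      using I by (intro in_operator_domain[OF fm r(2)]) (simp add: I_def top.not_eq_extremum)
    have "(\<integral>\<^sup>+x. ennreal (\<bar>operator f x\<bar> powr r) \<partial>M) \<le>
       (\<integral>\<^sup>+x. ennreal (C powr (r - 1)) * (\<integral>\<^sup>+y. ennreal (K x y) * ennreal (\<bar>f y\<bar> powr r) \<partial>M) \<partial>M)"
      by (intro nn_integral_mono operator_powr_le dom r)
    also have "\<dots> = ennreal (C powr (r - 1)) * (\<integral>\<^sup>+x. (\<integral>\<^sup>+y. ennreal (K x y) * ennreal (\<bar>f y\<bar> powr r) \<partial>M) \<partial>M)"
      by (rule nn_integral_cmult) measurable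
    also have "\<dots> \<le> ennreal (C powr (r - 1)) * (ennreal C * I)"
      unfolding I_def by (intro mult_left_mono nn_integral_kernel_transpose_le) auto
    also have "\<dots> = ennreal (C powr r) * I"
      using mass_pos powr_add[of C "r - 1" 1] by (simp add: mult.assoc[symmetric] ennreal_mult[symmetric])
    finally have le: "(\<integral>\<^sup>+x. ennreal (\<bar>operator f x\<bar> powr r) \<partial>M) \<le> ennreal (C powr r) * I" (is "?J \<le> _") .
    obtain i where i: "I = ennreal i" "i \<ge> 0" using I by (cases I) auto
    have le': "?J \<le> ennreal (C powr r * i)" using le i by (simp add: ennreal_mult)
    then have J: "?J \<noteq> \<infinity>" by (auto simp: top_unique)
    have "enn2real ?J \<le> C powr r * i" using le' i by (intro enn2real_leI) auto
    then have "enn2real ?J powr (1/r) \<le> (C powr r * i) powr (1/r)" using r by (intro powr_mono2) auto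
    also have "\<dots> = C * i powr (1/r)" using mass_pos r i by (simp add: powr_mult powr_powr)
    finally have "ennreal (enn2real ?J powr (1/r)) \<le> ennreal C * ennreal (i powr (1/r))"
      using mass_pos by (simp add: ennreal_mult[symmetric] ennreal_leI)
    then show ?thesis using dom False J i nf by (simp add: Lp_norm_def Let_def r(1)[symmetric])
  qed
  moreover from this have "Lp_norm M p (operator f) < \<infinity>"
    using fin by (auto simp: ennreal_mult_less_top intro: le_less_trans)
  ultimately show "f \<in> operator_domain" "operator f \<in> Lp M p" "Lp_norm M p (operator f) \<le> ennreal C * Lp_norm M p f"
    using Tm by (auto simp: Lp_def)
qed

lemma operator_opnorm_le: "1 \<le> p \<Longrightarrow> Lp_opnorm M p operator \<le> ennreal C"
  unfolding Lp_opnorm_def by (rule Inf_lower) (auto simp: operator_Lp)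

text \<open>Fubini and symmetry. Absolute integrability comes from \<bar>f y g x\<bar> \<le> (f y)^2
  + (g x)^2, where the column bound controls the first square and the row bound the second.\<close>

lemma operator_selfadjoint:
  assumes f: "f \<in> Lp M 2" and g: "g \<in> Lp M 2"
  shows "(LINT x|M. operator f x * g x) = (LINT x|M. f x * operator g x)"
proof -
  interpret P: pair_sigma_finite M M ..
  have m [measurable]: "f \<in> borel_measurable M" "g \<in> borel_measurable M" using f g by (auto simp: Lp_def)
  have fin: "(\<integral>\<^sup>+x. ennreal ((f x)\<^sup>2) \<partial>M) < \<infinity>" "(\<integral>\<^sup>+x. ennreal ((g x)\<^sup>2) \<partial>M) < \<infinity>"
    using f g by (auto simp: Lp_two_iff)
  have int: "integrable (M \<Otimes>\<^sub>M M) (\<lambda>(x, y). K x y * f y * g x)"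
  proof (rule integrableI_bounded)
    have "(\<integral>\<^sup>+z. ennreal (norm (case z of (x, y) \<Rightarrow> K x y * f y * g x)) \<partial>(M \<Otimes>\<^sub>M M)) =
      (\<integral>\<^sup>+x. \<integral>\<^sup>+y. ennreal (norm (K x y * f y * g x)) \<partial>M \<partial>M)"
      by (subst nn_integral_fst[symmetric]) auto
    also have "\<dots> \<le> (\<integral>\<^sup>+x. \<integral>\<^sup>+y. ennreal (K x y) * ennreal ((f y)\<^sup>2) + ennreal (K x y) * ennreal ((g x)\<^sup>2) \<partial>M \<partial>M)"
    proof (intro nn_integral_mono)
      fix x y assume xy: "x \<in> space M" "y \<in> space M"
      have "2 * \<bar>f y * g x\<bar> \<le> (f y)\<^sup>2 + (g x)\<^sup>2"
        using sum_squares_bound[of "\<bar>f y\<bar>" "\<bar>g x\<bar>"] by (simp add: abs_mult)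
      then have "\<bar>f y * g x\<bar> \<le> (f y)\<^sup>2 + (g x)\<^sup>2" using abs_ge_zero[of "f y * g x"] by linarith
      then have "K x y * \<bar>f y * g x\<bar> \<le> K x y * ((f y)\<^sup>2 + (g x)\<^sup>2)"
        using kernel_nonneg[OF xy] by (intro mult_left_mono)
      then have "ennreal (K x y * \<bar>f y * g x\<bar>) \<le> ennreal (K x y * (f y)\<^sup>2 + K x y * (g x)\<^sup>2)"
        by (intro ennreal_leI) (simp add: distrib_left)
      then show "ennreal (norm (K x y * f y * g x)) \<le> ennreal (K x y) * ennreal ((f y)\<^sup>2) + ennreal (K x y) * ennreal ((g x)\<^sup>2)"
        using kernel_nonneg[OF xy] by (simp add: ennreal_mult abs_mult mult.assoc)
    qed
    also have "\<dots> = (\<integral>\<^sup>+x. \<integral>\<^sup>+y. ennreal (K x y) * ennreal ((f y)\<^sup>2) \<partial>M \<partial>M) + (\<integral>\<^sup>+x. \<integral>\<^sup>+y. ennreal (K x y) * ennreal ((g x)\<^sup>2) \<partial>M \<partial>M)"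
      by (subst nn_integral_add[symmetric]) (auto intro!: nn_integral_cong nn_integral_add)
    also have "\<dots> \<le> ennreal C * (\<integral>\<^sup>+x. ennreal ((f x)\<^sup>2) \<partial>M) + ennreal C * (\<integral>\<^sup>+x. ennreal ((g x)\<^sup>2) \<partial>M)"
    proof (rule add_mono)
      show "(\<integral>\<^sup>+x. \<integral>\<^sup>+y. ennreal (K x y) * ennreal ((f y)\<^sup>2) \<partial>M \<partial>M) \<le> ennreal C * (\<integral>\<^sup>+x. ennreal ((f x)\<^sup>2) \<partial>M)"
        by (rule nn_integral_kernel_transpose_le) measurable
      have "(\<integral>\<^sup>+x. \<integral>\<^sup>+y. ennreal (K x y) * ennreal ((g x)\<^sup>2) \<partial>M \<partial>M) \<le> (\<integral>\<^sup>+x. ennreal C * ennreal ((g x)\<^sup>2) \<partial>M)"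
      proof (rule nn_integral_mono)
        fix x assume x: "x \<in> space M"
        show "(\<integral>\<^sup>+y. ennreal (K x y) * ennreal ((g x)\<^sup>2) \<partial>M) \<le> ennreal C * ennreal ((g x)\<^sup>2)"
          using measurable_kernel_fst[OF x] kernel_mass[OF x] by (simp add: nn_integral_multc mult_right_mono)
      qed
      also have "\<dots> = ennreal C * (\<integral>\<^sup>+x. ennreal ((g x)\<^sup>2) \<partial>M)" by (rule nn_integral_cmult) measurable
      finally show "(\<integral>\<^sup>+x. \<integral>\<^sup>+y. ennreal (K x y) * ennreal ((g x)\<^sup>2) \<partial>M \<partial>M) \<le> \<dots>" .
    qed
    also have "\<dots> < \<infinity>" using fin by (simp add: ennreal_mult_less_top)
    finally show "(\<integral>\<^sup>+z. ennreal (norm (case z of (x, y) \<Rightarrow> K x y * f y * g x)) \<partial>(M \<Otimes>\<^sub>M M)) < \<infinity>" .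
  qed measurable
  have "(LINT x|M. operator f x * g x) = (LINT x|M. LINT y|M. K x y * f y * g x)"
    unfolding operator_def by simp
  also have "\<dots> = (LINT y|M. LINT x|M. K x y * f y * g x)"
    by (rule P.Fubini_integral[OF int, symmetric])
  also have "\<dots> = (LINT y|M. f y * operator g y)"
  proof (intro Bochner_Integration.integral_cong refl)
    fix y assume y: "y \<in> space M"
    have "(LINT x|M. K x y * f y * g x) = (LINT x|M. f y * (K y x * g x))"
      using y by (intro Bochner_Integration.integral_cong refl) (simp add: kernel_symmetric[of _ y])
    then show "(LINT x|M. K x y * f y * g x) = f y * operator g y" by (simp add: operator_def)
  qed
  finally show ?thesis .
qed

end

text \<open>With absolute values inside, the inner integral collapses to K3 x y \<bar>f y\<bar>,
  which is integrable by the domain condition. So the composition identity for nonnegative integrals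
  itself justifies Fubini.\<close>

lemma symmetric_kernel_compose:
  assumes K1: "symmetric_kernel M K1 C1 B1" and K2: "symmetric_kernel M K2 C2 B2" and K3: "symmetric_kernel M K3 C3 B3"
    and ck: "\<And>x y. x \<in> space M \<Longrightarrow> y \<in> space M \<Longrightarrow> (\<integral>\<^sup>+z. ennreal (K1 x z * K2 z y) \<partial>M) = ennreal (K3 x y)"
    and f: "f \<in> symmetric_kernel.operator_domain M K3" and x: "x \<in> space M"
  shows "symmetric_kernel.operator M K3 f x = symmetric_kernel.operator M K1 (symmetric_kernel.operator M K2 f) x"
proof -
  interpret K1: symmetric_kernel M K1 C1 B1 by fact
  interpret K2: symmetric_kernel M K2 C2 B2 by fact
  interpret K3: symmetric_kernel M K3 C3 B3 by fact
  interpret P: pair_sigma_finite M M ..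
  have fm [measurable]: "f \<in> borel_measurable M" using f by (simp add: K3.operator_domain_def)
  note [measurable] = K1.measurable_kernel_fst[OF x]
  have int: "integrable (M \<Otimes>\<^sub>M M) (\<lambda>(y, z). K1 x z * K2 z y * f y)"
  proof (rule integrableI_bounded)
    have "(\<integral>\<^sup>+w. ennreal (norm (case w of (y, z) \<Rightarrow> K1 x z * K2 z y * f y)) \<partial>(M \<Otimes>\<^sub>M M)) =
      (\<integral>\<^sup>+y. \<integral>\<^sup>+z. ennreal (norm (K1 x z * K2 z y * f y)) \<partial>M \<partial>M)"
      by (subst K1.nn_integral_fst[symmetric]) auto
    also have "\<dots> = (\<integral>\<^sup>+y. ennreal (norm (K3 x y * f y)) \<partial>M)"
    proof (rule nn_integral_cong)
      fix y assume y: "y \<in> space M"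
      have "(\<integral>\<^sup>+z. ennreal (norm (K1 x z * K2 z y * f y)) \<partial>M) = (\<integral>\<^sup>+z. ennreal (K1 x z * K2 z y) * ennreal \<bar>f y\<bar> \<partial>M)"
        using x y by (intro nn_integral_cong) (simp add: abs_mult ennreal_mult K1.kernel_nonneg K2.kernel_nonneg)
      also have "\<dots> = ennreal (K3 x y) * ennreal \<bar>f y\<bar>"
        using y by (subst nn_integral_multc) (auto simp: ck[OF x y])
      finally show "(\<integral>\<^sup>+z. ennreal (norm (K1 x z * K2 z y * f y)) \<partial>M) = ennreal (norm (K3 x y * f y))"
        using K3.kernel_nonneg[OF x y] by (simp add: abs_mult ennreal_mult)
    qed
    also have "\<dots> < \<infinity>" using f x by (auto simp: K3.operator_domain_def integrable_iff_bounded)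
    finally show "(\<integral>\<^sup>+w. ennreal (norm (case w of (y, z) \<Rightarrow> K1 x z * K2 z y * f y)) \<partial>(M \<Otimes>\<^sub>M M)) < \<infinity>" .
  qed measurable
  have "K1.operator (K2.operator f) x = (LINT z|M. LINT y|M. K1 x z * K2 z y * f y)"
    unfolding K1.operator_def K2.operator_def by (simp add: mult.assoc)
  also have "\<dots> = (LINT y|M. LINT z|M. K1 x z * K2 z y * f y)"
    by (rule P.Fubini_integral[OF int])
  also have "\<dots> = K3.operator f x"
    unfolding K3.operator_def
  proof (intro Bochner_Integration.integral_cong refl)
    fix y assume y: "y \<in> space M"
    have "(LINT z|M. K1 x z * K2 z y) = enn2real (\<integral>\<^sup>+z. ennreal (K1 x z * K2 z y) \<partial>M)"
      using x y by (intro integral_eq_nn_integral) (auto simp: K1.kernel_nonneg K2.kernel_nonneg)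
    also have "\<dots> = K3 x y" using ck[OF x y] K3.kernel_nonneg[OF x y] by simp
    finally show "(LINT z|M. K1 x z * K2 z y * f y) = K3 x y * f y" by simp
  qed
  finally show ?thesis ..
qed

section \<open>Strong convergence on a dense set\<close>

text \<open>The squared L^2 norm. Limits and dominated convergence are handled here, without the
  root and the case distinction of \<open>Lp_norm\<close>; the triangle inequality is replaced by (a
  + b)^2 \<le> 2 a^2 + 2 b^2.\<close>

definition sqnorm :: "'a measure \<Rightarrow> ('a \<Rightarrow> real) \<Rightarrow> ennreal" where
  "sqnorm M f = (\<integral>\<^sup>+x. ennreal ((f x)\<^sup>2) \<partial>M)"

lemma Lp_two_iff_sqnorm: "f \<in> Lp M 2 \<longleftrightarrow> f \<in> borel_measurable M \<and> sqnorm M f < \<infinity>"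
  by (simp add: Lp_two_iff sqnorm_def)

lemma Lp_norm_two_sqnorm: "sqnorm M f < \<infinity> \<Longrightarrow> Lp_norm M 2 f = ennreal (sqrt (enn2real (sqnorm M f)))"
  by (auto simp: Lp_norm_two sqnorm_def Let_def)

lemma sqnorm_le_of_Lp_norm_le:
  assumes "f \<in> Lp M 2" "g \<in> Lp M 2" "Lp_norm M 2 f \<le> Lp_norm M 2 g"
  shows "sqnorm M f \<le> sqnorm M g"
proof -
  have fin: "sqnorm M f < \<infinity>" "sqnorm M g < \<infinity>" using assms by (auto simp: Lp_two_iff_sqnorm)
  then have "enn2real (sqnorm M f) \<le> enn2real (sqnorm M g)"
    using assms(3) by (simp add: Lp_norm_two_sqnorm ennreal_le_iff)
  then show ?thesis using fin by (cases "sqnorm M f"; cases "sqnorm M g") (auto simp: ennreal_leI)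
qed

lemma sqnorm_cong_AE: "AE x in M. f x = g x \<Longrightarrow> sqnorm M f = sqnorm M g"
  unfolding sqnorm_def by (rule nn_integral_cong_AE) (auto elim: AE_mp)

lemma sqnorm_combination_le:
  assumes [measurable]: "f \<in> borel_measurable M" "g \<in> borel_measurable M"
  shows "sqnorm M (\<lambda>x. a * f x + b * g x) \<le> ennreal (2 * a\<^sup>2) * sqnorm M f + ennreal (2 * b\<^sup>2) * sqnorm M g"
proof -
  have "sqnorm M (\<lambda>x. a * f x + b * g x) \<le> (\<integral>\<^sup>+x. ennreal (2 * a\<^sup>2) * ennreal ((f x)\<^sup>2) + ennreal (2 * b\<^sup>2) * ennreal ((g x)\<^sup>2) \<partial>M)"
    unfolding sqnorm_def
  proof (rule nn_integral_mono)
    fix x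
    have "(a * f x + b * g x)\<^sup>2 \<le> 2 * (a * f x)\<^sup>2 + 2 * (b * g x)\<^sup>2"
      using sum_squares_bound[of "a * f x" "b * g x"] by (simp add: power2_sum)
    then have "ennreal ((a * f x + b * g x)\<^sup>2) \<le> ennreal (2 * a\<^sup>2 * (f x)\<^sup>2 + 2 * b\<^sup>2 * (g x)\<^sup>2)"
      by (intro ennreal_leI) (simp add: power_mult_distrib)
    then show "ennreal ((a * f x + b * g x)\<^sup>2) \<le> ennreal (2 * a\<^sup>2) * ennreal ((f x)\<^sup>2) + ennreal (2 * b\<^sup>2) * ennreal ((g x)\<^sup>2)"
      by (simp add: ennreal_mult)
  qed
  also have "\<dots> = ennreal (2 * a\<^sup>2) * sqnorm M f + ennreal (2 * b\<^sup>2) * sqnorm M g"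
    unfolding sqnorm_def by (simp add: nn_integral_add nn_integral_cmult)
  finally show ?thesis .
qed

lemma Lp_two_combination:
  assumes "f \<in> Lp M 2" "g \<in> Lp M 2"
  shows "(\<lambda>x. a * f x + b * g x) \<in> Lp M 2"
proof -
  have m [measurable]: "f \<in> borel_measurable M" "g \<in> borel_measurable M"
    and fin: "sqnorm M f < \<infinity>" "sqnorm M g < \<infinity>"
    using assms by (auto simp: Lp_two_iff_sqnorm)
  have "sqnorm M (\<lambda>x. a * f x + b * g x) \<le> ennreal (2 * a\<^sup>2) * sqnorm M f + ennreal (2 * b\<^sup>2) * sqnorm M g"
    by (rule sqnorm_combination_le) measurable
  also have "\<dots> < \<infinity>" using fin by (simp add: ennreal_mult_less_top)
  finally show ?thesis by (simp add: Lp_two_iff_sqnorm)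
qed

lemma sqnorm_cmult_indicator:
  "A \<in> sets M \<Longrightarrow> sqnorm M (\<lambda>x. c * indicator A x) = ennreal (c\<^sup>2) * emeasure M A"
proof -
  assume [measurable]: "A \<in> sets M"
  have "sqnorm M (\<lambda>x. c * indicator A x) = (\<integral>\<^sup>+x. ennreal (c\<^sup>2) * indicator A x \<partial>M)"
    unfolding sqnorm_def by (intro nn_integral_cong) (auto simp: indicator_def)
  then show ?thesis by (simp add: nn_integral_cmult_indicator)
qed

lemma indicator_in_Lp_two:
  assumes "A \<in> sets M" "emeasure M A < \<infinity>"
  shows "(indicator A :: 'a \<Rightarrow> real) \<in> Lp M 2"
  using sqnorm_cmult_indicator[OF assms(1), of 1] assms by (simp add: Lp_two_iff_sqnorm)

text \<open>The parameter is a natural number because dominated convergence is about sequences; the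
  limit t to 0 is later tested along arbitrary positive null sequences.\<close>

locale L2_contractions =
  fixes M :: "'a measure" and T :: "nat \<Rightarrow> ('a \<Rightarrow> real) \<Rightarrow> 'a \<Rightarrow> real"
  assumes linear: "\<And>n f g a b. f \<in> Lp M 2 \<Longrightarrow> g \<in> Lp M 2 \<Longrightarrow>
      AE x in M. T n (\<lambda>x. a * f x + b * g x) x = a * T n f x + b * T n g x"
    and cong: "\<And>n f g. f \<in> Lp M 2 \<Longrightarrow> g \<in> Lp M 2 \<Longrightarrow> AE x in M. f x = g x \<Longrightarrow> AE x in M. T n f x = T n g x"
    and measurable_T: "\<And>n f. f \<in> Lp M 2 \<Longrightarrow> T n f \<in> borel_measurable M"
    and contraction: "\<And>n f. f \<in> Lp M 2 \<Longrightarrow> sqnorm M (T n f) \<le> sqnorm M f"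
begin

definition conv :: "('a \<Rightarrow> real) \<Rightarrow> bool" where
  "conv f \<longleftrightarrow> (\<lambda>n. sqnorm M (\<lambda>x. T n f x - f x)) \<longlonglongrightarrow> 0"

lemma conv_cong:
  assumes "f \<in> Lp M 2" "g \<in> Lp M 2" "AE x in M. f x = g x" "conv f"
  shows "conv g"
proof -
  have "sqnorm M (\<lambda>x. T n g x - g x) = sqnorm M (\<lambda>x. T n f x - f x)" for n
    by (rule sqnorm_cong_AE) (use cong[OF assms(1-3), of n] assms(3) in eventually_elim, simp)
  then show ?thesis using assms(4) by (simp add: conv_def)
qed

lemma conv_combination:
  assumes f: "f \<in> Lp M 2" and g: "g \<in> Lp M 2" and c: "conv f" "conv g"
  shows "conv (\<lambda>x. a * f x + b * g x)"
  unfolding conv_def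
proof (rule tendsto_sandwich[OF _ _ tendsto_const])
  note [measurable] = measurable_T[OF f] measurable_T[OF g] Lp_measurable[OF f] Lp_measurable[OF g]
  have "sqnorm M (\<lambda>x. T n (\<lambda>x. a * f x + b * g x) x - (a * f x + b * g x)) \<le>
      ennreal (2 * a\<^sup>2) * sqnorm M (\<lambda>x. T n f x - f x) + ennreal (2 * b\<^sup>2) * sqnorm M (\<lambda>x. T n g x - g x)" for n
  proof -
    have "sqnorm M (\<lambda>x. T n (\<lambda>x. a * f x + b * g x) x - (a * f x + b * g x)) =
      sqnorm M (\<lambda>x. a * (T n f x - f x) + b * (T n g x - g x))"
      by (rule sqnorm_cong_AE) (use linear[OF f g, of n a b] in eventually_elim, simp add: algebra_simps)
    also have "\<dots> \<le> ennreal (2 * a\<^sup>2) * sqnorm M (\<lambda>x. T n f x - f x) + ennreal (2 * b\<^sup>2) * sqnorm M (\<lambda>x. T n g x - g x)"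
      by (rule sqnorm_combination_le) measurable
    finally show ?thesis .
  qed
  then show "\<forall>\<^sub>F n in sequentially. sqnorm M (\<lambda>x. T n (\<lambda>x. a * f x + b * g x) x - (a * f x + b * g x)) \<le>
      ennreal (2 * a\<^sup>2) * sqnorm M (\<lambda>x. T n f x - f x) + ennreal (2 * b\<^sup>2) * sqnorm M (\<lambda>x. T n g x - g x)"
    by simp
  have "(\<lambda>n. ennreal (2 * a\<^sup>2) * sqnorm M (\<lambda>x. T n f x - f x) + ennreal (2 * b\<^sup>2) * sqnorm M (\<lambda>x. T n g x - g x))
     \<longlonglongrightarrow> ennreal (2 * a\<^sup>2) * 0 + ennreal (2 * b\<^sup>2) * 0"
    using c unfolding conv_def by (intro tendsto_add ennreal_tendsto_cmult) auto
  then show "(\<lambda>n. ennreal (2 * a\<^sup>2) * sqnorm M (\<lambda>x. T n f x - f x) + ennreal (2 * b\<^sup>2) * sqnorm M (\<lambda>x. T n g x - g x)) \<longlonglongrightarrow> 0"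
    by simp
qed simp

text \<open>The usual three-term argument: T f - f = T (f - h) + (T h - h) - (f - h), with the first
  term controlled by contractivity.\<close>

lemma conv_approx:
  assumes f: "f \<in> Lp M 2"
    and approx: "\<And>e. e > 0 \<Longrightarrow> \<exists>h\<in>Lp M 2. conv h \<and> sqnorm M (\<lambda>x. f x - h x) \<le> ennreal e"
  shows "conv f"
  unfolding conv_def
proof (rule order_tendstoI)
  fix a :: ennreal assume "0 < a"
  obtain c where c: "0 < c" "c < a" using dense[OF \<open>0 < a\<close>] by blast
  then obtain e where "c = ennreal e" "e \<ge> 0" by (cases c) auto
  with c have e: "e > 0" "ennreal e < a" by auto
  \<comment> \<open>Two nested uses of the inequality with factor 2 give 2/20 + 2 (2/20 + 2/20) =
    1/2 times \<open>e\<close>.\<close>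
  obtain h where h: "h \<in> Lp M 2" "conv h" and fh: "sqnorm M (\<lambda>x. f x - h x) \<le> ennreal (e / 20)"
    using approx[of "e / 20"] e by auto
  have d: "(\<lambda>x. 1 * f x + (-1) * h x) \<in> Lp M 2" by (intro Lp_two_combination f h)
  then have d': "(\<lambda>x. f x - h x) \<in> Lp M 2" by simp
  have "\<forall>\<^sub>F n in sequentially. sqnorm M (\<lambda>x. T n h x - h x) < ennreal (e / 20)"
    using h(2) e unfolding conv_def by (intro order_tendstoD(2)) auto
  then show "\<forall>\<^sub>F n in sequentially. sqnorm M (\<lambda>x. T n f x - f x) < a"
  proof eventually_elim
    case (elim n)
    note [measurable] = measurable_T[OF f] measurable_T[OF h(1)] measurable_T[OF d'] Lp_measurable[OF f] Lp_measurable[OF h(1)]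
    have "sqnorm M (\<lambda>x. T n f x - f x) = sqnorm M (\<lambda>x. 1 * T n (\<lambda>x. f x - h x) x + 1 * (1 * (T n h x - h x) + (-1) * (f x - h x)))"
      by (rule sqnorm_cong_AE) (use linear[OF f h(1), of n 1 "-1"] in eventually_elim, simp)
    also have "\<dots> \<le> ennreal (2 * 1\<^sup>2) * sqnorm M (T n (\<lambda>x. f x - h x)) + ennreal (2 * 1\<^sup>2) * sqnorm M (\<lambda>x. 1 * (T n h x - h x) + (-1) * (f x - h x))"
      by (rule sqnorm_combination_le) measurable
    also have "\<dots> \<le> ennreal (2 * 1\<^sup>2) * ennreal (e / 20) + ennreal (2 * 1\<^sup>2) * (ennreal (2 * 1\<^sup>2) * ennreal (e / 20) + ennreal (2 * (-1)\<^sup>2) * ennreal (e / 20))"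
    proof (intro add_mono mult_left_mono)
      show "sqnorm M (T n (\<lambda>x. f x - h x)) \<le> ennreal (e / 20)" using contraction[OF d'] fh by (rule order_trans)
      have "sqnorm M (\<lambda>x. 1 * (T n h x - h x) + (-1) * (f x - h x)) \<le>
        ennreal (2 * 1\<^sup>2) * sqnorm M (\<lambda>x. T n h x - h x) + ennreal (2 * (-1)\<^sup>2) * sqnorm M (\<lambda>x. f x - h x)"
        by (rule sqnorm_combination_le) measurable
      also have "\<dots> \<le> ennreal (2 * 1\<^sup>2) * ennreal (e / 20) + ennreal (2 * (-1)\<^sup>2) * ennreal (e / 20)"
        using elim fh by (intro add_mono mult_left_mono) auto
      finally show "sqnorm M (\<lambda>x. 1 * (T n h x - h x) + (-1) * (f x - h x)) \<le>
        ennreal (2 * 1\<^sup>2) * ennreal (e / 20) + ennreal (2 * (-1)\<^sup>2) * ennreal (e / 20)" .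
    qed auto
    also have "\<dots> = ennreal (e / 2)"
      using e by (simp add: ennreal_mult[symmetric] ennreal_plus[symmetric] del: ennreal_plus ennreal_numeral)
    also have "\<dots> \<le> ennreal e" using e by (intro ennreal_leI) auto
    finally show ?case using e(2) by (rule le_less_trans)
  qed
qed simp

lemma conv_sum_indicators:
  assumes indicators: "\<And>A. A \<in> sets M \<Longrightarrow> emeasure M A < \<infinity> \<Longrightarrow> conv (indicator A)"
    and "finite F" "\<And>y. y \<in> F \<Longrightarrow> A y \<in> sets M \<and> emeasure M (A y) < \<infinity>"
  shows "(\<lambda>x. \<Sum>y\<in>F. y * indicator (A y) x) \<in> Lp M 2 \<and> conv (\<lambda>x. \<Sum>y\<in>F. y * indicator (A y) x)"
  using assms(2-)
proof (induction F rule: finite_induct)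
  case empty
  \<comment> \<open>The zero function is written as a combination of indicators, so that its
    convergence follows from the two facts at hand.\<close>
  have z: "(\<lambda>x. 0 * indicator {} x + 0 * indicator {} x) \<in> Lp M 2"
    by (intro Lp_two_combination indicator_in_Lp_two) auto
  have "conv (\<lambda>x. 0 * indicator {} x + 0 * indicator {} x)"
  proof (rule conv_combination)
    show "conv (indicator {})" "conv (indicator {})" by (rule indicators; simp)+
  qed (rule indicator_in_Lp_two, simp, simp)+
  with z show ?case by simp
next
  case (insert y F)
  have A: "A y \<in> sets M" "emeasure M (A y) < \<infinity>" using insert.prems by auto
  have I: "(indicator (A y) :: 'a \<Rightarrow> real) \<in> Lp M 2" "conv (indicator (A y))"
    using indicator_in_Lp_two[OF A] indicators[OF A] by auto
  have R: "(\<lambda>x. \<Sum>y\<in>F. y * indicator (A y) x) \<in> Lp M 2" "conv (\<lambda>x. \<Sum>y\<in>F. y * indicator (A y) x)"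
    using insert by auto
  have "(\<lambda>x. y * indicator (A y) x + 1 * (\<Sum>y\<in>F. y * indicator (A y) x)) \<in> Lp M 2"
    "conv (\<lambda>x. y * indicator (A y) x + 1 * (\<Sum>y\<in>F. y * indicator (A y) x))"
    by (intro Lp_two_combination conv_combination I R)+
  then show ?case unfolding sum.insert[OF insert.hyps] mult_1_left by blast
qed

text \<open>Simple functions with \<bar>s\<bar> \<le> 2 \<bar>f\<bar> are in L^2, so they are finite
  combinations of indicators of sets of finite measure. They approximate f by dominated convergence
  with majorant 9 f^2.\<close>

lemma conv_all:
  assumes indicators: "\<And>A. A \<in> sets M \<Longrightarrow> emeasure M A < \<infinity> \<Longrightarrow> conv (indicator A)"
    and f: "f \<in> Lp M 2"
  shows "conv f"
proof -
  have fm [measurable]: "f \<in> borel_measurable M" and fin: "sqnorm M f < \<infinity>"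
    using f by (auto simp: Lp_two_iff_sqnorm)
  obtain s where s: "\<And>i. simple_function M (s i)" "\<And>x. x \<in> space M \<Longrightarrow> (\<lambda>i. s i x) \<longlonglongrightarrow> f x"
    "\<And>i x. x \<in> space M \<Longrightarrow> dist (s i x) 0 \<le> 2 * dist (f x) 0"
    using borel_measurable_implies_sequence_metric[OF fm, of 0] by blast
  have sm [measurable]: "s i \<in> borel_measurable M" for i using s(1) by (rule borel_measurable_simple_function)
  have sq: "sqnorm M (s i) < \<infinity>" for i
  proof -
    have "sqnorm M (s i) \<le> (\<integral>\<^sup>+x. ennreal 4 * ennreal ((f x)\<^sup>2) \<partial>M)"
      unfolding sqnorm_def
    proof (rule nn_integral_mono)
      fix x assume "x \<in> space M"
      then have "\<bar>s i x\<bar> \<le> \<bar>2 * f x\<bar>" using s(3)[of x i] by simp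
      then have "(s i x)\<^sup>2 \<le> (2 * f x)\<^sup>2" by (simp add: abs_le_square_iff)
      then have "(s i x)\<^sup>2 \<le> 4 * (f x)\<^sup>2" by (simp add: power_mult_distrib)
      then show "ennreal ((s i x)\<^sup>2) \<le> ennreal 4 * ennreal ((f x)\<^sup>2)"
        by (simp add: ennreal_mult[symmetric] ennreal_leI del: ennreal_numeral)
    qed
    also have "\<dots> = ennreal 4 * sqnorm M f" unfolding sqnorm_def by (simp add: nn_integral_cmult)
    also have "\<dots> < \<infinity>" using fin by (simp add: ennreal_mult_less_top)
    finally show ?thesis .
  qed
  have sL: "s i \<in> Lp M 2" for i using sq by (simp add: Lp_two_iff_sqnorm)
  have sc: "conv (s i)" for i
  proof -
    \<comment> \<open>The value 0 is left out, because its level set may have infinite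
      measure.\<close>
    define F where "F = s i ` space M - {0}"
    define A where "A y = s i -` {y} \<inter> space M" for y
    have F: "finite F" using s(1)[of i] by (auto simp: F_def simple_function_def)
    have A: "A y \<in> sets M" for y unfolding A_def by measurable
    have "emeasure M (A y) < \<infinity>" if "y \<in> F" for y
    proof -
      have "ennreal (y\<^sup>2) * emeasure M (A y) = sqnorm M (\<lambda>x. y * indicator (A y) x)"
        by (rule sqnorm_cmult_indicator[OF A, symmetric])
      also have "\<dots> \<le> sqnorm M (s i)" unfolding sqnorm_def
        by (intro nn_integral_mono) (auto simp: A_def indicator_def)
      also have "\<dots> < \<infinity>" by (rule sq)
      finally show ?thesis using that by (auto simp: ennreal_mult_less_top F_def)
    qed
    with A have *: "(\<lambda>x. \<Sum>y\<in>F. y * indicator (A y) x) \<in> Lp M 2 \<and> conv (\<lambda>x. \<Sum>y\<in>F. y * indicator (A y) x)"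
      by (intro conv_sum_indicators indicators F) auto
    have "(\<Sum>y\<in>F. y * indicator (A y) x) = s i x" if x: "x \<in> space M" for x
    proof -
      have "(\<Sum>y\<in>F. y * indicator (A y) x) = (\<Sum>y\<in>F. if y = s i x then y else 0)"
        using x by (intro sum.cong) (auto simp: A_def indicator_def)
      also have "\<dots> = s i x" using F x by (simp add: sum.delta F_def)
      finally show ?thesis .
    qed
    then show ?thesis using * by (intro conv_cong[OF _ sL]) auto
  qed
  have "(\<lambda>i. sqnorm M (\<lambda>x. f x - s i x)) \<longlonglongrightarrow> (\<integral>\<^sup>+x. 0 \<partial>M)"
    unfolding sqnorm_def
  proof (rule nn_integral_dominated_convergence[where w="\<lambda>x. ennreal 9 * ennreal ((f x)\<^sup>2)"])
    show "(\<integral>\<^sup>+x. ennreal 9 * ennreal ((f x)\<^sup>2) \<partial>M) < \<infinity>"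
      using fin by (simp add: nn_integral_cmult sqnorm_def ennreal_mult_less_top)
    show "AE x in M. ennreal ((f x - s i x)\<^sup>2) \<le> ennreal 9 * ennreal ((f x)\<^sup>2)" for i
    proof (rule AE_I2)
      fix x assume "x \<in> space M"
      then have "\<bar>s i x\<bar> \<le> 2 * \<bar>f x\<bar>" using s(3)[of x i] by simp
      then have "\<bar>f x - s i x\<bar> \<le> \<bar>3 * f x\<bar>" by (simp add: abs_mult)
      then have "(f x - s i x)\<^sup>2 \<le> (3 * f x)\<^sup>2" by (simp only: abs_le_square_iff)
      then show "ennreal ((f x - s i x)\<^sup>2) \<le> ennreal 9 * ennreal ((f x)\<^sup>2)"
        by (simp add: ennreal_mult[symmetric] ennreal_leI power_mult_distrib del: ennreal_numeral)
    qed
    show "AE x in M. (\<lambda>i. ennreal ((f x - s i x)\<^sup>2)) \<longlonglongrightarrow> 0"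
    proof (rule AE_I2)
      fix x assume "x \<in> space M"
      then have "(\<lambda>i. ennreal ((f x - s i x)\<^sup>2)) \<longlonglongrightarrow> ennreal ((f x - f x)\<^sup>2)"
        by (intro tendsto_ennrealI tendsto_intros s)
      then show "(\<lambda>i. ennreal ((f x - s i x)\<^sup>2)) \<longlonglongrightarrow> 0" by simp
    qed
  qed measurable
  then have lim: "(\<lambda>i. sqnorm M (\<lambda>x. f x - s i x)) \<longlonglongrightarrow> 0" by simp
  show ?thesis
  proof (rule conv_approx[OF f])
    fix e :: real assume "e > 0"
    then have "\<forall>\<^sub>F i in sequentially. sqnorm M (\<lambda>x. f x - s i x) < ennreal e"
      using lim by (intro order_tendstoD(2)) auto
    then obtain i where "sqnorm M (\<lambda>x. f x - s i x) < ennreal e"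
      using eventually_happens'[OF sequentially_bot] by blast
    with sL sc show "\<exists>h\<in>Lp M 2. conv h \<and> sqnorm M (\<lambda>x. f x - h x) \<le> ennreal e"
      by (intro bexI[of _ "s i"]) auto
  qed
qed

end

section \<open>Product kernels\<close>

lemma nn_integral_lborel_vec_prod:
  fixes f :: "'n::finite \<Rightarrow> real \<Rightarrow> ennreal"
  assumes [measurable]: "\<And>i. f i \<in> borel_measurable borel"
  shows "(\<integral>\<^sup>+x. (\<Prod>i\<in>UNIV. f i (x $ i)) \<partial>(lborel :: (real ^ 'n) measure)) = (\<Prod>i\<in>UNIV. (\<integral>\<^sup>+u. f i u \<partial>lborel))"
proof -
  define ax where "ax = (\<lambda>i::'n. axis i (1::real))"
  have inj: "inj ax" by (auto simp: ax_def inj_def axis_eq_axis)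
  have Basis: "(Basis :: (real ^ 'n) set) = range ax" by (auto simp: ax_def Basis_vec_def)
  define g where "g b = f (inv ax b)" for b
  have ga: "g (ax i) = f i" for i by (simp add: g_def inv_f_f[OF inj])
  have "(\<integral>\<^sup>+x. (\<Prod>b\<in>Basis. g b (x \<bullet> b)) \<partial>(lborel :: (real ^ 'n) measure)) = (\<Prod>b\<in>Basis. (\<integral>\<^sup>+u. g b u \<partial>lborel))"
    by (rule nn_integral_lborel_prod) (auto simp: g_def)
  then show ?thesis
    unfolding Basis by (simp add: prod.reindex[OF inj] ga) (simp add: ax_def inner_axis)
qed

section \<open>Integration over the positive orthant\<close>

lemma Rplus_set_open: "open {x :: real ^ 'n. \<forall>i. 0 < x $ i}"
proof -
  have "{x :: real ^ 'n. \<forall>i. 0 < x $ i} = (\<Inter>i. {x. 0 < x $ i})" by auto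
  then show ?thesis by (auto intro!: open_INT open_Collect_less continuous_intros)
qed

lemma space_Rplus: "space Rplus = {x :: real ^ 'n. \<forall>i. 0 < x $ i}"
  by (simp add: Rplus_def space_restrict_space)

lemma sets_Rplus_iff: "A \<in> sets (Rplus :: (real ^ 'n) measure) \<longleftrightarrow> A \<in> sets borel \<and> A \<subseteq> {x. \<forall>i. 0 < x $ i}"
  unfolding Rplus_def using borel_open[OF Rplus_set_open[where 'n='n]]
  by (subst sets_restrict_space_iff) auto

lemma emeasure_Rplus: "A \<in> sets Rplus \<Longrightarrow> emeasure Rplus A = emeasure lborel A"
  unfolding Rplus_def using borel_open[OF Rplus_set_open]
  by (subst emeasure_restrict_space) (auto simp: sets_restrict_space)

lemma nn_integral_Rplus:
  "(\<integral>\<^sup>+x. f x \<partial>Rplus) = (\<integral>\<^sup>+x. f x * indicator {x. \<forall>i. 0 < x $ i} x \<partial>lborel)"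
  unfolding Rplus_def using borel_open[OF Rplus_set_open] by (subst nn_integral_restrict_space) auto

lemma measurable_ident_Rplus [measurable]: "(\<lambda>x. x) \<in> Rplus \<rightarrow>\<^sub>M borel"
  unfolding Rplus_def by (rule measurable_restrict_space1) simp

lemma measurable_vec_component_Rplus [measurable]: "(\<lambda>x. x $ i) \<in> borel_measurable Rplus"
  by (rule measurable_compose[OF measurable_ident_Rplus]) simp

lemma sigma_finite_Rplus: "sigma_finite_measure Rplus"
  unfolding Rplus_def using borel_open[OF Rplus_set_open]
  by (intro sigma_finite_measure_restrict_space sigma_finite_lborel) auto

lemma indicator_vec_prod:
  fixes y :: "real ^ 'n"
  shows "indicator {y. \<forall>i. y $ i \<in> A i} y = (\<Prod>i\<in>UNIV. indicator (A i) (y $ i) :: ennreal)"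
proof (cases "\<forall>i. y $ i \<in> A i")
  case False
  then obtain i where "y $ i \<notin> A i" by blast
  then have "(\<Prod>i\<in>UNIV. indicator (A i) (y $ i) :: ennreal) = 0" by (intro prod_zero bexI[of _ i]) auto
  with False show ?thesis by simp
qed auto

lemma nn_integral_Rplus_prod:
  fixes f :: "'n::finite \<Rightarrow> real \<Rightarrow> ennreal"
  assumes [measurable]: "\<And>i. f i \<in> borel_measurable borel"
  shows "(\<integral>\<^sup>+x. (\<Prod>i\<in>UNIV. f i (x $ i)) \<partial>(Rplus :: (real ^ 'n) measure)) = (\<Prod>i\<in>UNIV. (\<integral>\<^sup>+u\<in>{0<..}. f i u \<partial>lborel))"
proof -
  have "(\<integral>\<^sup>+x. (\<Prod>i\<in>UNIV. f i (x $ i)) \<partial>(Rplus :: (real ^ 'n) measure)) =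
    (\<integral>\<^sup>+x. (\<Prod>i\<in>UNIV. f i (x $ i) * indicator {0<..} (x $ i)) \<partial>(lborel :: (real ^ 'n) measure))"
    unfolding nn_integral_Rplus using indicator_vec_prod[where 'n='n, of "\<lambda>_. {0<..}"] by (simp add: prod.distrib)
  also have "\<dots> = (\<Prod>i\<in>UNIV. (\<integral>\<^sup>+u\<in>{0<..}. f i u \<partial>lborel))"
    by (rule nn_integral_lborel_vec_prod) measurable
  finally show ?thesis .
qed

section \<open>The kernel in several coordinates\<close>

lemma laguerre_kernel_eq_prod:
  fixes \<gamma> :: "real ^ 'n"
  shows "laguerre_kernel \<gamma> t x y = (\<Prod>i\<in>UNIV. laguerre_kernel1 (\<gamma> $ i) t (x $ i) (y $ i))"
proof -
  have n: "(norm z)\<^sup>2 = (\<Sum>i\<in>UNIV. (z $ i)\<^sup>2)" for z :: "real ^ 'n"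
    unfolding power2_norm_eq_inner inner_vec_def by (simp add: power2_eq_square)
  have "exp (- (1 / 2) * (cosh (2 * t) / sinh (2 * t)) * ((norm x)\<^sup>2 + (norm y)\<^sup>2)) =
    (\<Prod>i\<in>UNIV. exp (- (1 / 2) * (cosh (2 * t) / sinh (2 * t)) * ((x $ i)\<^sup>2 + (y $ i)\<^sup>2)))"
    by (simp only: n sum.distrib[symmetric] sum_distrib_left exp_sum[OF finite_class.finite_UNIV])
  moreover have "(1 / sinh (2 * t)) ^ CARD('n) = (\<Prod>i\<in>(UNIV :: 'n set). 1 / sinh (2 * t))" by simp
  ultimately show ?thesis unfolding laguerre_kernel_def laguerre_kernel1_def by (simp only: prod.distrib)
qed

definition laguerre_exp_kernel :: "real ^ 'n \<Rightarrow> real \<Rightarrow> real ^ 'n \<Rightarrow> real ^ 'n \<Rightarrow> real" where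
  "laguerre_exp_kernel \<gamma> t x y = exp (- 2 * t) * laguerre_kernel \<gamma> t x y"

lemma ennreal_laguerre_exp_kernel:
  assumes "\<And>i. \<gamma> $ i \<ge> -1/2" "t > 0" "x \<in> space Rplus" "y \<in> space Rplus"
  shows "ennreal (laguerre_exp_kernel \<gamma> t x y) = ennreal (exp (- 2 * t)) * (\<Prod>i\<in>UNIV. ennreal (laguerre_kernel1 (\<gamma> $ i) t (x $ i) (y $ i)))"
  using assms unfolding laguerre_exp_kernel_def laguerre_kernel_eq_prod
  by (subst prod_ennreal) (auto simp: ennreal_mult' space_Rplus intro!: laguerre_kernel1_nonneg)

text \<open>With every \<open>A i\<close> equal to \<open>UNIV\<close> this is the row mass; with
  intervals it is the mass of a box, which enters strong continuity and the failure of
  contractivity.\<close>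

lemma nn_integral_laguerre_exp_kernel:
  fixes \<gamma> :: "real ^ 'n" and A :: "'n \<Rightarrow> real set"
  assumes \<gamma>: "\<And>i. \<gamma> $ i \<ge> -1/2" and t: "t > 0" and x: "x \<in> space Rplus"
    and A [measurable]: "\<And>i. A i \<in> sets borel"
  shows "(\<integral>\<^sup>+y. ennreal (laguerre_exp_kernel \<gamma> t x y) * indicator {y. \<forall>i. y $ i \<in> A i} y \<partial>Rplus) =
    ennreal (exp (- 2 * t)) * (\<Prod>i\<in>UNIV. (\<integral>\<^sup>+u\<in>A i \<inter> {0<..}. ennreal (laguerre_kernel1 (\<gamma> $ i) t (x $ i) u) \<partial>lborel))"
proof -
  have "(\<integral>\<^sup>+y. ennreal (laguerre_exp_kernel \<gamma> t x y) * indicator {y. \<forall>i. y $ i \<in> A i} y \<partial>Rplus) =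
    (\<integral>\<^sup>+y. ennreal (exp (- 2 * t)) * (\<Prod>i\<in>UNIV. ennreal (laguerre_kernel1 (\<gamma> $ i) t (x $ i) (y $ i)) * indicator (A i) (y $ i)) \<partial>Rplus)"
  proof (rule nn_integral_cong)
    fix y :: "real ^ 'n" assume y: "y \<in> space Rplus"
    show "ennreal (laguerre_exp_kernel \<gamma> t x y) * indicator {y. \<forall>i. y $ i \<in> A i} y =
      ennreal (exp (- 2 * t)) * (\<Prod>i\<in>UNIV. ennreal (laguerre_kernel1 (\<gamma> $ i) t (x $ i) (y $ i)) * indicator (A i) (y $ i))"
      by (simp add: ennreal_laguerre_exp_kernel[OF \<gamma> t x y] indicator_vec_prod prod.distrib mult.assoc)
  qed
  also have "\<dots> = ennreal (exp (- 2 * t)) * (\<integral>\<^sup>+y. (\<Prod>i\<in>UNIV. ennreal (laguerre_kernel1 (\<gamma> $ i) t (x $ i) (y $ i)) * indicator (A i) (y $ i)) \<partial>Rplus)"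
    by (rule nn_integral_cmult) measurable
  also have "(\<integral>\<^sup>+y. (\<Prod>i\<in>UNIV. ennreal (laguerre_kernel1 (\<gamma> $ i) t (x $ i) (y $ i)) * indicator (A i) (y $ i)) \<partial>Rplus) =
     (\<Prod>i\<in>UNIV. (\<integral>\<^sup>+u\<in>{0<..}. ennreal (laguerre_kernel1 (\<gamma> $ i) t (x $ i) u) * indicator (A i) u \<partial>lborel))"
    by (rule nn_integral_Rplus_prod[where f="\<lambda>i u. ennreal (laguerre_kernel1 (\<gamma> $ i) t (x $ i) u) * indicator (A i) u"]) measurable
  also have "\<dots> = (\<Prod>i\<in>UNIV. (\<integral>\<^sup>+u\<in>A i \<inter> {0<..}. ennreal (laguerre_kernel1 (\<gamma> $ i) t (x $ i) u) \<partial>lborel))"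
    by (intro prod.cong refl nn_integral_cong) (auto simp: indicator_def)
  finally show ?thesis .
qed

text \<open>For orders at least -1/2 the value 4 occurs exactly on the open interval from -1/2 to
  1/2. The product over the coordinates is thus 1 in the submarkovian range, and in general it is
  the constant of the norm bound.\<close>

definition laguerre_mass :: "real \<Rightarrow> real" where
  "laguerre_mass \<nu> = (if \<nu> = -1/2 \<or> \<nu> \<ge> 1/2 then 1 else 4)"

lemma bessel_I_le_laguerre_mass:
  "\<nu> \<ge> -1/2 \<Longrightarrow> z > 0 \<Longrightarrow> sqrt z * bessel_I \<nu> z \<le> laguerre_mass \<nu> * (sqrt (2 / pi) * cosh z)"
  using bessel_I_le_cosh[of \<nu> z] bessel_I_le_cosh_uniform[of \<nu> z] by (auto simp: laguerre_mass_def)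

lemma laguerre_mass_ge_1: "laguerre_mass \<nu> \<ge> 1"
  by (simp add: laguerre_mass_def)

lemma symmetric_kernel_laguerre:
  fixes \<gamma> :: "real ^ 'n"
  assumes \<gamma>: "\<And>i. \<gamma> $ i \<ge> -1/2" and t: "t > 0"
  shows "symmetric_kernel Rplus (laguerre_exp_kernel \<gamma> t)
    ((\<Prod>i\<in>UNIV. laguerre_mass (\<gamma> $ i)) * exp (- 2 * t) * cosh (2 * t) powr (- real CARD('n) / 2))
    (exp (- 2 * t) * (4 * sqrt (2 / pi) / sqrt (sinh (2 * t))) ^ CARD('n))"
proof -
  interpret sigma_finite_measure "Rplus :: (real ^ 'n) measure" by (rule sigma_finite_Rplus)
  show ?thesis
  proof
    show "case_prod (laguerre_exp_kernel \<gamma> t) \<in> borel_measurable (Rplus \<Otimes>\<^sub>M Rplus)"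
      unfolding laguerre_exp_kernel_def laguerre_kernel_eq_prod by measurable
    show "0 < (\<Prod>i\<in>UNIV. laguerre_mass (\<gamma> $ i)) * exp (- 2 * t) * cosh (2 * t) powr (- real CARD('n) / 2)"
      using less_le_trans[OF zero_less_one laguerre_mass_ge_1] cosh_real_pos[of "2 * t"]
      by (intro mult_pos_pos prod_pos) auto
    fix x :: "real ^ 'n" assume x: "x \<in> space Rplus"
    have "(\<integral>\<^sup>+y. ennreal (laguerre_exp_kernel \<gamma> t x y) \<partial>Rplus) =
      ennreal (exp (- 2 * t)) * (\<Prod>i\<in>UNIV. (\<integral>\<^sup>+u\<in>{0<..}. ennreal (laguerre_kernel1 (\<gamma> $ i) t (x $ i) u) \<partial>lborel))"
      using nn_integral_laguerre_exp_kernel[OF \<gamma> t x, of "\<lambda>_. UNIV"] by simp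
    also have "\<dots> \<le> ennreal (exp (- 2 * t)) * (\<Prod>i\<in>UNIV. ennreal (laguerre_mass (\<gamma> $ i) * cosh (2 * t) powr (-1/2)))"
      using x by (intro mult_left_mono prod_mono_ennreal laguerre_kernel1_row_mass bessel_I_le_laguerre_mass \<gamma> t)
        (auto simp: space_Rplus laguerre_mass_def)
    also have "\<dots> = ennreal (exp (- 2 * t) * (\<Prod>i\<in>UNIV. laguerre_mass (\<gamma> $ i) * cosh (2 * t) powr (-1/2)))"
      using order_trans[OF zero_le_one laguerre_mass_ge_1] by (subst prod_ennreal) (auto simp: ennreal_mult')
    also have "exp (- 2 * t) * (\<Prod>i\<in>UNIV. laguerre_mass (\<gamma> $ i) * cosh (2 * t) powr (-1/2)) =
      (\<Prod>i\<in>UNIV. laguerre_mass (\<gamma> $ i)) * exp (- 2 * t) * cosh (2 * t) powr (- real CARD('n) / 2)"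
      using cosh_real_pos[of "2 * t"] by (simp add: prod.distrib powr_powr flip: powr_realpow)
    finally show "(\<integral>\<^sup>+y. ennreal (laguerre_exp_kernel \<gamma> t x y) \<partial>Rplus) \<le> \<dots>" .
    fix y :: "real ^ 'n" assume y: "y \<in> space Rplus"
    have nn: "0 \<le> laguerre_kernel1 (\<gamma> $ i) t (x $ i) (y $ i)" for i
      using x y by (intro laguerre_kernel1_nonneg \<gamma> t) (auto simp: space_Rplus)
    show "0 \<le> laguerre_exp_kernel \<gamma> t x y"
      unfolding laguerre_exp_kernel_def laguerre_kernel_eq_prod by (intro mult_nonneg_nonneg prod_nonneg) (auto simp: nn)
    show "laguerre_exp_kernel \<gamma> t x y = laguerre_exp_kernel \<gamma> t y x"
      unfolding laguerre_exp_kernel_def laguerre_kernel_eq_prod by (simp only: laguerre_kernel1_commute)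
    have "(\<Prod>i\<in>UNIV. laguerre_kernel1 (\<gamma> $ i) t (x $ i) (y $ i)) \<le> (\<Prod>i\<in>(UNIV :: 'n set). 4 * sqrt (2 / pi) / sqrt (sinh (2 * t)))"
      using x y nn by (intro prod_mono conjI laguerre_kernel1_bounded \<gamma> t) (auto simp: space_Rplus)
    then show "laguerre_exp_kernel \<gamma> t x y \<le> exp (- 2 * t) * (4 * sqrt (2 / pi) / sqrt (sinh (2 * t))) ^ CARD('n)"
      unfolding laguerre_exp_kernel_def laguerre_kernel_eq_prod by (intro mult_left_mono) auto
  qed
qed

lemma laguerre_exp_kernel_chapman_kolmogorov:
  fixes \<gamma> :: "real ^ 'n"
  assumes \<gamma>: "\<And>i. \<gamma> $ i \<ge> -1/2" and s: "s > 0" and t: "t > 0"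
    and x: "x \<in> space Rplus" and y: "y \<in> space Rplus"
  shows "(\<integral>\<^sup>+z. ennreal (laguerre_exp_kernel \<gamma> s x z * laguerre_exp_kernel \<gamma> t z y) \<partial>Rplus) = ennreal (laguerre_exp_kernel \<gamma> (s + t) x y)"
proof -
  have pos: "x $ i > 0" "y $ i > 0" for i using x y by (auto simp: space_Rplus)
  have "(\<integral>\<^sup>+z. ennreal (laguerre_exp_kernel \<gamma> s x z * laguerre_exp_kernel \<gamma> t z y) \<partial>Rplus) =
    (\<integral>\<^sup>+z. ennreal (exp (- 2 * (s + t))) * (\<Prod>i\<in>UNIV. ennreal (laguerre_kernel1 (\<gamma> $ i) s (x $ i) (z $ i) * laguerre_kernel1 (\<gamma> $ i) t (z $ i) (y $ i))) \<partial>Rplus)"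
  proof (rule nn_integral_cong)
    fix z :: "real ^ 'n" assume z: "z \<in> space Rplus"
    have "0 \<le> laguerre_kernel1 (\<gamma> $ i) s (x $ i) (z $ i) * laguerre_kernel1 (\<gamma> $ i) t (z $ i) (y $ i)" for i
      using z pos by (intro mult_nonneg_nonneg laguerre_kernel1_nonneg \<gamma> s t) (auto simp: space_Rplus)
    then show "ennreal (laguerre_exp_kernel \<gamma> s x z * laguerre_exp_kernel \<gamma> t z y) =
      ennreal (exp (- 2 * (s + t))) * (\<Prod>i\<in>UNIV. ennreal (laguerre_kernel1 (\<gamma> $ i) s (x $ i) (z $ i) * laguerre_kernel1 (\<gamma> $ i) t (z $ i) (y $ i)))"
      unfolding laguerre_exp_kernel_def laguerre_kernel_eq_prod
      by (subst prod_ennreal) (simp_all add: ennreal_mult'[symmetric] prod.distrib exp_add[symmetric] mult_ac distrib_left exp_diff exp_minus divide_inverse)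
  qed
  also have "\<dots> = ennreal (exp (- 2 * (s + t))) * (\<integral>\<^sup>+z. (\<Prod>i\<in>UNIV. ennreal (laguerre_kernel1 (\<gamma> $ i) s (x $ i) (z $ i) * laguerre_kernel1 (\<gamma> $ i) t (z $ i) (y $ i))) \<partial>Rplus)"
    by (rule nn_integral_cmult) measurable
  also have "(\<integral>\<^sup>+z. (\<Prod>i\<in>UNIV. ennreal (laguerre_kernel1 (\<gamma> $ i) s (x $ i) (z $ i) * laguerre_kernel1 (\<gamma> $ i) t (z $ i) (y $ i))) \<partial>Rplus) =
      (\<Prod>i\<in>UNIV. (\<integral>\<^sup>+u\<in>{0<..}. ennreal (laguerre_kernel1 (\<gamma> $ i) s (x $ i) u * laguerre_kernel1 (\<gamma> $ i) t u (y $ i)) \<partial>lborel))"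
    by (rule nn_integral_Rplus_prod[where f="\<lambda>i u. ennreal (laguerre_kernel1 (\<gamma> $ i) s (x $ i) u * laguerre_kernel1 (\<gamma> $ i) t u (y $ i))"]) measurable
  also have "\<dots> = (\<Prod>i\<in>UNIV. ennreal (laguerre_kernel1 (\<gamma> $ i) (s + t) (x $ i) (y $ i)))"
    by (intro prod.cong refl laguerre_kernel1_chapman_kolmogorov \<gamma> s t pos)
  finally show ?thesis using ennreal_laguerre_exp_kernel[OF \<gamma> _ x y, of "s + t"] s t by simp
qed

lemma modified_laguerre_eq_operator:
  assumes "\<And>i. (\<alpha> + axis j 1) $ i \<ge> -1/2" "t > 0"
  shows "modified_laguerre \<alpha> j t = symmetric_kernel.operator Rplus (laguerre_exp_kernel (\<alpha> + axis j 1) t)"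
proof (intro ext)
  fix f :: "real ^ 'a \<Rightarrow> real" and x
  interpret symmetric_kernel Rplus "laguerre_exp_kernel (\<alpha> + axis j 1) t"
      "(\<Prod>i\<in>UNIV. laguerre_mass ((\<alpha> + axis j 1) $ i)) * exp (- 2 * t) * cosh (2 * t) powr (- real CARD('a) / 2)"
      "exp (- 2 * t) * (4 * sqrt (2 / pi) / sqrt (sinh (2 * t))) ^ CARD('a)"
    by (rule symmetric_kernel_laguerre[OF assms])
  show "modified_laguerre \<alpha> j t f x = operator f x"
    using assms(2) unfolding modified_laguerre_def operator_def laguerre_exp_kernel_def
    by (simp add: mult.assoc)
qed

section \<open>Strong continuity\<close>

text \<open>The weak inequality yields contractivity; its strictness rules out the Markov
  property.\<close>

lemma exp_kernel_mass_less_1: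
  assumes "t > 0"
  shows "exp (- 2 * t) * cosh (2 * t) powr (- real n / 2) < (1::real)"
proof -
  have "cosh (2 * t) powr (- real n / 2) \<le> cosh (2 * t) powr 0"
    by (intro powr_mono) (auto simp: cosh_real_ge_1)
  then have "cosh (2 * t) powr (- real n / 2) \<le> 1" using cosh_real_pos[of "2 * t"] by simp
  then have "exp (- 2 * t) * cosh (2 * t) powr (- real n / 2) \<le> exp (- 2 * t) * 1" by (intro mult_left_mono) auto
  also have "\<dots> < 1" using assms by simp
  finally show ?thesis .
qed

text \<open>Nonempty open sets are not Lebesgue null. Both negative results use this to confront a
  pointwise estimate with a statement that holds almost everywhere.\<close>

lemma not_AE_Rplus_open:
  fixes U :: "(real ^ 'n) set"
  assumes "open U" "U \<noteq> {}" "U \<subseteq> space Rplus" "AE x in Rplus. P x" "\<And>x. x \<in> U \<Longrightarrow> \<not> P x"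
  shows False
proof -
  have U: "U \<in> sets Rplus" using assms by (simp add: sets_Rplus_iff space_Rplus)
  obtain N where N: "{x \<in> space Rplus. \<not> P x} \<subseteq> N" "emeasure Rplus N = 0" "N \<in> sets Rplus"
    using assms(4) by (rule AE_E)
  have "U \<subseteq> N" using assms N by auto
  then have "emeasure Rplus U = 0" using N emeasure_mono[of U N Rplus] by simp
  then have "U \<in> null_sets lebesgue"
    using U emeasure_Rplus[OF U] assms(1) by (intro null_sets_completionI) auto
  then show False using assms open_not_negligible by (auto simp: negligible_iff_null_sets)
qed

text \<open>A squeeze: the row mass is at most 1, and from below a small box around x inside U
  already captures the product of the one-dimensional local masses, each tending to 1.\<close>

lemma operator_indicator_tendsto:
  fixes \<gamma> :: "real ^ 'n"
  assumes \<gamma>: "\<And>i. \<gamma> $ i = -1/2 \<or> \<gamma> $ i \<ge> 1/2" and U: "open U" "U \<subseteq> space Rplus" and x: "x \<in> U"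
  shows "((\<lambda>t. symmetric_kernel.operator Rplus (laguerre_exp_kernel \<gamma> t) (indicator U) x) \<longlongrightarrow> 1) (at_right 0)"
proof -
  have \<gamma>': "\<gamma> $ i \<ge> -1/2" for i using \<gamma>[of i] by auto
  have x': "x \<in> space Rplus" and x0: "x $ i > 0" for i using x U by (auto simp: space_Rplus)
  have Um [measurable]: "U \<in> sets Rplus" using U by (simp add: sets_Rplus_iff space_Rplus)
  obtain e where e: "e > 0" "ball x e \<subseteq> U" using U(1) x by (auto simp: open_contains_ball)
  \<comment> \<open>The Euclidean norm is at most the sum of the coordinates' moduli, so on the
    closed box it is at most CARD('n) * \<delta> = e/2 < e.\<close>
  define \<delta> where "\<delta> = e / (2 * real CARD('n))"
  have \<delta>: "\<delta> > 0" using e by (simp add: \<delta>_def)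
  have box: "y \<in> U" if "\<And>i. \<bar>y $ i - x $ i\<bar> \<le> \<delta>" for y
  proof -
    have "norm (y - x) \<le> (\<Sum>i\<in>UNIV. \<bar>(y - x) $ i\<bar>)" by (rule norm_le_l1_cart)
    also have "\<dots> \<le> (\<Sum>i\<in>(UNIV::'n set). \<delta>)" using that by (intro sum_mono) simp
    also have "\<dots> < e" using e by (simp add: \<delta>_def)
    finally show ?thesis using e by (auto simp: dist_norm norm_minus_commute)
  qed
  have \<delta>x: "\<delta> < x $ i" for i
  proof -
    \<comment> \<open>The lower corner of the closed box is still in U, hence in the orthant; this
      keeps the one-dimensional windows away from 0.\<close>
    have "x - (\<chi> k. \<delta>) \<in> U" using \<delta> by (intro box) simp
    then show ?thesis using U by (auto simp: space_Rplus)
  qed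
  have "\<forall>i. \<exists>L. (L \<longlongrightarrow> 1) (at_right 0) \<and> (\<forall>\<^sub>F t in at_right 0. 0 \<le> L t \<and>
      ennreal (L t) \<le> (\<integral>\<^sup>+u\<in>{x $ i - \<delta><..<x $ i + \<delta>}. ennreal (laguerre_kernel1 (\<gamma> $ i) t (x $ i) u) \<partial>lborel))"
    (is "\<forall>i. \<exists>L. ?Q i L")
  proof
    fix i
    show "\<exists>L. ?Q i L"
      by (rule laguerre_kernel1_local_mass_tendsto[OF \<gamma>'[of i] \<delta> \<delta>x[of i]]) (rule exI, erule (1) conjI)
  qed
  then have "\<exists>L. \<forall>i. ?Q i (L i)" by (rule choice)
  then obtain L where "\<forall>i. ?Q i (L i)" ..
  then have L: "\<And>i. (L i \<longlongrightarrow> 1) (at_right 0)" "\<And>i. \<forall>\<^sub>F t in at_right 0. 0 \<le> L i t \<and>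
      ennreal (L i t) \<le> (\<integral>\<^sup>+u\<in>{x $ i - \<delta><..<x $ i + \<delta>}. ennreal (laguerre_kernel1 (\<gamma> $ i) t (x $ i) u) \<partial>lborel)"
    by simp_all
  define P where "P t = exp (- 2 * t) * (\<Prod>i\<in>UNIV. L i t)" for t
  have "(P \<longlongrightarrow> exp (- 2 * 0) * (\<Prod>i\<in>(UNIV::'n set). 1)) (at_right 0)"
    unfolding P_def by (intro tendsto_intros L)
  then have P1: "(P \<longlongrightarrow> 1) (at_right 0)" by simp
  have pos: "\<forall>\<^sub>F t in at_right (0::real). t > 0" by (simp add: eventually_at_filter)
  have ev: "\<forall>\<^sub>F t in at_right 0. \<forall>i. 0 \<le> L i t \<and>
      ennreal (L i t) \<le> (\<integral>\<^sup>+u\<in>{x $ i - \<delta><..<x $ i + \<delta>}. ennreal (laguerre_kernel1 (\<gamma> $ i) t (x $ i) u) \<partial>lborel)"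
    using L(2) by (rule eventually_all_finite)
  have main: "\<forall>\<^sub>F t in at_right 0. P t \<le> symmetric_kernel.operator Rplus (laguerre_exp_kernel \<gamma> t) (indicator U) x \<and>
      symmetric_kernel.operator Rplus (laguerre_exp_kernel \<gamma> t) (indicator U) x \<le> 1"
    using pos ev
  proof eventually_elim
    case (elim t)
    interpret symmetric_kernel Rplus "laguerre_exp_kernel \<gamma> t"
      "(\<Prod>i\<in>UNIV. laguerre_mass (\<gamma> $ i)) * exp (- 2 * t) * cosh (2 * t) powr (- real CARD('n) / 2)"
      "exp (- 2 * t) * (4 * sqrt (2 / pi) / sqrt (sinh (2 * t))) ^ CARD('n)"
      by (rule symmetric_kernel_laguerre[OF \<gamma>' \<open>t > 0\<close>])
    have m1: "(\<Prod>i\<in>UNIV. laguerre_mass (\<gamma> $ i)) = 1" using \<gamma> by (intro prod.neutral) (auto simp: laguerre_mass_def)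
    have b: "AE y in Rplus. \<bar>indicator U y :: real\<bar> \<le> 1" by (auto simp: indicator_def)
    have im: "(indicator U :: _ \<Rightarrow> real) \<in> borel_measurable Rplus" by measurable
    have "\<bar>operator (indicator U) x\<bar> \<le> exp (- 2 * t) * cosh (2 * t) powr (- real CARD('n) / 2)"
      using bounded_in_operator_domain(2)[OF im b x'] by (simp add: m1)
    also have "\<dots> \<le> 1" using exp_kernel_mass_less_1[OF \<open>t > 0\<close>] by (rule less_imp_le)
    finally have up: "operator (indicator U) x \<le> 1" by simp
    have int: "integrable Rplus (\<lambda>y. laguerre_exp_kernel \<gamma> t x y * indicator U y)"
      using bounded_in_operator_domain(1)[OF im b] x' by (simp add: operator_domain_def)
    have "ennreal (P t) = ennreal (exp (- 2 * t)) * (\<Prod>i\<in>UNIV. ennreal (L i t))"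
      unfolding P_def using elim by (subst prod_ennreal) (auto simp: ennreal_mult')
    also have "\<dots> \<le> ennreal (exp (- 2 * t)) * (\<Prod>i\<in>UNIV. (\<integral>\<^sup>+u\<in>{x $ i - \<delta><..<x $ i + \<delta>} \<inter> {0<..}. ennreal (laguerre_kernel1 (\<gamma> $ i) t (x $ i) u) \<partial>lborel))"
    proof (intro mult_left_mono prod_mono_ennreal)
      fix i
      have "{x $ i - \<delta><..<x $ i + \<delta>} \<inter> {0<..} = {x $ i - \<delta><..<x $ i + \<delta>}" using \<delta>x[of i] by auto
      then show "ennreal (L i t) \<le> (\<integral>\<^sup>+u\<in>{x $ i - \<delta><..<x $ i + \<delta>} \<inter> {0<..}. ennreal (laguerre_kernel1 (\<gamma> $ i) t (x $ i) u) \<partial>lborel)"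
        using elim by simp
    qed simp
    also have "\<dots> = (\<integral>\<^sup>+y. ennreal (laguerre_exp_kernel \<gamma> t x y) * indicator {y. \<forall>i. y $ i \<in> {x $ i - \<delta><..<x $ i + \<delta>}} y \<partial>Rplus)"
      by (rule nn_integral_laguerre_exp_kernel[OF \<gamma>' \<open>t > 0\<close> x', symmetric]) measurable
    also have "\<dots> \<le> (\<integral>\<^sup>+y. ennreal (laguerre_exp_kernel \<gamma> t x y * indicator U y) \<partial>Rplus)"
    proof (rule nn_integral_mono)
      fix y :: "real ^ 'n"
      have "y \<in> U" if "\<And>i. y $ i \<in> {x $ i - \<delta><..<x $ i + \<delta>}"
      proof (rule box)
        show "\<bar>y $ i - x $ i\<bar> \<le> \<delta>" for i using that[of i] by (auto simp: abs_le_iff)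
      qed
      then show "ennreal (laguerre_exp_kernel \<gamma> t x y) * indicator {y. \<forall>i. y $ i \<in> {x $ i - \<delta><..<x $ i + \<delta>}} y \<le>
        ennreal (laguerre_exp_kernel \<gamma> t x y * indicator U y)"
        by (auto simp: indicator_def)
    qed
    also have "\<dots> = ennreal (operator (indicator U) x)"
      unfolding operator_def using int x' by (intro nn_integral_eq_integral) (auto simp: kernel_nonneg)
    finally have "P t \<le> operator (indicator U) x"
      using operator_nonneg[OF _ x', of "indicator U"] by (subst (asm) ennreal_le_iff) auto
    with up show ?case by simp
  qed
  show ?thesis
    by (rule tendsto_sandwich[OF _ _ P1 tendsto_const]) (use main in \<open>auto elim: eventually_mono\<close>)
qed

text \<open>For a contraction \<open>T\<close> with \<open>0 \<le> T\<close>, expanding the square gives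
  \<open>\<parallel>T 1\<^sub>U - 1\<^sub>U\<parallel>\<^sup>2 \<le> 2 (\<bar>U\<bar> - \<langle>T 1\<^sub>U, 1\<^sub>U\<rangle>)\<close>, so pointwise convergence on \<open>U\<close> is enough.\<close>

lemma sqnorm_operator_indicator_le:
  assumes g [measurable]: "g \<in> borel_measurable M" and U [measurable]: "U \<in> sets M" and fin: "emeasure M U < \<infinity>"
    and contr: "sqnorm M g \<le> sqnorm M (indicator U)" and g1: "\<And>x. x \<in> space M \<Longrightarrow> 0 \<le> g x \<and> g x \<le> 1"
  shows "sqnorm M (\<lambda>x. g x - indicator U x) \<le> 2 * (\<integral>\<^sup>+x\<in>U. ennreal (1 - g x) \<partial>M)"
proof -
  have U2: "sqnorm M (indicator U) = emeasure M U" using sqnorm_cmult_indicator[OF U, of 1] by simp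
  have iU: "integrable M (indicator U :: _ \<Rightarrow> real)" using fin by (simp add: integrable_indicator_iff U)
  have ig: "integrable M (\<lambda>x. g x * indicator U x)"
    using iU g1 by (intro Bochner_Integration.integrable_bound[OF iU]) (auto simp: indicator_def)
  have ig2: "integrable M (\<lambda>x. (g x)\<^sup>2)"
  proof (rule integrableI_nonneg)
    show "(\<integral>\<^sup>+x. ennreal ((g x)\<^sup>2) \<partial>M) < \<infinity>"
      using contr fin unfolding U2 unfolding sqnorm_def by (rule le_less_trans)
  qed auto
  have "ennreal (LINT x|M. (g x)\<^sup>2) = sqnorm M g"
    unfolding sqnorm_def by (rule nn_integral_eq_integral[symmetric, OF ig2]) auto
  also have "\<dots> \<le> ennreal (measure M U)" using contr fin by (simp add: U2 emeasure_eq_ennreal_measure)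
  finally have le: "(LINT x|M. (g x)\<^sup>2) \<le> measure M U" by (simp add: ennreal_le_iff)
  have eq: "(g x - indicator U x)\<^sup>2 = (g x)\<^sup>2 - 2 * (g x * indicator U x) + indicator U x" for x
    by (simp add: indicator_def power2_diff)
  have id: "integrable M (\<lambda>x. (g x - indicator U x)\<^sup>2)" unfolding eq using ig ig2 iU by auto
  have "sqnorm M (\<lambda>x. g x - indicator U x) = ennreal (LINT x|M. (g x - indicator U x)\<^sup>2)"
    unfolding sqnorm_def by (rule nn_integral_eq_integral[OF id]) auto
  also have "(LINT x|M. (g x - indicator U x)\<^sup>2) = (LINT x|M. (g x)\<^sup>2) - 2 * (LINT x|M. g x * indicator U x) + measure M U"
    unfolding eq using ig ig2 iU by simp
  also have "\<dots> \<le> 2 * (LINT x|M. indicator U x - g x * indicator U x)"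
    using le ig iU by simp
  also have "ennreal (2 * (LINT x|M. indicator U x - g x * indicator U x)) = 2 * (\<integral>\<^sup>+x. ennreal (indicator U x - g x * indicator U x) \<partial>M)"
  proof -
    have "(\<integral>\<^sup>+x. ennreal (indicator U x - g x * indicator U x) \<partial>M) = ennreal (LINT x|M. indicator U x - g x * indicator U x)"
      by (rule nn_integral_eq_integral[OF Bochner_Integration.integrable_diff[OF iU ig]])
        (use g1 in \<open>auto simp: indicator_def\<close>)
    then show ?thesis by (simp add: ennreal_mult')
  qed
  also have "(\<integral>\<^sup>+x. ennreal (indicator U x - g x * indicator U x) \<partial>M) = (\<integral>\<^sup>+x\<in>U. ennreal (1 - g x) \<partial>M)"
    by (intro nn_integral_cong) (auto simp: indicator_def)
  finally show ?thesis by (simp add: ennreal_leI)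
qed

lemma Lp_norm_two_tendsto_0:
  assumes "(\<lambda>n. sqnorm M (h n)) \<longlonglongrightarrow> 0"
  shows "(\<lambda>n. Lp_norm M 2 (h n)) \<longlonglongrightarrow> 0"
proof (rule order_tendstoI)
  fix a :: ennreal assume "0 < a"
  obtain c where c: "0 < c" "c < a" using dense[OF \<open>0 < a\<close>] by blast
  then obtain e where "c = ennreal e" "e \<ge> 0" by (cases c) auto
  with c have e: "e > 0" "ennreal e < a" by auto
  then have "\<forall>\<^sub>F n in sequentially. sqnorm M (h n) < ennreal (e\<^sup>2)"
    using assms by (intro order_tendstoD(2)) auto
  then show "\<forall>\<^sub>F n in sequentially. Lp_norm M 2 (h n) < a"
  proof eventually_elim
    case (elim n)
    then have fin: "sqnorm M (h n) < \<infinity>" by (rule less_trans) simp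
    have "enn2real (sqnorm M (h n)) \<le> e\<^sup>2" using elim by (intro enn2real_leI) auto
    then have "sqrt (enn2real (sqnorm M (h n))) \<le> e" using e by (simp add: real_le_lsqrt)
    then have "Lp_norm M 2 (h n) \<le> ennreal e" using fin by (simp add: Lp_norm_two_sqnorm ennreal_leI)
    then show ?case using e(2) by (rule le_less_trans)
  qed
qed simp

text \<open>For open U the quantity 1 - T 1_U tends to 0 at each point of U and is dominated by 1
  there. A general set of finite measure is approximated from outside by open sets, and
  \<open>conv_all\<close> extends the result to L^2.\<close>

lemma laguerre_L2_continuity:
  fixes \<gamma> :: "real ^ 'n"
  assumes \<gamma>: "\<And>i. \<gamma> $ i = -1/2 \<or> \<gamma> $ i \<ge> 1/2"
    and X: "\<And>n. X n > 0" "X \<longlonglongrightarrow> 0" and f: "f \<in> Lp Rplus 2"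
  shows "(\<lambda>n. Lp_norm Rplus 2 (\<lambda>x. symmetric_kernel.operator Rplus (laguerre_exp_kernel \<gamma> (X n)) f x - f x)) \<longlonglongrightarrow> 0"
proof -
  define T where "T n = symmetric_kernel.operator Rplus (laguerre_exp_kernel \<gamma> (X n))" for n
  define C B where "C n = exp (- 2 * X n) * cosh (2 * X n) powr (- real CARD('n) / 2)"
    and "B n = exp (- 2 * X n) * (4 * sqrt (2 / pi) / sqrt (sinh (2 * X n))) ^ CARD('n)" for n
  have \<gamma>': "\<gamma> $ i \<ge> -1/2" for i using \<gamma>[of i] by auto
  have m1: "(\<Prod>i\<in>UNIV. laguerre_mass (\<gamma> $ i)) = 1" using \<gamma> by (intro prod.neutral) (auto simp: laguerre_mass_def)
  have sk: "symmetric_kernel Rplus (laguerre_exp_kernel \<gamma> (X n)) (C n) (B n)" for n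
    using symmetric_kernel_laguerre[OF \<gamma>' X(1)] unfolding C_def B_def m1 by simp
  have C1: "C n \<le> 1" for n unfolding C_def using exp_kernel_mass_less_1[OF X(1)] by (rule less_imp_le)
  have dom: "g \<in> symmetric_kernel.operator_domain Rplus (laguerre_exp_kernel \<gamma> (X n))" if "g \<in> Lp Rplus 2" for g n
    using symmetric_kernel.operator_Lp(1)[OF sk _ that] by simp
  have sq: "sqnorm Rplus (T n g) \<le> sqnorm Rplus g" if g: "g \<in> Lp Rplus 2" for g n
  proof (rule sqnorm_le_of_Lp_norm_le)
    show "T n g \<in> Lp Rplus 2" unfolding T_def using symmetric_kernel.operator_Lp(2)[OF sk _ g] by simp
    have "Lp_norm Rplus 2 (T n g) \<le> ennreal (C n) * Lp_norm Rplus 2 g"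
      unfolding T_def using symmetric_kernel.operator_Lp(3)[OF sk _ g] by simp
    also have "\<dots> \<le> 1 * Lp_norm Rplus 2 g" using C1 by (intro mult_right_mono) auto
    finally show "Lp_norm Rplus 2 (T n g) \<le> Lp_norm Rplus 2 g" by simp
  qed (rule g)
  have Tm: "T n g \<in> borel_measurable Rplus" if "g \<in> Lp Rplus 2" for g n
    unfolding T_def by (rule symmetric_kernel.measurable_operator[OF sk Lp_measurable[OF that]])
  have lin: "T n (\<lambda>x. a * g x + b * h x) x = a * T n g x + b * T n h x"
    if "g \<in> Lp Rplus 2" "h \<in> Lp Rplus 2" "x \<in> space Rplus" for n g h a b x
    unfolding T_def by (rule symmetric_kernel.operator_linear[OF sk dom[OF that(1)] dom[OF that(2)] that(3)])
  interpret L2_contractions Rplus T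
  proof
    fix n :: nat and g h :: "real ^ 'n \<Rightarrow> real" assume gh: "g \<in> Lp Rplus 2" "h \<in> Lp Rplus 2"
    show "AE x in Rplus. T n (\<lambda>x. a * g x + b * h x) x = a * T n g x + b * T n h x" for a b
      using lin[OF gh] by (intro AE_I2)
    assume ae: "AE x in Rplus. g x = h x"
    show "AE x in Rplus. T n g x = T n h x"
      unfolding T_def
      by (rule AE_I2, rule symmetric_kernel.operator_AE_cong[OF sk Lp_measurable[OF gh(1)] Lp_measurable[OF gh(2)] ae])
  qed (use Tm sq in auto)
  have open_conv: "conv (indicator U)"
    if U: "open U" "U \<subseteq> space Rplus" "emeasure Rplus U < \<infinity>" for U :: "(real ^ 'n) set"
    unfolding conv_def
  proof (rule tendsto_sandwich[OF _ _ tendsto_const])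
    have Um [measurable]: "U \<in> sets Rplus" using U by (simp add: sets_Rplus_iff space_Rplus)
    note UL = indicator_in_Lp_two[OF Um U(3)]
    note [measurable] = Tm[OF UL]
    have b: "AE y in Rplus. \<bar>indicator U y :: real\<bar> \<le> 1" by (auto simp: indicator_def)
    have T01: "0 \<le> T n (indicator U) x \<and> T n (indicator U) x \<le> 1" if x: "x \<in> space Rplus" for n x
    proof -
      have "\<bar>T n (indicator U) x\<bar> \<le> C n * \<bar>1\<bar>"
        unfolding T_def using symmetric_kernel.bounded_in_operator_domain(2)[OF sk _ b x] by simp
      moreover have "0 \<le> T n (indicator U) x"
        unfolding T_def by (rule symmetric_kernel.operator_nonneg[OF sk _ x]) simp
      ultimately show ?thesis using C1[of n] by simp
    qed
    have "sqnorm Rplus (\<lambda>x. T n (indicator U) x - indicator U x) \<le> 2 * (\<integral>\<^sup>+x\<in>U. ennreal (1 - T n (indicator U) x) \<partial>Rplus)" for n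
      by (rule sqnorm_operator_indicator_le[OF Tm[OF UL] Um U(3) sq[OF UL] T01])
    then show "\<forall>\<^sub>F n in sequentially. sqnorm Rplus (\<lambda>x. T n (indicator U) x - indicator U x) \<le> 2 * (\<integral>\<^sup>+x\<in>U. ennreal (1 - T n (indicator U) x) \<partial>Rplus)"
      by simp
    have "(\<lambda>n. (\<integral>\<^sup>+x. ennreal (1 - T n (indicator U) x) * indicator U x \<partial>Rplus)) \<longlonglongrightarrow> (\<integral>\<^sup>+x. 0 \<partial>(Rplus :: (real ^ 'n) measure))"
    proof (rule nn_integral_dominated_convergence[where w="indicator U"])
      show "AE x in Rplus. ennreal (1 - T n (indicator U) x) * indicator U x \<le> indicator U x" for n
        using T01 by (intro AE_I2) (auto simp: indicator_def)
      show "AE x in Rplus. (\<lambda>n. ennreal (1 - T n (indicator U) x) * indicator U x) \<longlonglongrightarrow> 0"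
      proof (rule AE_I2)
        fix x :: "real ^ 'n"
        show "(\<lambda>n. ennreal (1 - T n (indicator U) x) * indicator U x) \<longlonglongrightarrow> 0"
        proof (cases "x \<in> U")
          case True
          have "(\<lambda>n. T n (indicator U) x) \<longlonglongrightarrow> 1"
            using operator_indicator_tendsto[OF \<gamma> U(1,2) True] X unfolding T_def
            by (auto simp: tendsto_at_iff_sequentially o_def)
          then have "(\<lambda>n. ennreal (1 - T n (indicator U) x)) \<longlonglongrightarrow> ennreal (1 - 1)"
            by (intro tendsto_ennrealI tendsto_intros)
          with True show ?thesis by simp
        qed simp
      qed
      show "(\<integral>\<^sup>+x. indicator U x \<partial>Rplus) < \<infinity>" using U(3) Um by simp
    qed measurable
    then have "(\<lambda>n. 2 * (\<integral>\<^sup>+x. ennreal (1 - T n (indicator U) x) * indicator U x \<partial>Rplus)) \<longlonglongrightarrow> 2 * 0"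
      by (intro ennreal_tendsto_cmult) auto
    then show "(\<lambda>n. 2 * (\<integral>\<^sup>+x\<in>U. ennreal (1 - T n (indicator U) x) \<partial>Rplus)) \<longlonglongrightarrow> 0" by simp
  qed simp
  \<comment> \<open>Outer regularity of Lebesgue measure. The open set is cut down to the orthant,
    which is itself open, so that it belongs to the space of \<open>Rplus\<close>.\<close>
  have approx: "\<exists>U. open U \<and> A \<subseteq> U \<and> U \<subseteq> space Rplus \<and> emeasure Rplus U < \<infinity> \<and> emeasure Rplus (U - A) \<le> ennreal e"
    if A: "A \<in> sets Rplus" "emeasure Rplus A < \<infinity>" and e: "e > 0" for A :: "(real ^ 'n) set" and e
  proof -
    have Ab: "A \<in> sets borel" "A \<subseteq> space Rplus" using A by (auto simp: sets_Rplus_iff space_Rplus)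
    obtain V where V: "open V" "A \<subseteq> V" "V - A \<in> lmeasurable" "emeasure lebesgue (V - A) < ennreal e"
      using sets_lebesgue_outer_open[of A e] Ab e by (auto simp: sets_completionI_sets)
    define U where "U = V \<inter> space Rplus"
    have U: "open U" "A \<subseteq> U" "U \<subseteq> space Rplus"
      using V Ab Rplus_set_open[where 'n='n] by (auto simp: U_def space_Rplus)
    have Um: "U \<in> sets Rplus" using U by (simp add: sets_Rplus_iff space_Rplus)
    have "emeasure Rplus (U - A) = emeasure lborel (U - A)" using Um A by (intro emeasure_Rplus) auto
    also have "\<dots> \<le> emeasure lborel (V - A)" using V Ab by (intro emeasure_mono) (auto simp: U_def)
    also have "\<dots> = emeasure lebesgue (V - A)"     proof -
      have "V - A \<in> sets lborel" using V Ab by auto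
      then show ?thesis by simp
    qed
    also have "\<dots> \<le> ennreal e" using V(4) by (rule less_imp_le)
    finally have UA: "emeasure Rplus (U - A) \<le> ennreal e" .
    have "emeasure Rplus U = emeasure Rplus (A \<union> (U - A))" using U by (auto intro: arg_cong[where f="emeasure Rplus"])
    also have "\<dots> \<le> emeasure Rplus A + emeasure Rplus (U - A)" using A Um by (intro emeasure_subadditive) auto
    also have "\<dots> < \<infinity>" using A UA by (simp add: le_less_trans[OF UA])
    finally show ?thesis using U UA by blast
  qed
  have "conv (indicator A)" if A: "A \<in> sets Rplus" "emeasure Rplus A < \<infinity>" for A :: "(real ^ 'n) set"
  proof (rule conv_approx[OF indicator_in_Lp_two[OF A]])
    fix e :: real assume "e > 0"
    then obtain U where U: "open U" "A \<subseteq> U" "U \<subseteq> space Rplus" "emeasure Rplus U < \<infinity>" and UA: "emeasure Rplus (U - A) \<le> ennreal e"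
      using approx[OF A, of e] by auto
    have Um: "U \<in> sets Rplus" using U by (simp add: sets_Rplus_iff space_Rplus)
    have "sqnorm Rplus (\<lambda>x. indicator A x - indicator U x) = sqnorm Rplus (\<lambda>x. -1 * indicator (U - A) x)"
      using U(2) by (intro arg_cong[where f="sqnorm Rplus"] ext) (auto simp: indicator_def)
    also have "\<dots> \<le> ennreal e" using UA by (subst sqnorm_cmult_indicator) (auto simp: A Um)
    finally show "\<exists>h\<in>Lp Rplus 2. conv h \<and> sqnorm Rplus (\<lambda>x. indicator A x - h x) \<le> ennreal e"
      using open_conv[OF U(1,3,4)] indicator_in_Lp_two[OF Um U(4)] by blast
  qed
  from conv_all[OF this f, unfolded conv_def T_def] show ?thesis by (rule Lp_norm_two_tendsto_0)
qed

section \<open>Failure of contractivity\<close>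

lemma sinh_ge_self: "0 \<le> x \<Longrightarrow> x \<le> sinh (x::real)"
proof -
  assume x: "0 \<le> x"
  have "sinh 0 - 0 \<le> sinh x - x"
  proof (rule DERIV_nonneg_imp_nondecreasing[OF x])
    fix u :: real
    show "\<exists>y. ((\<lambda>u. sinh u - u) has_real_derivative y) (at u) \<and> y \<ge> 0"
      by (rule exI[of _ "cosh u - 1"]) (auto intro!: derivative_eq_intros simp: cosh_real_ge_1)
  qed
  then show ?thesis by simp
qed

lemma one_minus_power_ge: "a \<le> 1 \<Longrightarrow> 1 - real n * a \<le> (1 - a) ^ n"
  using Bernoulli_inequality[of "- a" n] by simp

text \<open>The test function is the indicator of a bounded box, so it lies in L^2 as well as in
  L^\<infinity>. Its image exceeds 1 on a smaller open box: the exceptional coordinate is near 0 and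
  gains mass, while the others lie between 1 and 2 and lose little.\<close>

lemma modified_laguerre_not_Lp_contractive:
  fixes \<alpha> :: "real ^ 'n"
  assumes \<gamma>: "\<And>i. (\<alpha> + axis j 1) $ i \<ge> -1/2"
    and b: "-1/2 < (\<alpha> + axis j 1) $ b" "(\<alpha> + axis j 1) $ b < 1/2"
  shows "\<not> Lp_contractive Rplus (modified_laguerre \<alpha> j)"
proof
  assume contr: "Lp_contractive Rplus (modified_laguerre \<alpha> j)"
  define \<gamma>' where "\<gamma>' = \<alpha> + axis j 1"
  note \<gamma> = \<gamma>[folded \<gamma>'_def] and b = b[folded \<gamma>'_def]
  let ?m = "\<lambda>i t x A. (\<integral>\<^sup>+u\<in>A. ennreal (laguerre_kernel1 (\<gamma>' $ i) t x u) \<partial>lborel)"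
  have "\<forall>i. \<exists>A\<ge>0. \<forall>t x. t > 0 \<longrightarrow> A * sinh (2 * t) \<le> 1 \<longrightarrow> 1 \<le> x \<longrightarrow> x \<le> 2 \<longrightarrow>
      ennreal (1 - A * sinh (2 * t)) \<le> ?m i t x {1/2<..<5/2}" (is "\<forall>i. \<exists>A. ?Q i A")
  proof
    fix i
    show "\<exists>A. ?Q i A" by (rule laguerre_kernel1_mass_loss[OF \<gamma>[of i]]) blast
  qed
  then have "\<exists>A. \<forall>i. ?Q i (A i)" by (rule choice)
  then obtain A where "\<forall>i. ?Q i (A i)" ..
  then have A: "\<And>i. A i \<ge> 0" "\<And>i t x. \<lbrakk>t > 0; A i * sinh (2 * t) \<le> 1; 1 \<le> x; x \<le> 2\<rbrakk> \<Longrightarrow>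
      ennreal (1 - A i * sinh (2 * t)) \<le> ?m i t x {1/2<..<5/2}" by auto
  define A' where "A' = (\<Sum>i\<in>UNIV. A i)"
  have A': "A' \<ge> 0" "A i \<le> A'" for i
    using A(1) by (auto simp: A'_def intro: sum_nonneg member_le_sum)
  \<comment> \<open>\<open>c * S\<close> majorizes all first-order losses: CARD('n) * A' from the
    coordinates and 1 from exp (- 2 t). The gain is then requested at rate c + 1, which is possible
    because c does not depend on \<open>x0\<close>.\<close>
  define c where "c = real CARD('n) * A' + 1"
  have c: "c \<ge> 1" using A' by (simp add: c_def)
  obtain x0 where x0: "x0 > 0" and gain: "\<forall>\<^sub>F S in at_right 0. \<forall>t>0. sinh (2 * t) = S \<longrightarrow> (\<forall>x. x0 \<le> x \<longrightarrow> x \<le> 2 * x0 \<longrightarrow>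
      ennreal (1 + (c + 1) * S) \<le> ?m b t x {x0 / 2<..<3 * x0})"
    using laguerre_kernel1_mass_gain[OF b, of "c + 1"] by blast
  have "\<forall>\<^sub>F S in at_right (0::real). 0 < S \<and> S < 1 / (c * (c + 1))"
    using c by (auto simp: eventually_at_right_field intro!: exI[of _ "1 / (c * (c + 1))"])
  with gain have "\<forall>\<^sub>F S in at_right 0. (0 < S \<and> S < 1 / (c * (c + 1))) \<and> (\<forall>t>0. sinh (2 * t) = S \<longrightarrow> (\<forall>x. x0 \<le> x \<longrightarrow> x \<le> 2 * x0 \<longrightarrow>
      ennreal (1 + (c + 1) * S) \<le> ?m b t x {x0 / 2<..<3 * x0}))"
    by eventually_elim blast
  then obtain S where S: "0 < S" "S < 1 / (c * (c + 1))" and gain: "\<And>t x. \<lbrakk>t > 0; sinh (2 * t) = S; x0 \<le> x; x \<le> 2 * x0\<rbrakk> \<Longrightarrow>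
      ennreal (1 + (c + 1) * S) \<le> ?m b t x {x0 / 2<..<3 * x0}"
    using eventually_happens'[OF trivial_limit_at_right_real] by blast
  \<comment> \<open>The estimates are phrased in S = sinh 2t, so S is chosen first and t recovered
    from it.\<close>
  define t where "t = arsinh S / 2"
  have t: "t > 0" "sinh (2 * t) = S" using S by (auto simp: t_def)
  have cS2: "c * (c + 1) * S < 1"
  proof -
    have "0 < c * (c + 1)" using c by simp
    with S(2) show ?thesis by (simp only: pos_less_divide_eq mult.commute)
  qed
  have cS: "c * S \<le> 1"
  proof -
    have "c * S * 1 \<le> c * S * (c + 1)" using c S by (intro mult_left_mono) auto
    with cS2 show ?thesis by (simp add: mult_ac)
  qed
  have AS: "A' * S \<le> 1"
  proof -
    have "A' * 1 \<le> A' * real CARD('n)" using A' by (intro mult_left_mono) (auto simp: Suc_le_eq)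
    then have "A' \<le> c" by (simp add: c_def mult.commute)
    then have "A' * S \<le> c * S" using S by (intro mult_right_mono) auto
    with cS show ?thesis by simp
  qed
  interpret symmetric_kernel Rplus "laguerre_exp_kernel \<gamma>' t"
      "(\<Prod>i\<in>UNIV. laguerre_mass (\<gamma>' $ i)) * exp (- 2 * t) * cosh (2 * t) powr (- real CARD('n) / 2)"
      "exp (- 2 * t) * (4 * sqrt (2 / pi) / sqrt (sinh (2 * t))) ^ CARD('n)"
    by (rule symmetric_kernel_laguerre[OF \<gamma> t(1)])
  have Top: "modified_laguerre \<alpha> j t = operator"
    unfolding \<gamma>'_def by (rule modified_laguerre_eq_operator) (use \<gamma> t in \<open>auto simp: \<gamma>'_def\<close>)
  \<comment> \<open>The windows of the two one-dimensional mass lemmas; \<open>Q\<close> below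
    consists of the points x for which these windows are valid.\<close>
  define J where "J i = (if i = b then {x0 / 2<..<3 * x0} else {1/2<..<5/2})" for i
  define P where "P = {y :: real ^ 'n. \<forall>i. y $ i \<in> J i}"
  define Q where "Q = {x :: real ^ 'n. \<forall>i. x $ i \<in> (if i = b then {x0<..<2 * x0} else {1<..<2})}"
  have open_box: "open {x :: real ^ 'n. \<forall>i. x $ i \<in> (if i = b then {l<..<u} else {l'<..<u'})}" for l u l' u' :: real
  proof -
    have "{x :: real ^ 'n. \<forall>i. x $ i \<in> (if i = b then {l<..<u} else {l'<..<u'})} =
      (\<Inter>i. {x. (if i = b then l else l') < x $ i} \<inter> {x. x $ i < (if i = b then u else u')})"
    proof -
      have "v \<in> (if i = b then {l<..<u} else {l'<..<u'}) \<longleftrightarrow> (if i = b then l else l') < v \<and> v < (if i = b then u else u')"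
        for v i by simp
      then show ?thesis by blast
    qed
    then show ?thesis by (auto intro!: open_INT open_Int open_Collect_less continuous_intros)
  qed
  have Psub: "P \<subseteq> space Rplus"
  proof
    fix y assume y: "y \<in> P"
    have "0 < y $ i" for i
    proof -
      have "y $ i \<in> J i" using y by (simp add: P_def)
      then show ?thesis using x0 by (auto simp: J_def split: if_splits)
    qed
    then show "y \<in> space Rplus" by (simp add: space_Rplus)
  qed
  have Qsub: "Q \<subseteq> space Rplus"
  proof
    fix y assume y: "y \<in> Q"
    have "0 < y $ i" for i
    proof -
      have "y $ i \<in> (if i = b then {x0<..<2 * x0} else {1<..<2})" using y by (simp add: Q_def)
      then show ?thesis using x0 by (auto split: if_splits)
    qed
    then show "y \<in> space Rplus" by (simp add: space_Rplus)
  qed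
  have "open P" unfolding P_def J_def by (rule open_box)
  then have Pm [measurable]: "P \<in> sets Rplus" using Psub by (simp add: sets_Rplus_iff space_Rplus)
  have "emeasure Rplus P < \<infinity>"
  proof -
    have "P \<subseteq> cbox 0 (\<chi> i. 3 * x0 + 3)"
    proof
      fix y assume y: "y \<in> P"
      have "0 \<le> y $ i \<and> y $ i \<le> 3 * x0 + 3" for i
      proof -
        have "y $ i \<in> J i" using y by (simp add: P_def)
        then show ?thesis using x0 by (auto simp: J_def split: if_splits)
      qed
      then show "y \<in> cbox 0 (\<chi> i. 3 * x0 + 3)" by (simp add: mem_box_cart)
    qed
    then have "emeasure lborel P \<le> emeasure lborel (cbox 0 (\<chi> i::'n. 3 * x0 + 3))" by (intro emeasure_mono) auto
    also have "\<dots> < \<infinity>" by (rule emeasure_lborel_cbox_finite)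
    finally show ?thesis using emeasure_Rplus[OF Pm] by simp
  qed
  then have P2: "(indicator P :: _ \<Rightarrow> real) \<in> Lp Rplus 2" by (rule indicator_in_Lp_two[OF Pm])
  have "esssup Rplus (\<lambda>x. ennreal \<bar>indicator P x\<bar>) \<le> ennreal 1"
    by (intro esssup_I AE_I2) (auto simp: indicator_def)
  then have norm1: "Lp_norm Rplus \<infinity> (indicator P) \<le> 1" by (simp add: Lp_norm_def)
  then have "(indicator P :: _ \<Rightarrow> real) \<in> Lp Rplus \<infinity>" by (auto simp: Lp_def le_less_trans)
  with P2 contr t have "Lp_norm Rplus \<infinity> (operator (indicator P)) \<le> Lp_norm Rplus \<infinity> (indicator P)"
    unfolding Lp_contractive_def Top[symmetric] by (auto dest!: spec[of _ "\<infinity>"] spec[of _ t])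
  then have le1: "esssup Rplus (\<lambda>x. ennreal \<bar>operator (indicator P) x\<bar>) \<le> 1"
    using norm1 by (simp add: Lp_norm_def)
  have ae: "AE x in Rplus. ennreal \<bar>operator (indicator P) x\<bar> \<le> 1"
    by (rule AE_mp[OF esssup_AE], rule AE_I2, rule impI, erule order_trans[OF _ le1])
  have big: "\<not> ennreal \<bar>operator (indicator P) x\<bar> \<le> 1" if x: "x \<in> Q" for x
  proof
    assume le1: "ennreal \<bar>operator (indicator P) x\<bar> \<le> 1"
    have x': "x \<in> space Rplus" using x Qsub by auto
    have Qi: "x $ i \<in> (if i = b then {x0<..<2 * x0} else {1<..<2})" for i using x by (simp add: Q_def)
    have int: "integrable Rplus (\<lambda>y. laguerre_exp_kernel \<gamma>' t x y * indicator P y)"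
      using operator_Lp(1)[OF _ P2] x' by (simp add: operator_domain_def)
    have lower: "ennreal (if i = b then 1 + (c + 1) * S else 1 - A' * S) \<le> ?m i t (x $ i) (J i \<inter> {0<..})" for i
    proof (cases "i = b")
      case True
      have "J i \<inter> {0<..} = {x0 / 2<..<3 * x0}" using True x0 by (auto simp: J_def)
      then show ?thesis using True gain[OF t, of "x $ b"] Qi[of b] by simp
    next
      case False
      have "J i \<inter> {0<..} = {1/2<..<5/2}" using False by (auto simp: J_def)
      moreover have Ai: "A i * S \<le> A' * S" using A'(2)[of i] S by (intro mult_right_mono) auto
      moreover have "ennreal (1 - A i * S) \<le> ?m i t (x $ i) {1/2<..<5/2}"
        using A(2)[OF t(1), of i "x $ i"] Qi[of i] False Ai AS unfolding t(2) by simp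
      ultimately show ?thesis using False
        by simp (rule order_trans[OF ennreal_leI], auto)
    qed
    \<comment> \<open>The product equals 1 + S - c (c + 1) S^2, and S was taken below 1 / (c (c +
      1)).\<close>
    have "1 < (1 - c * S) * (1 + (c + 1) * S)"
    proof -
      have "(c * (c + 1) * S) * S < 1 * S" using cS2 S by (intro mult_strict_right_mono) auto
      then show ?thesis by (simp add: algebra_simps)
    qed
    \<comment> \<open>The linear loss is split into the share of exp (- 2 t) and that of the
      coordinates by dropping a nonnegative product; Bernoulli's inequality then passes to the
      power.\<close>
    also have "1 - c * S \<le> (1 - S) * (1 - (real CARD('n) * A') * S)"
      using S A' by (simp add: c_def algebra_simps)
    also have "\<dots> \<le> exp (- 2 * t) * (1 - A' * S) ^ (CARD('n) - 1)"
    proof (rule mult_mono)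
      have "1 - S \<le> 1 + (- 2 * t)" using sinh_ge_self[of "2 * t"] t by simp
      also have "\<dots> \<le> exp (- 2 * t)" by (rule exp_ge_add_one_self)
      finally show "1 - S \<le> exp (- 2 * t)" .
      have "real (CARD('n) - 1) * (A' * S) \<le> real CARD('n) * (A' * S)"
        using A' S by (intro mult_right_mono) auto
      then have "1 - real CARD('n) * A' * S \<le> 1 - real (CARD('n) - 1) * (A' * S)" by simp
      also have "\<dots> \<le> (1 - A' * S) ^ (CARD('n) - 1)" by (rule one_minus_power_ge[OF AS])
      finally show "1 - real CARD('n) * A' * S \<le> (1 - A' * S) ^ (CARD('n) - 1)" .
      have "c * S = real CARD('n) * A' * S + S" by (simp add: c_def algebra_simps)
      with cS S show "0 \<le> 1 - real CARD('n) * A' * S" by simp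
    qed simp
    finally have "1 < exp (- 2 * t) * (1 - A' * S) ^ (CARD('n) - 1) * (1 + (c + 1) * S)"
      using S c by (simp add: mult_right_mono)
    also have "\<dots> = exp (- 2 * t) * (\<Prod>i\<in>UNIV. if i = b then 1 + (c + 1) * S else 1 - A' * S)"
    proof -
      have "(\<Prod>i\<in>UNIV. if i = b then 1 + (c + 1) * S else 1 - A' * S) =
        (1 + (c + 1) * S) * (\<Prod>i\<in>UNIV - {b}. if i = b then 1 + (c + 1) * S else 1 - A' * S)"
        by (subst prod.remove[of _ b]) auto
      also have "(\<Prod>i\<in>UNIV - {b}. if i = b then 1 + (c + 1) * S else 1 - A' * S) = (1 - A' * S) ^ (CARD('n) - 1)"
        by (subst prod.cong[OF refl, of _ _ "\<lambda>_. 1 - A' * S"]) (auto simp: card_Diff_singleton)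
      finally show ?thesis by simp
    qed
    finally have "ennreal 1 < ennreal (exp (- 2 * t) * (\<Prod>i\<in>UNIV. if i = b then 1 + (c + 1) * S else 1 - A' * S))"
      by (intro ennreal_lessI) auto
    also have "\<dots> = ennreal (exp (- 2 * t)) * (\<Prod>i\<in>UNIV. ennreal (if i = b then 1 + (c + 1) * S else 1 - A' * S))"
      using AS S c by (subst prod_ennreal) (auto simp: ennreal_mult')
    also have "\<dots> \<le> ennreal (exp (- 2 * t)) * (\<Prod>i\<in>UNIV. ?m i t (x $ i) (J i \<inter> {0<..}))"
      by (intro mult_left_mono prod_mono_ennreal lower) simp
    also have "\<dots> = (\<integral>\<^sup>+y. ennreal (laguerre_exp_kernel \<gamma>' t x y) * indicator P y \<partial>Rplus)"
      unfolding P_def by (rule nn_integral_laguerre_exp_kernel[OF \<gamma> t(1) x', symmetric]) (simp add: J_def)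
    also have "\<dots> = (\<integral>\<^sup>+y. ennreal (laguerre_exp_kernel \<gamma>' t x y * indicator P y) \<partial>Rplus)"
      by (intro nn_integral_cong) (auto simp: indicator_def)
    also have "\<dots> = ennreal (operator (indicator P) x)"
      unfolding operator_def using int x' by (intro nn_integral_eq_integral) (auto simp: kernel_nonneg)
    also have "\<dots> \<le> ennreal \<bar>operator (indicator P) x\<bar>" by (intro ennreal_leI) simp
    finally show False using le1 by simp
  qed
  show False
  proof (rule not_AE_Rplus_open[OF _ _ Qsub ae big])
    show "open Q" unfolding Q_def by (rule open_box)
    have "(\<chi> i. if i = b then 3 / 2 * x0 else 3 / 2) \<in> Q" using x0 by (simp add: Q_def)
    then show "Q \<noteq> {}" by blast
  qed
qed

section \<open>Submarkovian and non-Markovian properties; conclusion\<close>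

lemma modified_laguerre_diffusion_semigroup:
  fixes \<alpha> :: "real ^ 'n"
  assumes \<gamma>: "\<And>i. (\<alpha> + axis j 1) $ i = -1/2 \<or> (\<alpha> + axis j 1) $ i \<ge> 1/2"
  shows "submarkovian_diffusion_semigroup Rplus (modified_laguerre \<alpha> j)"
proof -
  define \<gamma>' where "\<gamma>' = \<alpha> + axis j 1"
  note \<gamma> = \<gamma>[folded \<gamma>'_def]
  have \<gamma>0: "\<gamma>' $ i \<ge> -1/2" for i using \<gamma>[of i] by auto
  define K where "K = laguerre_exp_kernel \<gamma>'"
  define C B where "C t = exp (- 2 * t) * cosh (2 * t) powr (- real CARD('n) / 2)"
    and "B t = exp (- 2 * t) * (4 * sqrt (2 / pi) / sqrt (sinh (2 * t))) ^ CARD('n)" for t :: real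
  let ?T = "modified_laguerre \<alpha> j" and ?M = "Rplus :: (real ^ 'n) measure"
  have m1: "(\<Prod>i\<in>UNIV. laguerre_mass (\<gamma>' $ i)) = 1" using \<gamma> by (intro prod.neutral) (auto simp: laguerre_mass_def)
  have sk: "symmetric_kernel ?M (K t) (C t) (B t)" if "t > 0" for t
    using symmetric_kernel_laguerre[OF \<gamma>0 that] unfolding K_def C_def B_def m1 by simp
  have C1: "C t < 1" if "t > 0" for t unfolding C_def by (rule exp_kernel_mass_less_1[OF that])
  have Top: "?T t = symmetric_kernel.operator ?M (K t)" if "t > 0" for t
    unfolding K_def \<gamma>'_def by (rule modified_laguerre_eq_operator[OF _ that]) (use \<gamma>0 in \<open>simp add: \<gamma>'_def\<close>)
  have T0: "?T 0 f = f" for f by (simp add: modified_laguerre_def)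
  \<comment> \<open>One space for all times: the intersection of the domains over t > 0. It is
    linear and contains every L^p, since each single domain does.\<close>
  define D where "D = {f \<in> borel_measurable ?M. \<forall>t>0. f \<in> symmetric_kernel.operator_domain ?M (K t)}"
  have LpD: "Lp ?M p \<subseteq> D" if "p \<ge> 1" for p
    using symmetric_kernel.operator_Lp(1)[OF sk that] by (auto simp: D_def Lp_def)
  have contr: "?T t f \<in> Lp ?M p \<and> Lp_norm ?M p (?T t f) \<le> Lp_norm ?M p f"
    if p: "p \<ge> 1" and f: "f \<in> Lp ?M p" and t: "t \<ge> 0" for p f t
  proof (cases "t = 0")
    case False
    with t have t: "t > 0" by simp
    have "Lp_norm ?M p (?T t f) \<le> ennreal (C t) * Lp_norm ?M p f"
      unfolding Top[OF t] by (rule symmetric_kernel.operator_Lp(3)[OF sk[OF t] p f])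
    also have "\<dots> \<le> 1 * Lp_norm ?M p f" using C1[OF t] by (intro mult_right_mono) auto
    finally show ?thesis
      using symmetric_kernel.operator_Lp(2)[OF sk[OF t] p f] unfolding Top[OF t] by simp
  qed (use T0 f in simp)
  have semigroup: "?T (s + t) f x = ?T s (?T t f) x"
    if p: "p \<ge> 1" and f: "f \<in> Lp ?M p" and s: "s \<ge> 0" and t: "t \<ge> 0" and x: "x \<in> space ?M" for p f s t x
  proof (cases "s = 0 \<or> t = 0")
    case False
    with s t have st: "s > 0" "t > 0" "s + t > 0" by auto
    show ?thesis unfolding Top[OF st(1)] Top[OF st(2)] Top[OF st(3)]
    proof (rule symmetric_kernel_compose[OF sk[OF st(1)] sk[OF st(2)] sk[OF st(3)] _ _ x])
      show "(\<integral>\<^sup>+z. ennreal (K s x z * K t z y) \<partial>?M) = ennreal (K (s + t) x y)"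
        if "x \<in> space ?M" "y \<in> space ?M" for x y
        unfolding K_def by (rule laguerre_exp_kernel_chapman_kolmogorov[OF \<gamma>0 st(1,2) that])
      show "f \<in> symmetric_kernel.operator_domain ?M (K (s + t))"
        using LpD[OF p] f st by (auto simp: D_def)
    qed
  qed (auto simp: T0)
  have "symmetric_diffusion_semigroup_on ?M D ?T"
    unfolding symmetric_diffusion_semigroup_on_def
  proof (intro conjI allI ballI impI)
    show "sigma_finite_measure ?M" by (rule sigma_finite_Rplus)
    show "D \<subseteq> borel_measurable ?M" by (auto simp: D_def)
    show "Lp ?M p \<subseteq> D" if "p \<ge> 1" for p by (rule LpD[OF that])
    show "AE x in ?M. ?T 0 f x = f x" for f by (simp add: T0)
    show "(\<lambda>x. a * f x + b * g x) \<in> D" if "f \<in> D" "g \<in> D" for f g a b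
      using that symmetric_kernel.operator_domain_linear[OF sk] by (auto simp: D_def)
    show "?T t f \<in> borel_measurable ?M" if "t \<ge> 0" "f \<in> D" for t f
      using that symmetric_kernel.measurable_operator[OF sk, of t f] Top[of t] T0
      by (cases "t = 0") (auto simp: D_def)
    show "AE x in ?M. ?T t f x = ?T t g x" if "t \<ge> 0" "f \<in> D" "g \<in> D" "AE x in ?M. f x = g x" for t f g
    proof (cases "t = 0")
      case False
      with that have "t > 0" by simp
      show ?thesis unfolding Top[OF \<open>t > 0\<close>]
        by (rule AE_I2, rule symmetric_kernel.operator_AE_cong[OF sk[OF \<open>t > 0\<close>] _ _ that(4)])
          (use that in \<open>auto simp: D_def\<close>)
    qed (use that T0 in simp)
    show "AE x in ?M. ?T t (\<lambda>x. a * f x + b * g x) x = a * ?T t f x + b * ?T t g x" if "t \<ge> 0" "f \<in> D" "g \<in> D" for t f g a b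
    proof (cases "t = 0")
      case False
      with that have "t > 0" by simp
      with that show ?thesis unfolding Top[OF \<open>t > 0\<close>]
        by (intro AE_I2 symmetric_kernel.operator_linear[OF sk]) (auto simp: D_def)
    qed (use T0 in simp)
    show "?T t f \<in> Lp ?M p" "Lp_norm ?M p (?T t f) \<le> Lp_norm ?M p f" if "1 \<le> p" "f \<in> Lp ?M p" "t \<ge> 0" for p f t
      using contr[OF that] by auto
    show "AE x in ?M. ?T (s + t) f x = ?T s (?T t f) x" if "1 \<le> p" "f \<in> Lp ?M p" "s \<ge> 0" "t \<ge> 0" for p f s t
      using semigroup[OF that] by (rule AE_I2)
    show "(LINT x|?M. ?T t f x * g x) = (LINT x|?M. f x * ?T t g x)" if "t \<ge> 0" "f \<in> Lp ?M 2" "g \<in> Lp ?M 2" for t f g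
    proof (cases "t = 0")
      case False
      with that have t: "t > 0" by simp
      show ?thesis unfolding Top[OF t] by (rule symmetric_kernel.operator_selfadjoint[OF sk[OF t] that(2,3)])
    qed (simp add: T0)
    show "((\<lambda>t. Lp_norm ?M 2 (\<lambda>x. ?T t f x - f x)) \<longlongrightarrow> 0) (at_right 0)" if f: "f \<in> Lp ?M 2" for f
      unfolding tendsto_at_iff_sequentially
    proof (intro allI impI)
      fix X :: "nat \<Rightarrow> real" assume X: "\<forall>i. X i \<in> {0<..} - {0}" "X \<longlonglongrightarrow> 0"
      then have X0: "X n > 0" for n by auto
      have "(\<lambda>n. Lp_norm ?M 2 (\<lambda>x. ?T (X n) f x - f x)) \<longlonglongrightarrow> 0"
        unfolding Top[OF X0] K_def by (rule laguerre_L2_continuity[OF \<gamma> X0 X(2) f])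
      then show "((\<lambda>t. Lp_norm ?M 2 (\<lambda>x. ?T t f x - f x)) \<circ> X) \<longlonglongrightarrow> 0" by (simp add: o_def)
    qed
  qed
  moreover have "positivity_preserving_on ?M D ?T"
    unfolding positivity_preserving_on_def
  proof (intro allI ballI impI)
    fix t f assume tf: "(0::real) \<le> t" "f \<in> D" "AE x in ?M. 0 \<le> f x"
    show "AE x in ?M. 0 \<le> ?T t f x"
    proof (cases "t = 0")
      case False
      with tf have t: "t > 0" by simp
      show ?thesis unfolding Top[OF t] by (intro AE_I2 symmetric_kernel.operator_nonneg[OF sk[OF t] tf(3)])
    qed (use tf T0 in simp)
  qed
  moreover have "AE x in ?M. ?T t (\<lambda>_. 1) x \<le> 1" if "t \<ge> 0" for t
  proof (cases "t = 0")
    case False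
    with that have t: "t > 0" by simp
    have "\<bar>?T t (\<lambda>_. 1) x\<bar> \<le> C t * \<bar>1\<bar>" if "x \<in> space ?M" for x
      unfolding Top[OF t] by (rule symmetric_kernel.bounded_in_operator_domain(2)[OF sk[OF t] _ _ that]) auto
    then show ?thesis using C1[OF t] by (intro AE_I2) fastforce
  qed (simp add: T0)
  ultimately show ?thesis unfolding submarkovian_diffusion_semigroup_def by blast
qed

text \<open>At time 1 the row mass is strictly below 1 at every point, so the image of the constant
  1 is nowhere equal to 1.\<close>

lemma modified_laguerre_not_markovian:
  fixes \<alpha> :: "real ^ 'n"
  assumes \<gamma>: "\<And>i. (\<alpha> + axis j 1) $ i = -1/2 \<or> (\<alpha> + axis j 1) $ i \<ge> 1/2"
  shows "\<not> markovian_diffusion_semigroup Rplus (modified_laguerre \<alpha> j)"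
proof
  assume "markovian_diffusion_semigroup Rplus (modified_laguerre \<alpha> j)"
  then have ae: "AE x in Rplus. modified_laguerre \<alpha> j 1 (\<lambda>_. 1) x = 1"
    by (auto simp: markovian_diffusion_semigroup_def)
  have \<gamma>0: "(\<alpha> + axis j 1) $ i \<ge> -1/2" for i using \<gamma>[of i] by auto
  have m1: "(\<Prod>i\<in>UNIV. laguerre_mass ((\<alpha> + axis j 1) $ i)) = 1"
    by (intro prod.neutral ballI) (simp only: laguerre_mass_def if_P[OF \<gamma>])
  note sk = symmetric_kernel_laguerre[OF \<gamma>0, of 1, unfolded m1 mult_1_left, OF zero_less_one]
  have ne: "modified_laguerre \<alpha> j 1 (\<lambda>_. 1) x \<noteq> 1" if x: "x \<in> space Rplus" for x
  proof -
    have "\<bar>modified_laguerre \<alpha> j 1 (\<lambda>_. 1) x\<bar> \<le> (exp (- 2 * 1) * cosh (2 * 1) powr (- real CARD('n) / 2)) * \<bar>1\<bar>"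
      unfolding modified_laguerre_eq_operator[OF \<gamma>0 zero_less_one]
      by (rule symmetric_kernel.bounded_in_operator_domain(2)[OF sk _ _ x]) auto
    moreover have "exp (- 2 * 1) * cosh (2 * 1) powr (- real CARD('n) / 2) < (1::real)"
      by (rule exp_kernel_mass_less_1) simp
    ultimately show ?thesis by linarith
  qed
  show False
  proof (rule not_AE_Rplus_open[OF _ _ order_refl ae ne])
    show "open (space (Rplus :: (real ^ 'n) measure))"
      unfolding space_Rplus by (rule Rplus_set_open)
    have "(\<chi> i. 1) \<in> space (Rplus :: (real ^ 'n) measure)" by (simp add: space_Rplus)
    then show "space (Rplus :: (real ^ 'n) measure) \<noteq> {}" by blast
  qed
qed

lemma modified_laguerre_opnorm_le:
  fixes \<alpha> :: "real ^ 'n"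
  assumes \<gamma>: "\<And>i. (\<alpha> + axis j 1) $ i \<ge> -1/2" and p: "p \<ge> 1" and t: "t > 0"
  shows "Lp_opnorm Rplus p (modified_laguerre \<alpha> j t) \<le>
    ennreal ((\<Prod>i\<in>UNIV. laguerre_mass ((\<alpha> + axis j 1) $ i)) * exp (- 2 * t) * cosh (2 * t) powr (- real CARD('n) / 2))"
  unfolding modified_laguerre_eq_operator[OF \<gamma> t]
  by (rule symmetric_kernel.operator_opnorm_le[OF symmetric_kernel_laguerre[OF \<gamma> t] p])

theorem proposition4p2:
  fixes \<alpha> :: "real ^ 'n" and j :: 'n
  assumes "\<alpha> $ j \<ge> -3/2"
    and "\<And>i. i \<noteq> j \<Longrightarrow> \<alpha> $ i \<ge> -1/2"
  shows
    "(\<alpha> $ j \<in> {-3/2} \<union> {-1/2..} \<and> (\<forall>i. i \<noteq> j \<longrightarrow> \<alpha> $ i \<in> {-1/2} \<union> {1/2..}) \<longrightarrow>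
        submarkovian_diffusion_semigroup Rplus (modified_laguerre \<alpha> j) \<and>
        \<not> markovian_diffusion_semigroup Rplus (modified_laguerre \<alpha> j) \<and>
        (\<forall>p\<ge>1. \<forall>t>0. Lp_opnorm Rplus p (modified_laguerre \<alpha> j t)
            \<le> ennreal (exp (- 2 * t) * cosh (2 * t) powr (- real CARD('n) / 2)))) \<and>
     (\<alpha> $ j \<notin> {-3/2} \<union> {-1/2..} \<or> (\<exists>i. i \<noteq> j \<and> \<alpha> $ i \<notin> {-1/2} \<union> {1/2..}) \<longrightarrow>
        \<not> Lp_contractive Rplus (modified_laguerre \<alpha> j) \<and>
        (\<exists>c>1. \<forall>p\<ge>1. \<forall>t>0. Lp_opnorm Rplus p (modified_laguerre \<alpha> j t)
            \<le> ennreal (c * exp (- 2 * t) * cosh (2 * t) powr (- real CARD('n) / 2))))"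
proof -
  \<comment> \<open>The shift by the j-th unit vector moves -3/2 to -1/2 and -1/2 to 1/2 in
    coordinate j, so the conditions on \<alpha> become the same condition in every coordinate of
    \<gamma>.\<close>
  define \<gamma> where "\<gamma> = \<alpha> + axis j 1"
  have \<gamma>j: "\<gamma> $ j = \<alpha> $ j + 1" and \<gamma>i: "i \<noteq> j \<Longrightarrow> \<gamma> $ i = \<alpha> $ i" for i
    by (auto simp: \<gamma>_def axis_def)
  have \<gamma>0: "\<gamma> $ i \<ge> -1/2" for i using assms \<gamma>j \<gamma>i[of i] by (cases "i = j") auto
  define c where "c = (\<Prod>i\<in>UNIV. laguerre_mass (\<gamma> $ i))"
  have opnorm: "Lp_opnorm Rplus p (modified_laguerre \<alpha> j t) \<le> ennreal (c * exp (- 2 * t) * cosh (2 * t) powr (- real CARD('n) / 2))"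
    if "p \<ge> 1" "t > 0" for p t
    unfolding c_def \<gamma>_def by (rule modified_laguerre_opnorm_le[OF \<gamma>0[unfolded \<gamma>_def] that])
  have good: "submarkovian_diffusion_semigroup Rplus (modified_laguerre \<alpha> j) \<and>
        \<not> markovian_diffusion_semigroup Rplus (modified_laguerre \<alpha> j) \<and>
        (\<forall>p\<ge>1. \<forall>t>0. Lp_opnorm Rplus p (modified_laguerre \<alpha> j t)
            \<le> ennreal (exp (- 2 * t) * cosh (2 * t) powr (- real CARD('n) / 2)))"
    if "\<alpha> $ j \<in> {-3/2} \<union> {-1/2..} \<and> (\<forall>i. i \<noteq> j \<longrightarrow> \<alpha> $ i \<in> {-1/2} \<union> {1/2..})"
  proof -
    have \<gamma>': "\<gamma> $ i = -1/2 \<or> \<gamma> $ i \<ge> 1/2" for i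
      using that \<gamma>j \<gamma>i[of i] by (cases "i = j") auto
    have "c = 1" unfolding c_def by (intro prod.neutral ballI) (simp only: laguerre_mass_def if_P[OF \<gamma>'])
    then show ?thesis
      using modified_laguerre_diffusion_semigroup[OF \<gamma>'[unfolded \<gamma>_def]]
        modified_laguerre_not_markovian[OF \<gamma>'[unfolded \<gamma>_def]] opnorm by simp
  qed
  have bad: "\<not> Lp_contractive Rplus (modified_laguerre \<alpha> j) \<and>
        (\<exists>c>1. \<forall>p\<ge>1. \<forall>t>0. Lp_opnorm Rplus p (modified_laguerre \<alpha> j t)
            \<le> ennreal (c * exp (- 2 * t) * cosh (2 * t) powr (- real CARD('n) / 2)))"
    if h: "\<alpha> $ j \<notin> {-3/2} \<union> {-1/2..} \<or> (\<exists>i. i \<noteq> j \<and> \<alpha> $ i \<notin> {-1/2} \<union> {1/2..})"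
  proof
    \<comment> \<open>A coordinate outside the good range but at least -1/2 after the shift can only
      lie in the open interval from -1/2 to 1/2.\<close>
    obtain b where b: "-1/2 < \<gamma> $ b" "\<gamma> $ b < 1/2"
    proof (cases "\<alpha> $ j \<notin> {-3/2} \<union> {-1/2..}")
      case True
      then show ?thesis using that[of j] assms(1) \<gamma>j by auto
    next
      case False
      with h obtain i where "i \<noteq> j" "\<alpha> $ i \<notin> {-1/2} \<union> {1/2..}" by blast
      then show ?thesis using that[of i] assms(2)[of i] \<gamma>i[of i] by auto
    qed
    show "\<not> Lp_contractive Rplus (modified_laguerre \<alpha> j)"
      by (rule modified_laguerre_not_Lp_contractive[OF \<gamma>0[unfolded \<gamma>_def] b[unfolded \<gamma>_def]])
    have "c \<ge> 1" unfolding c_def by (intro prod_ge_1 laguerre_mass_ge_1)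
    \<comment> \<open>Adding 1 gives a constant strictly above 1 without evaluating the product; a
      larger constant keeps the upper bound valid.\<close>
    then have "c + 1 > 1" by simp
    moreover have "Lp_opnorm Rplus p (modified_laguerre \<alpha> j t) \<le> ennreal ((c + 1) * exp (- 2 * t) * cosh (2 * t) powr (- real CARD('n) / 2))"
      if "p \<ge> 1" "t > 0" for p t
      by (rule order_trans[OF opnorm[OF that] ennreal_leI]) (intro mult_right_mono, auto)
    ultimately show "\<exists>c>1. \<forall>p\<ge>1. \<forall>t>0. Lp_opnorm Rplus p (modified_laguerre \<alpha> j t)
            \<le> ennreal (c * exp (- 2 * t) * cosh (2 * t) powr (- real CARD('n) / 2))" by blast
  qed
  from good bad show ?thesis by blast
qed

end
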